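(* Suppose the elementary deduction problem for $E$ can be decided in time $O(f(m))$ on inputs of size $m$. Then there is a constant $k$ such that, for every normal-form sequent $\Gamma\vdash M$ (given as input by the DAG representation of $St(\Gamma\cup\{M\})$ described below), one can decide whether $\Gamma\vdash M$ is derivable in the system $\mathcal L$ in time $O(n^k\, f(n))$, where $n=\#St(\Gamma\cup\{M\})$. (That is, derivability in $\mathcal L$ is polynomially reducible to elementary deduction in $E$.)
   Context: Messages: names, and terms built with constructors $\mathsf{pub}$ (unary), $\mathsf{sign}$, $\mathsf{blind}$, $\langle\cdot,\cdot\rangle$, $\{\cdot\}_\cdot$ (binary) and function symbols of a finite signature $\Sigma_E$ disjoint from the constructors; all messages are ground. $E$ is an equational theory over $\Sigma_E$ with at most one AC symbol $\oplus$, presented by a rewrite system terminating and confluent modulo AC; $\equiv$ is equality modulo AC, $\approx_E$ equality modulo $E$; all terms in sequents are in $E$-normal form. A term is $E$-alien if headed by a symbol not in $\Sigma_E$; an $E$-alien subterm $A$ of $N$ is an $E$-factor of $N$ if it is an immediate subterm of a subterm of $N$ headed by a symbol of $\Sigma_E$ ($E$-factor of a set: of some member). An $E$-context is a term built from holes using only symbols of $\Sigma_E$. Elementary deduction problem for $E$: given $\Gamma, M$, decide whether there exist an $E$-context $C$ and $M_1,\ldots,M_k\in\Gamma$ with $C[M_1,\ldots,M_k]\approx_E M$. $\Gamma\Vdash_{\mathcal R} M$ means $\Gamma\vdash M$ is derivable using only: (id) $\Gamma\vdash M$ if $M\approx_E C[M_1,\ldots,M_k]$ for an $E$-context $C$ and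 $M_i\in\Gamma$; and the right rules: from $\Gamma\vdash M$ and $\Gamma\vdash N$ infer $\Gamma\vdash g(M,N)$ for $g\in\{\langle\cdot,\cdot\rangle,\{\cdot\}_\cdot,\mathsf{sign},\mathsf{blind}\}$. System $\mathcal L$ (single-premise rules, premise $\Rightarrow$ conclusion; $\Gamma, M$ means $\Gamma\cup\{M\}$): (r) $\Gamma\vdash M$ if $\Gamma\Vdash_{\mathcal R}M$; (lp) $\Gamma,\langle M,N\rangle,M,N\vdash T\Rightarrow\Gamma,\langle M,N\rangle\vdash T$; (le) $\Gamma,\{M\}_K,M,K\vdash N\Rightarrow\Gamma,\{M\}_K\vdash N$ if $\Gamma,\{M\}_K\Vdash_{\mathcal R}K$; ($\mathsf{sign}$) $\Gamma,\mathsf{sign}(M,K),\mathsf{pub}(L),M\vdash N\Rightarrow\Gamma,\mathsf{sign}(M,K),\mathsf{pub}(L)\vdash N$ if $K\equiv L$; ($\mathsf{blind}_1$) $\Gamma,\mathsf{blind}(M,K),M,K\vdash N\Rightarrow\Gamma,\mathsf{blind}(M,K)\vdash N$ if $\Gamma,\mathsf{blind}(M,K)\Vdash_{\mathcal R}K$; ($\mathsf{blind}_2$) $\Gamma,\mathsf{sign}(\mathsf{blind}(M,R),K),\mathsf{sign}(M,K),R\vdash N\Rightarrow\Gamma,\mathsf{sign}(\mathsf{blind}(M,R),K)\vdash N$ if $\Gamma,\mathsf{sign}(\mathsf{blind}(M,R),K)\Vdash_{\mathcal R}R$; (ls) $\Gamma,A\vdash M\Rightarrow\Gamma\vdash M$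 if $A$ is an $E$-factor of $\Gamma\cup\{M\}$ and $\Gamma\Vdash_{\mathcal R}A$. Saturated set: $St(\Gamma)=\Gamma\cup pst(\Gamma)\cup\{\mathsf{sign}(M,N)\mid M,N\in pst(\Gamma)\}$, where $pst(\Gamma)$ is the set of proper subterms of members of $\Gamma$; $\#$ denotes cardinality. Input representation: a directed acyclic graph with maximal sharing of subterms representing $St(\Gamma\cup\{M\})$, each node tagged (with a constant amount of information) to indicate whether its term occurs in $\Gamma$ or is $M$. *)

theory Defs
  imports Complex_Main "HOL-Library.Landau_Symbols"
begin

section \<open>Messages and the equational theory\<close>

datatype sym = Pub | Sign | Blind | Tup | Enc | Fn nat

datatype msg = Name nat | App sym "msg list"

abbreviation pub :: "msg \<Rightarrow> msg" where "pub M \<equiv> App Pub [M]"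
abbreviation sign :: "msg \<Rightarrow> msg \<Rightarrow> msg" where "sign M K \<equiv> App Sign [M, K]"
abbreviation blind :: "msg \<Rightarrow> msg \<Rightarrow> msg" where "blind M K \<equiv> App Blind [M, K]"
abbreviation pair :: "msg \<Rightarrow> msg \<Rightarrow> msg" where "pair M N \<equiv> App Tup [M, N]"
abbreviation enc :: "msg \<Rightarrow> msg \<Rightarrow> msg" where "enc M K \<equiv> App Enc [M, K]"

text \<open>Terms over \<open>\<Sigma>\<^sub>E\<close> with variables. They serve both as the two sides of rewrite rules and as
  \<open>E\<close>-contexts; in the latter case the variables are the holes.\<close>

datatype pat = PVar nat | PFn nat "pat list"

primrec holes :: "pat \<Rightarrow> nat set" where
  "holes (PVar i) = {i}"
| "holes (PFn f ps) = \<Union> (set (map holes ps))"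

primrec plug :: "(nat \<Rightarrow> msg) \<Rightarrow> pat \<Rightarrow> msg" where
  "plug \<sigma> (PVar i) = \<sigma> i"
| "plug \<sigma> (PFn f ps) = App (Fn f) (map (plug \<sigma>) ps)"

text \<open>A presentation of \<open>E\<close>. The function symbols of \<open>\<Sigma>\<^sub>E\<close> are named by the natural numbers in
  \<open>sig E\<close>, which is finite and possibly empty.\<close>

record eq_theory =
  sig :: "nat set"
  arity :: "nat \<Rightarrow> nat"
  ac_sym :: "nat option"
  rules :: "(pat \<times> pat) set"

primrec sym_arity :: "eq_theory \<Rightarrow> sym \<Rightarrow> nat" where
  "sym_arity E Pub = 1"
| "sym_arity E Sign = 2"
| "sym_arity E Blind = 2"
| "sym_arity E Tup = 2"
| "sym_arity E Enc = 2"
| "sym_arity E (Fn f) = arity E f"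

primrec wf_msg :: "eq_theory \<Rightarrow> msg \<Rightarrow> bool" where
  "wf_msg E (Name a) \<longleftrightarrow> True"
| "wf_msg E (App g Ms) \<longleftrightarrow> (\<forall>f. g = Fn f \<longrightarrow> f \<in> sig E) \<and> length Ms = sym_arity E g \<and>
     list_all (wf_msg E) Ms"

primrec wf_pat :: "eq_theory \<Rightarrow> pat \<Rightarrow> bool" where
  "wf_pat E (PVar i) \<longleftrightarrow> True"
| "wf_pat E (PFn f ps) \<longleftrightarrow> f \<in> sig E \<and> length ps = arity E f \<and> list_all (wf_pat E) ps"

inductive in_context :: "(msg \<Rightarrow> msg \<Rightarrow> bool) \<Rightarrow> msg \<Rightarrow> msg \<Rightarrow> bool" for r where
  root: "r s t \<Longrightarrow> in_context r s t"
| arg: "in_context r s t \<Longrightarrow> in_context r (App g (Ms @ s # Ns)) (App g (Ms @ t # Ns))"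

inductive ac_axiom :: "eq_theory \<Rightarrow> msg \<Rightarrow> msg \<Rightarrow> bool" for E where
  comm: "ac_sym E = Some p \<Longrightarrow> ac_axiom E (App (Fn p) [a, b]) (App (Fn p) [b, a])"
| assoc: "ac_sym E = Some p \<Longrightarrow>
    ac_axiom E (App (Fn p) [App (Fn p) [a, b], c]) (App (Fn p) [a, App (Fn p) [b, c]])"

definition ac_eq :: "eq_theory \<Rightarrow> msg \<Rightarrow> msg \<Rightarrow> bool" where
  "ac_eq E = equivclp (in_context (ac_axiom E))"

text \<open>Only well-formed instances are taken, because a rule need not be variable-preserving and its
  backward use in \<open>eq_E\<close> should not introduce ill-formed terms.\<close>

inductive rule_instance :: "eq_theory \<Rightarrow> msg \<Rightarrow> msg \<Rightarrow> bool" for E where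
  "(l, r) \<in> rules E \<Longrightarrow> (\<And>i. wf_msg E (\<sigma> i)) \<Longrightarrow> rule_instance E (plug \<sigma> l) (plug \<sigma> r)"

definition eq_E :: "eq_theory \<Rightarrow> msg \<Rightarrow> msg \<Rightarrow> bool" where
  "eq_E E = equivclp (sup (in_context (ac_axiom E)) (in_context (rule_instance E)))"

text \<open>Rewriting modulo AC, i.e. rewriting of AC-equivalence classes.\<close>

definition rewrite_ac :: "eq_theory \<Rightarrow> msg \<Rightarrow> msg \<Rightarrow> bool" where
  "rewrite_ac E = ac_eq E OO in_context (rule_instance E) OO ac_eq E"

definition normal :: "eq_theory \<Rightarrow> msg \<Rightarrow> bool" where
  "normal E M \<longleftrightarrow> \<not> (\<exists>N. rewrite_ac E M N)"

definition terminating_ac :: "eq_theory \<Rightarrow> bool" where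
  "terminating_ac E \<longleftrightarrow> wfp (\<lambda>t s. wf_msg E s \<and> rewrite_ac E s t)"

definition confluent_ac :: "eq_theory \<Rightarrow> bool" where
  "confluent_ac E \<longleftrightarrow> (\<forall>s s' t t'. wf_msg E s \<longrightarrow> wf_msg E s' \<longrightarrow> ac_eq E s s' \<longrightarrow>
     (rewrite_ac E)\<^sup>*\<^sup>* s t \<longrightarrow> (rewrite_ac E)\<^sup>*\<^sup>* s' t' \<longrightarrow>
     (\<exists>u u'. (rewrite_ac E)\<^sup>*\<^sup>* t u \<and> (rewrite_ac E)\<^sup>*\<^sup>* t' u' \<and> ac_eq E u u'))"

definition convergent_theory :: "eq_theory \<Rightarrow> bool" where
  "convergent_theory E \<longleftrightarrow>
     finite (sig E) \<and>
     (\<forall>p. ac_sym E = Some p \<longrightarrow> p \<in> sig E \<and> arity E p = 2) \<and>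
     (\<forall>(l, r) \<in> rules E. wf_pat E l \<and> wf_pat E r) \<and>
     terminating_ac E \<and> confluent_ac E"

section \<open>Subterms, factors and saturated sets\<close>

primrec subterms :: "msg \<Rightarrow> msg set" where
  "subterms (Name a) = {Name a}"
| "subterms (App g Ms) = insert (App g Ms) (\<Union> (set (map subterms Ms)))"

definition pst :: "msg set \<Rightarrow> msg set" where
  "pst \<Gamma> = (\<Union>M \<in> \<Gamma>. subterms M - {M})"

definition St :: "msg set \<Rightarrow> msg set" where
  "St \<Gamma> = \<Gamma> \<union> pst \<Gamma> \<union> {sign M N | M N. M \<in> pst \<Gamma> \<and> N \<in> pst \<Gamma>}"

definition E_headed :: "eq_theory \<Rightarrow> msg \<Rightarrow> bool" where
  "E_headed E M \<longleftrightarrow> (\<exists>f Ms. f \<in> sig E \<and> M = App (Fn f) Ms)"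

definition alien :: "eq_theory \<Rightarrow> msg \<Rightarrow> bool" where
  "alien E M \<longleftrightarrow> \<not> E_headed E M"

definition immediate_subterm :: "msg \<Rightarrow> msg \<Rightarrow> bool" where
  "immediate_subterm A F \<longleftrightarrow> (\<exists>g Ms. F = App g Ms \<and> A \<in> set Ms)"

definition factor :: "eq_theory \<Rightarrow> msg \<Rightarrow> msg \<Rightarrow> bool" where
  "factor E A N \<longleftrightarrow> alien E A \<and> A \<in> subterms N \<and>
     (\<exists>F \<in> subterms N. E_headed E F \<and> immediate_subterm A F)"

section \<open>Elementary deduction and the proof systems\<close>

definition elementary :: "eq_theory \<Rightarrow> msg set \<Rightarrow> msg \<Rightarrow> bool" where
  "elementary E \<Gamma> M \<longleftrightarrow>
     (\<exists>C \<sigma>. wf_pat E C \<and> (\<forall>i \<in> holes C. \<sigma> i \<in> \<Gamma>) \<and> eq_E E (plug \<sigma> C) M)"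

inductive right_deriv :: "eq_theory \<Rightarrow> msg set \<Rightarrow> msg \<Rightarrow> bool" for E \<Gamma> where
  id: "elementary E \<Gamma> M \<Longrightarrow> right_deriv E \<Gamma> M"
| pR: "right_deriv E \<Gamma> M \<Longrightarrow> right_deriv E \<Gamma> N \<Longrightarrow> right_deriv E \<Gamma> (pair M N)"
| eR: "right_deriv E \<Gamma> M \<Longrightarrow> right_deriv E \<Gamma> N \<Longrightarrow> right_deriv E \<Gamma> (enc M N)"
| signR: "right_deriv E \<Gamma> M \<Longrightarrow> right_deriv E \<Gamma> N \<Longrightarrow> right_deriv E \<Gamma> (sign M N)"
| blindR: "right_deriv E \<Gamma> M \<Longrightarrow> right_deriv E \<Gamma> N \<Longrightarrow> right_deriv E \<Gamma> (blind M N)"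

inductive L_deriv :: "eq_theory \<Rightarrow> msg set \<Rightarrow> msg \<Rightarrow> bool" for E where
  r: "right_deriv E \<Gamma> M \<Longrightarrow> L_deriv E \<Gamma> M"
| lp: "L_deriv E (\<Gamma> \<union> {pair M N, M, N}) T \<Longrightarrow> L_deriv E (\<Gamma> \<union> {pair M N}) T"
| le: "right_deriv E (\<Gamma> \<union> {enc M K}) K \<Longrightarrow>
    L_deriv E (\<Gamma> \<union> {enc M K, M, K}) N \<Longrightarrow> L_deriv E (\<Gamma> \<union> {enc M K}) N"
| sign: "ac_eq E K L \<Longrightarrow>
    L_deriv E (\<Gamma> \<union> {sign M K, pub L, M}) N \<Longrightarrow> L_deriv E (\<Gamma> \<union> {sign M K, pub L}) N"
| blind1: "right_deriv E (\<Gamma> \<union> {blind M K}) K \<Longrightarrow>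
    L_deriv E (\<Gamma> \<union> {blind M K, M, K}) N \<Longrightarrow> L_deriv E (\<Gamma> \<union> {blind M K}) N"
| blind2: "right_deriv E (\<Gamma> \<union> {sign (blind M R) K}) R \<Longrightarrow>
    L_deriv E (\<Gamma> \<union> {sign (blind M R) K, sign M K, R}) N \<Longrightarrow>
    L_deriv E (\<Gamma> \<union> {sign (blind M R) K}) N"
| ls: "\<exists>N \<in> \<Gamma> \<union> {M}. factor E A N \<Longrightarrow> right_deriv E \<Gamma> A \<Longrightarrow>
    L_deriv E (\<Gamma> \<union> {A}) M \<Longrightarrow> L_deriv E \<Gamma> M"

definition normal_sequent :: "eq_theory \<Rightarrow> msg set \<Rightarrow> msg \<Rightarrow> bool" where
  "normal_sequent E \<Gamma> M \<longleftrightarrow> finite \<Gamma> \<and> (\<forall>N \<in> \<Gamma> \<union> {M}. wf_msg E N \<and> normal E N)"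

section \<open>DAG representation of sequents\<close>

text \<open>A node carries its symbol (\<open>None\<close> for a name), the indices of its children, and the two tags
  ``occurs in \<open>\<Gamma>\<close>'' and ``is the right-hand side''. Name nodes carry no identifier: since sharing is
  maximal, different name nodes stand for different names. The nodes may be listed in any order;
  a cyclic graph represents nothing, because terms are finite.\<close>

datatype node = Node (node_sym: "sym option") (children: "nat list") (in_left: bool) (is_goal: bool)

type_synonym dag = "node list"

primrec root_sym :: "msg \<Rightarrow> sym option" where
  "root_sym (Name a) = None"
| "root_sym (App g Ms) = Some g"

primrec arguments :: "msg \<Rightarrow> msg list" where
  "arguments (Name a) = []"
| "arguments (App g Ms) = Ms"

definition represents :: "dag \<Rightarrow> msg set \<Rightarrow> msg \<Rightarrow> bool" where
  "represents G \<Gamma> M \<longleftrightarrow>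
     (\<exists>term_of. bij_betw term_of {..<length G} (St (\<Gamma> \<union> {M})) \<and>
        (\<forall>i < length G.
           root_sym (term_of i) = node_sym (G ! i) \<and>
           set (children (G ! i)) \<subseteq> {..<length G} \<and>
           arguments (term_of i) = map term_of (children (G ! i)) \<and>
           (in_left (G ! i) \<longleftrightarrow> term_of i \<in> \<Gamma>) \<and>
           (is_goal (G ! i) \<longleftrightarrow> term_of i = M)))"

section \<open>Machine model\<close>

text \<open>Jones's WHILE language (Computability and Complexity from a Programming Perspective), with its
  unit-cost time measure: programs over binary trees with a single atom. Up to a polynomial, its
  running times agree with those of Turing machines and of random access machines. There is no
  unit-cost comparison of trees; the only test is whether a value is the atom.\<close>

datatype tree = Atom | Cell tree tree

primrec hd_tree :: "tree \<Rightarrow> tree" where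
  "hd_tree Atom = Atom"
| "hd_tree (Cell a b) = a"

primrec tl_tree :: "tree \<Rightarrow> tree" where
  "tl_tree Atom = Atom"
| "tl_tree (Cell a b) = b"

datatype expr = Var nat | Nil_expr | Cons_expr expr expr | Hd expr | Tl expr

datatype com = Assign nat expr | Seq com com | Cond expr com com | While expr com

type_synonym store = "nat \<Rightarrow> tree"

primrec eval_expr :: "store \<Rightarrow> expr \<Rightarrow> tree" where
  "eval_expr s (Var x) = s x"
| "eval_expr s Nil_expr = Atom"
| "eval_expr s (Cons_expr e e') = Cell (eval_expr s e) (eval_expr s e')"
| "eval_expr s (Hd e) = hd_tree (eval_expr s e)"
| "eval_expr s (Tl e) = tl_tree (eval_expr s e)"

primrec cost :: "expr \<Rightarrow> nat" where
  "cost (Var x) = 1"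
| "cost Nil_expr = 1"
| "cost (Cons_expr e e') = 1 + cost e + cost e'"
| "cost (Hd e) = 1 + cost e"
| "cost (Tl e) = 1 + cost e"

inductive exec :: "com \<Rightarrow> store \<Rightarrow> nat \<Rightarrow> store \<Rightarrow> bool" where
  Assign: "exec (Assign x e) s (1 + cost e) (s(x := eval_expr s e))"
| Seq: "exec c s t s' \<Longrightarrow> exec d s' t' s'' \<Longrightarrow> exec (Seq c d) s (t + t') s''"
| CondTrue: "eval_expr s e \<noteq> Atom \<Longrightarrow> exec c s t s' \<Longrightarrow> exec (Cond e c d) s (1 + cost e + t) s'"
| CondFalse: "eval_expr s e = Atom \<Longrightarrow> exec d s t s' \<Longrightarrow> exec (Cond e c d) s (1 + cost e + t) s'"
| WhileFalse: "eval_expr s e = Atom \<Longrightarrow> exec (While e c) s (1 + cost e) s"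
| WhileTrue: "eval_expr s e \<noteq> Atom \<Longrightarrow> exec c s t s' \<Longrightarrow> exec (While e c) s' t' s'' \<Longrightarrow>
    exec (While e c) s (1 + cost e + t + t') s''"

text \<open>The input is read from variable 0, all other variables being initialised with the atom, and the
  answer is read from variable 1.\<close>

definition answers :: "com \<Rightarrow> tree \<Rightarrow> nat \<Rightarrow> bool \<Rightarrow> bool" where
  "answers p d t b \<longleftrightarrow> (\<exists>s. exec p ((\<lambda>_. Atom)(0 := d)) t s \<and> (b \<longleftrightarrow> s 1 \<noteq> Atom))"

primrec tree_of_list :: "tree list \<Rightarrow> tree" where
  "tree_of_list [] = Atom"
| "tree_of_list (d # ds) = Cell d (tree_of_list ds)"

definition tree_of_nat :: "nat \<Rightarrow> tree" where
  "tree_of_nat n = tree_of_list (replicate n Atom)"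

definition tree_of_bool :: "bool \<Rightarrow> tree" where
  "tree_of_bool b = tree_of_nat (of_bool b)"

primrec sym_code :: "sym \<Rightarrow> nat" where
  "sym_code Pub = 1"
| "sym_code Sign = 2"
| "sym_code Blind = 3"
| "sym_code Tup = 4"
| "sym_code Enc = 5"
| "sym_code (Fn f) = 6 + f"

definition tree_of_node :: "node \<Rightarrow> tree" where
  "tree_of_node v = tree_of_list
     [tree_of_nat (case node_sym v of None \<Rightarrow> 0 | Some g \<Rightarrow> sym_code g),
      tree_of_list (map tree_of_nat (children v)),
      tree_of_bool (in_left v),
      tree_of_bool (is_goal v)]"

definition tree_of_dag :: "dag \<Rightarrow> tree" where
  "tree_of_dag G = tree_of_list (map tree_of_node G)"

text \<open>\<open>P\<close>, a relation between a set of messages and a message, is decidable in time \<open>O(f(n))\<close> on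
  normal-form sequents \<open>\<Gamma> \<turnstile> M\<close>, where \<open>n\<close> is the number of nodes of the input DAG.\<close>

definition decidable_in_time ::
    "eq_theory \<Rightarrow> (msg set \<Rightarrow> msg \<Rightarrow> bool) \<Rightarrow> (nat \<Rightarrow> real) \<Rightarrow> bool" where
  "decidable_in_time E P f \<longleftrightarrow>
     (\<exists>(p :: com) (T :: nat \<Rightarrow> nat).
        (\<lambda>n. real (T n)) \<in> O(f) \<and>
        (\<forall>\<Gamma> M G. normal_sequent E \<Gamma> M \<longrightarrow> represents G \<Gamma> M \<longrightarrow>
           (\<exists>t \<le> T (card (St (\<Gamma> \<union> {M}))). answers p (tree_of_dag G) t (P \<Gamma> M))))"

end

theory Submission
  imports Defs
begin

text \<open>Every left rule of the system only adds members of the saturated set to the left-hand side, and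
  right derivability is monotone in it. Hence a sequent is derivable iff its right-hand side is right
  derivable from the closure of its left-hand side under the left rules, which is a fixpoint reached
  after at most as many rounds as the DAG has nodes. Right derivability is itself such a fixpoint,
  over the nodes of the DAG, with elementary deduction as its only non-trivial ingredient.

  Every elementary deduction problem that arises concerns members of the saturated set, and is posed
  on a DAG of exactly the same size as the input: nodes that the problem does not need are replaced by
  fresh names that are added to the left-hand side, which does not affect elementary deducibility. So
  nothing has to be assumed about the growth of \<open>f\<close>. The test \<open>K \<equiv> L\<close> is also an elementary
  deduction problem, namely \<open>sign(K, K) \<turnstile> sign(K, L)\<close>.

  All of this is expressed by a formula of a fixpoint logic, and such formulas are compiled to programs
  that use polynomially many steps and queries.\<close>

section \<open>The equational theory\<close>

text \<open>The only left rule whose result need not be a subterm is \<open>blind2\<close>, and it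
  yields a signature of two proper subterms. This explains the signatures in the saturated set and
  keeps the closure among the nodes. The signatures in the query for \<open>K \<equiv> L\<close> are
  nodes too, as \<open>K\<close> and \<open>L\<close> lie directly below a signature and a public
  key. Since \<open>f\<close> is arbitrary, a query of another size could cost more than
  \<open>f n\<close> allows, which forces the padding. It is harmless because renaming can send all
  fresh names to a member of the left-hand side. If there is none, convergence is used instead: the
  goal is normal, so it is AC-equal to a normal form of a context over fresh names; as it contains
  none of them, it is a closed term over the signature. The formula depends on \<open>E\<close>
  only, through a bound on arities. Its connectives multiply costs by powers of \<open>n\<close> and
  merely add query times, so \<open>f\<close> enters the final bound linearly.\<close>

lemma in_context_swap: "in_context r s t \<longleftrightarrow> in_context (\<lambda>a b. r b a) t s"
proof -
  have "in_context r s t \<Longrightarrow> in_context (\<lambda>a b. r b a) t s" for r s t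
    by (induction rule: in_context.induct) (auto intro: in_context.intros)
  from this[of r s t] this[of "\<lambda>a b. r b a" t s] show ?thesis by auto
qed

lemma in_context_mono: "in_context r s t \<Longrightarrow> (\<And>a b. r a b \<Longrightarrow> q a b) \<Longrightarrow> in_context q s t"
  by (induction rule: in_context.induct) (auto intro: in_context.intros)

lemma in_context_or:
  "in_context (\<lambda>a b. r a b \<or> q a b) s t \<longleftrightarrow> in_context r s t \<or> in_context q s t"
proof
  show "in_context (\<lambda>a b. r a b \<or> q a b) s t \<Longrightarrow> in_context r s t \<or> in_context q s t"
    by (induction rule: in_context.induct) (auto intro: in_context.intros)
qed (auto elim: in_context_mono)

lemma in_context_App_cases:
  assumes "in_context r (App g Ms) v"
  obtains "r (App g Ms) v"
  | Ps s t Qs where "Ms = Ps @ s # Qs" "v = App g (Ps @ t # Qs)" "in_context r s t"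
  using assms by (cases rule: in_context.cases) auto

lemma in_context_Name: "in_context r (Name a) v \<longleftrightarrow> r (Name a) v"
  by (auto elim: in_context.cases intro: in_context.intros)

text \<open>Symmetrising the axioms below the context lets inductions on AC equality treat both
  directions as one step.\<close>

definition ac_step :: "eq_theory \<Rightarrow> msg \<Rightarrow> msg \<Rightarrow> bool" where
  "ac_step E = in_context (\<lambda>a b. ac_axiom E a b \<or> ac_axiom E b a)"

lemma ac_step_iff: "ac_step E s t \<longleftrightarrow> in_context (ac_axiom E) s t \<or> in_context (ac_axiom E) t s"
  unfolding ac_step_def in_context_or using in_context_swap by metis

lemma ac_eq_refl [simp]: "ac_eq E s s"
  by (simp add: ac_eq_def)

lemma ac_eq_sym: "ac_eq E s t \<Longrightarrow> ac_eq E t s"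
  unfolding ac_eq_def by (rule equivclp_sym)

lemma ac_eq_trans [trans]: "ac_eq E s t \<Longrightarrow> ac_eq E t u \<Longrightarrow> ac_eq E s u"
  unfolding ac_eq_def by (rule equivclp_trans)

lemma ac_eq_step: "ac_step E s t \<Longrightarrow> ac_eq E s t"
  unfolding ac_eq_def ac_step_iff by (metis r_into_equivclp converse_r_into_equivclp)

lemma ac_eq_induct [consumes 1, case_names refl step]:
  assumes "ac_eq E s t" "P s" "\<And>u v. ac_eq E s u \<Longrightarrow> ac_step E u v \<Longrightarrow> P u \<Longrightarrow> P v"
  shows "P t"
  using assms(1,2) unfolding ac_eq_def
proof (rule equivclp_induct)
  fix y z
  assume "equivclp (in_context (ac_axiom E)) s y"
    "in_context (ac_axiom E) y z \<or> in_context (ac_axiom E) z y" "P y"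
  then show "P z" using assms(3)[of y z] by (simp add: ac_eq_def ac_step_iff)
qed

lemma ac_eq_arg:
  assumes "ac_eq E s t" shows "ac_eq E (App g (Ps @ s # Qs)) (App g (Ps @ t # Qs))"
  using assms
proof (induction rule: ac_eq_induct)
  case (step u v)
  then have "ac_step E (App g (Ps @ u # Qs)) (App g (Ps @ v # Qs))"
    by (simp add: ac_step_def in_context.arg)
  with step show ?case by (meson ac_eq_step ac_eq_trans)
qed simp

lemma ac_step_root_sym: "ac_step E s t \<Longrightarrow> root_sym s = root_sym t"
  unfolding ac_step_def by (induction rule: in_context.induct) (auto elim: ac_axiom.cases)

lemma ac_eq_root_sym: "ac_eq E s t \<Longrightarrow> root_sym s = root_sym t"
  by (induction rule: ac_eq_induct) (auto dest: ac_step_root_sym)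

lemma E_headed_root_sym: "E_headed E M \<longleftrightarrow> (\<exists>f \<in> sig E. root_sym M = Some (Fn f))"
  by (cases M) (auto simp: E_headed_def)

lemma ac_eq_alien: "ac_eq E s t \<Longrightarrow> alien E s \<longleftrightarrow> alien E t"
  by (simp add: alien_def E_headed_root_sym ac_eq_root_sym)

lemma ac_axiom_root_sym:
  "ac_axiom E s t \<Longrightarrow> \<exists>p. root_sym s = Some (Fn p) \<and> root_sym t = Some (Fn p) \<and> ac_sym E = Some p"
  by (auto elim: ac_axiom.cases)

lemma ac_step_sign:
  "ac_step E (sign M K) v \<Longrightarrow> \<exists>M' K'. v = sign M' K' \<and> ac_eq E M M' \<and> ac_eq E K K'"
  unfolding ac_step_def
  by (erule in_context_App_cases)
    (auto dest: ac_axiom_root_sym simp: ac_step_def[symmetric] append_eq_Cons_conv Cons_eq_append_conv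
      intro: ac_eq_step)

lemma ac_eq_sign:
  assumes "ac_eq E (sign M K) v"
  shows "\<exists>M' K'. v = sign M' K' \<and> ac_eq E M M' \<and> ac_eq E K K'"
  using assms by (induction rule: ac_eq_induct) (auto dest!: ac_step_sign intro: ac_eq_trans)

lemma ac_eq_Name: "ac_eq E (Name a) u \<Longrightarrow> u = Name a"
  by (induction rule: ac_eq_induct) (auto simp: ac_step_def in_context_Name dest: ac_axiom_root_sym)

lemma ac_eq_signI: "ac_eq E K L \<Longrightarrow> ac_eq E (sign M K) (sign M L)"
  using ac_eq_arg[of E K L Sign "[M]" "[]"] by simp

lemma eq_E_trans: "eq_E E s t \<Longrightarrow> eq_E E t u \<Longrightarrow> eq_E E s u"
  unfolding eq_E_def by (rule equivclp_trans)

lemma eq_E_induct [consumes 1, case_names refl ac rule rule_sym]: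
  assumes "eq_E E s t" "P s" "\<And>u v. eq_E E s u \<Longrightarrow> ac_step E u v \<Longrightarrow> P u \<Longrightarrow> P v"
    "\<And>u v. eq_E E s u \<Longrightarrow> in_context (rule_instance E) u v \<Longrightarrow> P u \<Longrightarrow> P v"
    "\<And>u v. eq_E E s u \<Longrightarrow> in_context (rule_instance E) v u \<Longrightarrow> P u \<Longrightarrow> P v"
  shows "P t"
  using assms(1,2) unfolding eq_E_def
proof (rule equivclp_induct)
  fix y z
  assume "equivclp (sup (in_context (ac_axiom E)) (in_context (rule_instance E))) s y"
    "sup (in_context (ac_axiom E)) (in_context (rule_instance E)) y z \<or>
       sup (in_context (ac_axiom E)) (in_context (rule_instance E)) z y" "P y"
  then show "P z" using assms(3-5)[of y z] by (auto simp: eq_E_def ac_step_iff)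
qed

lemma eq_E_rule: "in_context (rule_instance E) s t \<Longrightarrow> eq_E E s t"
  unfolding eq_E_def by (rule r_into_equivclp) simp

lemma eq_E_refl [simp]: "eq_E E s s"
  by (simp add: eq_E_def)

lemma eq_E_sym: "eq_E E s t \<Longrightarrow> eq_E E t s"
  unfolding eq_E_def by (rule equivclp_sym)

lemma eq_E_ac: "ac_eq E s t \<Longrightarrow> eq_E E s t"
proof (induction rule: ac_eq_induct)
  case (step u v)
  then have "eq_E E u v"
    unfolding eq_E_def ac_step_iff by (metis r_into_equivclp converse_r_into_equivclp sup2I1)
  with step show ?case by (meson eq_E_trans)
qed simp

subsection \<open>Rewriting modulo AC\<close>

lemma rewrite_ac_iff:
  "rewrite_ac E s t \<longleftrightarrow> (\<exists>u v. ac_eq E s u \<and> in_context (rule_instance E) u v \<and> ac_eq E v t)"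
  by (auto simp: rewrite_ac_def relcompp_apply)

lemma rewrite_ac_arg:
  "rewrite_ac E s t \<Longrightarrow> rewrite_ac E (App g (Ps @ s # Qs)) (App g (Ps @ t # Qs))"
  unfolding rewrite_ac_iff by (meson ac_eq_arg in_context.arg)

lemma rewrite_ac_rule: "in_context (rule_instance E) s t \<Longrightarrow> rewrite_ac E s t"
  unfolding rewrite_ac_iff by (meson ac_eq_refl)

lemma rewrite_ac_cong: "ac_eq E s u \<Longrightarrow> rewrite_ac E u v \<Longrightarrow> rewrite_ac E s v"
  by (meson rewrite_ac_iff ac_eq_trans)

lemma subterms_refl [simp]: "M \<in> subterms M"
  by (cases M) auto

lemma subterms_trans: "A \<in> subterms B \<Longrightarrow> B \<in> subterms C \<Longrightarrow> A \<in> subterms C"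
  by (induction C) auto

lemma wf_msg_subterm: "A \<in> subterms M \<Longrightarrow> wf_msg E M \<Longrightarrow> wf_msg E A"
  by (induction M) (auto simp: list_all_iff)

lemma normal_subterm: "A \<in> subterms M \<Longrightarrow> normal E M \<Longrightarrow> normal E A"
proof (induction M)
  case (App g Ms)
  show ?case
  proof (cases "A = App g Ms")
    case False
    then obtain N where N: "N \<in> set Ms" "A \<in> subterms N" using App.prems by auto
    then obtain Ps Qs where "Ms = Ps @ N # Qs" by (meson split_list)
    then have "normal E N"
      using App.prems(2) rewrite_ac_arg unfolding normal_def by blast
    then show ?thesis using App.IH N by blast
  qed (use App in simp)
qed simp

lemma normal_ac_eq: "ac_eq E s t \<Longrightarrow> normal E t \<Longrightarrow> normal E s"
  unfolding normal_def by (meson rewrite_ac_cong ac_eq_sym)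

lemma wf_msg_plug: "wf_pat E q \<Longrightarrow> (\<And>i. i \<in> holes q \<Longrightarrow> wf_msg E (\<sigma> i)) \<Longrightarrow> wf_msg E (plug \<sigma> q)"
  by (induction q) (auto simp: list_all_iff)

lemma plug_cong: "(\<And>i. i \<in> holes q \<Longrightarrow> \<sigma> i = \<tau> i) \<Longrightarrow> plug \<sigma> q = plug \<tau> q"
  by (induction q) auto

lemma hole_subterm_plug: "i \<in> holes q \<Longrightarrow> \<sigma> i \<in> subterms (plug \<sigma> q)"
  by (induction q) auto

section \<open>Consequences of termination and confluence\<close>

locale convergent =
  fixes E :: eq_theory
  assumes conv: "convergent_theory E"
begin

lemma finite_sig: "finite (sig E)"
  and ac_sym_sig: "ac_sym E = Some p \<Longrightarrow> p \<in> sig E \<and> arity E p = 2"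
  and rules_wf: "(l, r) \<in> rules E \<Longrightarrow> wf_pat E l \<and> wf_pat E r"
  and terminating: "terminating_ac E"
  and confluent: "confluent_ac E"
  using conv by (auto simp: convergent_theory_def)

lemma wf_msg_in_context:
  "in_context q s t \<Longrightarrow> (\<And>a b. q a b \<Longrightarrow> wf_msg E a \<longleftrightarrow> wf_msg E b) \<Longrightarrow>
    wf_msg E s \<longleftrightarrow> wf_msg E t"
  by (induction rule: in_context.induct) (auto simp: list_all_iff)

lemma ac_axiom_wf: "ac_axiom E a b \<Longrightarrow> wf_msg E a \<longleftrightarrow> wf_msg E b"
  by (auto elim!: ac_axiom.cases dest: ac_sym_sig)

lemma rule_instance_wf: "rule_instance E a b \<Longrightarrow> wf_msg E a \<and> wf_msg E b"
  by (auto elim!: rule_instance.cases intro!: wf_msg_plug dest: rules_wf)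

lemma wf_msg_ac_step: "ac_step E s t \<Longrightarrow> wf_msg E s \<longleftrightarrow> wf_msg E t"
  unfolding ac_step_def by (erule wf_msg_in_context) (auto simp: ac_axiom_wf)

lemma wf_msg_rule: "in_context (rule_instance E) s t \<Longrightarrow> wf_msg E s \<longleftrightarrow> wf_msg E t"
  by (erule wf_msg_in_context) (auto dest: rule_instance_wf)

lemma wf_msg_eq_E: "eq_E E s t \<Longrightarrow> wf_msg E s \<longleftrightarrow> wf_msg E t"
  by (induction rule: eq_E_induct) (auto simp: wf_msg_ac_step wf_msg_rule)

text \<open>Such a rule would rewrite every well-formed message to a well-formed one, so by
  well-founded induction there would be none; but names are well-formed.\<close>

lemma rule_lhs_not_PVar:
  assumes "(l, r) \<in> rules E" shows "l \<noteq> PVar x"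
proof
  assume l: "l = PVar x"
  have "\<not> wf_msg E s" for s
  proof (induction s rule: wfp_induct_rule[OF terminating[unfolded terminating_ac_def]])
    case (1 s)
    show ?case
    proof
      assume s: "wf_msg E s"
      have ri: "rule_instance E (plug (\<lambda>_. s) l) (plug (\<lambda>_. s) r)"
        using assms s by (intro rule_instance.intros)
      then have "rewrite_ac E s (plug (\<lambda>_. s) r)"
        using l by (auto intro!: rewrite_ac_rule intro: in_context.root)
      with 1 s rule_instance_wf[OF ri] show False by blast
    qed
  qed
  from this[of "Name 0"] show False by simp
qed

text \<open>\<open>M'\<close> is \<open>M\<close> with one occurrence of \<open>A\<close> replaced
  by \<open>B\<close>; it carries a root step over to any message containing the redex.\<close>

lemma in_context_subterm:
  assumes "A \<in> subterms M"
  shows "\<exists>M'. B \<in> subterms M' \<and> (\<forall>q. q A B \<longrightarrow> in_context q M M')"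
  using assms
proof (induction M)
  case (App g Ms)
  show ?case
  proof (cases "A = App g Ms")
    case False
    then obtain N where N: "N \<in> set Ms" "A \<in> subterms N" using App.prems by auto
    then obtain Ps Qs where Ms: "Ms = Ps @ N # Qs" by (meson split_list)
    obtain N' where "B \<in> subterms N'" "\<forall>q. q A B \<longrightarrow> in_context q N N'"
      using App.IH N by blast
    then show ?thesis
      by (intro exI[of _ "App g (Ps @ N' # Qs)"]) (auto simp: Ms intro: in_context.arg)
  qed (auto intro!: exI[of _ B] in_context.root)
qed (auto intro!: exI[of _ B] in_context.root)

text \<open>If \<open>y\<close> occurred on the right only, it could be instantiated with an
  instance of the left-hand side: the contractum would contain the redex again, and rewriting would
  never end.\<close>

lemma rule_holes:
  assumes "(l, r) \<in> rules E" shows "holes r \<subseteq> holes l"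
proof
  fix y assume y: "y \<in> holes r"
  show "y \<in> holes l"
  proof (rule ccontr)
    assume yl: "y \<notin> holes l"
    define L where "L = plug (\<lambda>_. Name 0) l"
    have "wf_msg E L" unfolding L_def using rules_wf[OF assms] by (auto intro: wf_msg_plug)
    define \<sigma> where "\<sigma> = (\<lambda>_. Name 0)(y := L)"
    have L: "plug \<sigma> l = L"
      unfolding L_def by (rule plug_cong) (use yl in \<open>auto simp: \<sigma>_def\<close>)
    have R: "L \<in> subterms (plug \<sigma> r)"
      using hole_subterm_plug[OF y, of \<sigma>] by (simp add: \<sigma>_def)
    have ri: "rule_instance E L (plug \<sigma> r)"
      using rule_instance.intros[OF assms, of \<sigma>] \<open>wf_msg E L\<close> L by (simp add: \<sigma>_def)
    \<comment> \<open>A step leads from any message containing \<open>L\<close> to another one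
      containing \<open>L\<close>, so termination leaves no well-formed message of this
      kind.\<close>
    have "L \<in> subterms s \<Longrightarrow> \<not> wf_msg E s" for s
    proof (induction s rule: wfp_induct_rule[OF terminating[unfolded terminating_ac_def]])
      case (1 s)
      obtain s' where s': "plug \<sigma> r \<in> subterms s'" "in_context (rule_instance E) s s'"
        using in_context_subterm[OF 1(2)] ri by blast
      show ?case
        using 1(1)[of s'] rewrite_ac_rule[OF s'(2)] wf_msg_rule[OF s'(2)] subterms_trans[OF R s'(1)]
        by blast
    qed
    then show False using \<open>wf_msg E L\<close> by auto
  qed
qed

text \<open>Since left-hand sides are not variables, constructors and names never head a
  redex.\<close>

lemma rule_instance_root_sym: "rule_instance E s t \<Longrightarrow> \<exists>f. f \<in> sig E \<and> root_sym s = Some (Fn f)"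
  by (erule rule_instance.cases, rename_tac l r \<sigma>, case_tac l)
    (auto dest: rule_lhs_not_PVar rules_wf)

lemma normal_Name [simp]: "normal E (Name a)"
  by (auto simp: normal_def rewrite_ac_iff in_context_Name dest!: ac_eq_Name rule_instance_root_sym)

text \<open>The saturated set contains signatures that need not occur in the sequent, and queries
  about them need normal messages. Up to AC, a step on a signature happens inside one of its two
  arguments.\<close>

lemma normal_sign:
  assumes "normal E M" "normal E K" shows "normal E (sign M K)"
  unfolding normal_def
proof
  assume "\<exists>N. rewrite_ac E (sign M K) N"
  then obtain u v where u: "ac_eq E (sign M K) u" "in_context (rule_instance E) u v"
    by (auto simp: rewrite_ac_iff)
  then obtain M' K' where MK: "u = sign M' K'" "ac_eq E M M'" "ac_eq E K K'"
    by (auto dest: ac_eq_sign)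
  then have "normal E M'" "normal E K'" using assms normal_ac_eq ac_eq_sym by blast+
  moreover from u(2) have "\<exists>s t. s \<in> {M', K'} \<and> in_context (rule_instance E) s t"
    unfolding MK(1)
    by (cases rule: in_context_App_cases)
      (auto dest!: rule_instance_root_sym simp: append_eq_Cons_conv Cons_eq_append_conv)
  ultimately show False unfolding normal_def using rewrite_ac_rule by blast
qed

text \<open>A nonempty rewrite sequence absorbs the AC equality into its first step; only the empty
  one leaves it over, hence the \<open>w\<close>.\<close>

lemma rewrite_steps_cong:
  assumes "ac_eq E s u" "(rewrite_ac E)\<^sup>*\<^sup>* u v"
  shows "\<exists>w. (rewrite_ac E)\<^sup>*\<^sup>* s w \<and> ac_eq E w v"
  using assms(2)
proof (cases rule: converse_rtranclpE)
  case base
  then show ?thesis using assms by auto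
next
  case (step y)
  then have "(rewrite_ac E)\<^sup>*\<^sup>* s v"
    by (meson assms(1) rewrite_ac_cong converse_rtranclp_into_rtranclp)
  then show ?thesis by auto
qed

text \<open>Joinability \<open>J\<close> is transitive by confluence at the middle message.
  Confluence is only given for well-formed messages, and \<open>wf_msg_eq_E\<close> transports
  well-formedness along the chain.\<close>

lemma church_rosser:
  assumes "eq_E E s t" "wf_msg E s"
  shows "\<exists>u u'. (rewrite_ac E)\<^sup>*\<^sup>* s u \<and> (rewrite_ac E)\<^sup>*\<^sup>* t u' \<and> ac_eq E u u'"
proof -
  define J where "J s t \<longleftrightarrow> (\<exists>u u'. (rewrite_ac E)\<^sup>*\<^sup>* s u \<and> (rewrite_ac E)\<^sup>*\<^sup>* t u' \<and> ac_eq E u u')" for s t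
  have trans: "J s w" if "J s t" "J t w" "wf_msg E t" for s t w
  proof -
    obtain u u' where u: "(rewrite_ac E)\<^sup>*\<^sup>* s u" "(rewrite_ac E)\<^sup>*\<^sup>* t u'" "ac_eq E u u'"
      using \<open>J s t\<close> J_def by auto
    obtain v v' where v: "(rewrite_ac E)\<^sup>*\<^sup>* t v" "(rewrite_ac E)\<^sup>*\<^sup>* w v'" "ac_eq E v v'"
      using \<open>J t w\<close> J_def by auto
    obtain a b where ab: "(rewrite_ac E)\<^sup>*\<^sup>* u' a" "(rewrite_ac E)\<^sup>*\<^sup>* v b" "ac_eq E a b"
      using confluent \<open>wf_msg E t\<close> u(2) v(1) unfolding confluent_ac_def by (meson ac_eq_refl)
    obtain a' where a': "(rewrite_ac E)\<^sup>*\<^sup>* u a'" "ac_eq E a' a"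
      using rewrite_steps_cong u(3) ab(1) by blast
    obtain b' where b': "(rewrite_ac E)\<^sup>*\<^sup>* v' b'" "ac_eq E b' b"
      using rewrite_steps_cong ac_eq_sym[OF v(3)] ab(2) by blast
    have "ac_eq E a' b'" by (meson a' b' ab(3) ac_eq_trans ac_eq_sym)
    then show ?thesis unfolding J_def using u(1) a' v(2) b' by (meson rtranclp_trans)
  qed
  have ac: "J u v" if "ac_eq E u v" for u v
    unfolding J_def using that by blast
  have rule: "J u v \<and> J v u" if "in_context (rule_instance E) u v" for u v
    unfolding J_def using rewrite_ac_rule[OF that] by (meson ac_eq_refl r_into_rtranclp rtranclp.rtrancl_refl)
  from assms(1) have "J s t"
  proof (induction rule: eq_E_induct)
    case refl show ?case by (rule ac) simp
  next
    case (ac u v)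
    then show ?case using trans \<open>\<And>v u. ac_eq E u v \<Longrightarrow> J u v\<close> wf_msg_eq_E assms(2) ac_eq_step by blast
  next
    case (rule u v)
    then show ?case using trans \<open>\<And>v u. in_context (rule_instance E) u v \<Longrightarrow> _\<close> wf_msg_eq_E assms(2) by blast
  next
    case (rule_sym u v)
    then show ?case using trans rule wf_msg_eq_E assms(2) by blast
  qed
  then show ?thesis by (simp add: J_def)
qed

lemma eq_E_normal:
  assumes "eq_E E s t" "wf_msg E s" "normal E t"
  shows "\<exists>u. (rewrite_ac E)\<^sup>*\<^sup>* s u \<and> ac_eq E u t"
proof -
  obtain u u' where u: "(rewrite_ac E)\<^sup>*\<^sup>* s u" "(rewrite_ac E)\<^sup>*\<^sup>* t u'" "ac_eq E u u'"
    using church_rosser assms by blast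
  from u(2) have "u' = t"
    by (cases rule: converse_rtranclpE) (use assms(3) in \<open>auto simp: normal_def\<close>)
  with u show ?thesis by auto
qed

end

subsection \<open>Elementary deduction from alien terms\<close>

text \<open>This set contains all normal forms of \<open>E\<close>-contexts filled with alien normal
  messages: a layer over \<open>sig E\<close> above AC variants of members of
  \<open>\<Delta>\<close>. Admitting AC variants at the leaves makes it closed under AC
  equality.\<close>

inductive_set combinations :: "eq_theory \<Rightarrow> msg set \<Rightarrow> msg set" for E \<Delta> where
  base: "d \<in> \<Delta> \<Longrightarrow> ac_eq E a d \<Longrightarrow> a \<in> combinations E \<Delta>"
| fn: "f \<in> sig E \<Longrightarrow> length Ms = arity E f \<Longrightarrow> (\<And>M. M \<in> set Ms \<Longrightarrow> M \<in> combinations E \<Delta>) \<Longrightarrow>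
    App (Fn f) Ms \<in> combinations E \<Delta>"

lemma plug_combinations:
  "wf_pat E C \<Longrightarrow> (\<And>i. i \<in> holes C \<Longrightarrow> \<sigma> i \<in> combinations E \<Delta>) \<Longrightarrow> plug \<sigma> C \<in> combinations E \<Delta>"
proof (induction C)
  case (PFn f ps)
  then have "plug \<sigma> q \<in> combinations E \<Delta>" if "q \<in> set ps" for q
    using that by (auto simp: list_all_iff)
  then show ?case using PFn.prems by (auto intro!: combinations.fn)
qed simp

context convergent
begin

context
  fixes \<Delta> :: "msg set"
  assumes al: "\<And>d. d \<in> \<Delta> \<Longrightarrow> alien E d"
begin

text \<open>AC equality keeps the root symbol, so an \<open>E\<close>-headed combination cannot be
  an AC variant of an alien leaf; it must have been built by \<open>fn\<close>.\<close>

lemma combinations_E_headed: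
  assumes "App (Fn f) Ms \<in> combinations E \<Delta>" "f \<in> sig E"
  shows "M \<in> set Ms \<Longrightarrow> M \<in> combinations E \<Delta>" "length Ms = arity E f"
proof -
  have na: "\<not> alien E (App (Fn f) Ms)" using assms(2) by (auto simp: alien_def E_headed_def)
  from assms(1) have "(\<forall>M \<in> set Ms. M \<in> combinations E \<Delta>) \<and> length Ms = arity E f"
  proof (cases rule: combinations.cases)
    case (base d)
    then show ?thesis using al ac_eq_alien na by blast
  qed auto
  then show "M \<in> set Ms \<Longrightarrow> M \<in> combinations E \<Delta>" "length Ms = arity E f" by auto
qed

lemma combinations_ac_axiom:
  assumes "ac_axiom E a b \<or> ac_axiom E b a" "a \<in> combinations E \<Delta>"
  shows "b \<in> combinations E \<Delta>"
proof -
  have *: "App (Fn p) [x, y] \<in> combinations E \<Delta> \<longleftrightarrow> x \<in> combinations E \<Delta> \<and> y \<in> combinations E \<Delta>"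
    if "ac_sym E = Some p" for p x y
    using combinations_E_headed(1)[of p "[x, y]"] ac_sym_sig[OF that]
    by (auto intro!: combinations.fn)
  show ?thesis using assms by (auto elim!: ac_axiom.cases simp: *)
qed

lemma combinations_ac_step:
  "a \<in> combinations E \<Delta> \<Longrightarrow> ac_step E a b \<Longrightarrow> b \<in> combinations E \<Delta>"
proof (induction arbitrary: b rule: combinations.induct)
  case (base d a)
  then show ?case by (meson ac_eq_step ac_eq_sym ac_eq_trans combinations.base)
next
  case (fn f Ms)
  have "App (Fn f) Ms \<in> combinations E \<Delta>" using fn by (auto intro: combinations.fn)
  with fn.prems[unfolded ac_step_def] show ?case
  proof (cases rule: in_context_App_cases)
    case 1
    then show ?thesis using combinations_ac_axiom \<open>App (Fn f) Ms \<in> _\<close> by blast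
  next
    case (2 Ps s t Qs)
    then have "t \<in> combinations E \<Delta>" using fn.IH[of s t] by (auto simp: ac_step_def)
    then show ?thesis using 2 fn by (auto intro!: combinations.fn)
  qed
qed

lemma combinations_ac_eq:
  "ac_eq E a b \<Longrightarrow> a \<in> combinations E \<Delta> \<Longrightarrow> b \<in> combinations E \<Delta>"
  by (induction rule: ac_eq_induct) (auto intro: combinations_ac_step)

lemma combinations_holes:
  "wf_pat E q \<Longrightarrow> plug \<sigma> q \<in> combinations E \<Delta> \<Longrightarrow> i \<in> holes q \<Longrightarrow> \<sigma> i \<in> combinations E \<Delta>"
proof (induction q)
  case (PFn f ps)
  then obtain q where q: "q \<in> set ps" "i \<in> holes q" by auto
  have "plug \<sigma> q \<in> combinations E \<Delta>"
    using combinations_E_headed(1)[of f "map (plug \<sigma>) ps"] PFn.prems q by auto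
  then show ?case using PFn q by (auto simp: list_all_iff)
qed simp

text \<open>A leaf is normal and has no step. At a redex, the right-hand side reuses only messages
  substituted into the left-hand side, by \<open>rule_holes\<close>, and these are combinations
  themselves.\<close>

lemma combinations_rule:
  assumes nf: "\<And>d. d \<in> \<Delta> \<Longrightarrow> normal E d"
  shows "a \<in> combinations E \<Delta> \<Longrightarrow> in_context (rule_instance E) a b \<Longrightarrow> b \<in> combinations E \<Delta>"
proof (induction arbitrary: b rule: combinations.induct)
  case (base d a)
  then have "normal E a" using normal_ac_eq nf by blast
  then show ?case using rewrite_ac_rule base by (auto simp: normal_def)
next
  case (fn f Ms)
  have *: "App (Fn f) Ms \<in> combinations E \<Delta>" using fn by (auto intro: combinations.fn)
  from fn.prems show ?case
  proof (cases rule: in_context_App_cases)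
    case 1
    then obtain l r \<sigma> where lr: "(l, r) \<in> rules E" "App (Fn f) Ms = plug \<sigma> l" "b = plug \<sigma> r"
      by (auto elim: rule_instance.cases)
    have "\<sigma> i \<in> combinations E \<Delta>" if "i \<in> holes r" for i
      using combinations_holes[of l \<sigma> i] lr rules_wf rule_holes * that by (metis subsetD)
    then show ?thesis using lr rules_wf by (auto intro: plug_combinations)
  next
    case (2 Ps s t Qs)
    then have "t \<in> combinations E \<Delta>" using fn.IH[of s t] by auto
    then show ?thesis using 2 fn by (auto intro!: combinations.fn)
  qed
qed

text \<open>The filled context is a combination and stays one while it is rewritten to a message
  AC-equal to \<open>M\<close>.\<close>

lemma elementary_alien_combinations:
  assumes nf: "\<And>d. d \<in> \<Delta> \<Longrightarrow> normal E d" and wf: "\<And>d. d \<in> \<Delta> \<Longrightarrow> wf_msg E d"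
    and M: "elementary E \<Delta> M" "normal E M"
  shows "M \<in> combinations E \<Delta>"
proof -
  obtain C \<sigma> where C: "wf_pat E C" "\<forall>i \<in> holes C. \<sigma> i \<in> \<Delta>" "eq_E E (plug \<sigma> C) M"
    using M(1) by (auto simp: elementary_def)
  have "wf_msg E (plug \<sigma> C)" using C wf by (auto intro: wf_msg_plug)
  then obtain u where u: "(rewrite_ac E)\<^sup>*\<^sup>* (plug \<sigma> C) u" "ac_eq E u M"
    using eq_E_normal C(3) M(2) by blast
  have "plug \<sigma> C \<in> combinations E \<Delta>"
    using C by (auto intro!: plug_combinations intro: combinations.base)
  with u(1) have "u \<in> combinations E \<Delta>"
  proof (induction rule: rtranclp_induct)
    case (step y z)
    then obtain u v where "ac_eq E y u" "in_context (rule_instance E) u v" "ac_eq E v z"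
      by (auto simp: rewrite_ac_iff)
    with step.IH[OF step.prems] show ?case using combinations_ac_eq combinations_rule[OF nf] by metis
  qed
  then show ?thesis using u(2) combinations_ac_eq by blast
qed

end

lemma elementary_member: "M \<in> \<Gamma> \<Longrightarrow> eq_E E M N \<Longrightarrow> elementary E \<Gamma> N"
  unfolding elementary_def by (intro exI[of _ "PVar 0"] exI[of _ "\<lambda>_. M"]) auto

text \<open>Both terms are alien, so the query can only succeed with the empty context. This reduces the
  test \<open>K \<equiv> L\<close> to elementary deduction between two members of the saturated set.\<close>

lemma elementary_sign_iff:
  assumes "wf_msg E K" "normal E K" "normal E L"
  shows "elementary E {sign K K} (sign K L) \<longleftrightarrow> ac_eq E K L"
proof
  assume *: "elementary E {sign K K} (sign K L)"
  have "sign K L \<in> combinations E {sign K K}"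
    using assms by (intro elementary_alien_combinations *) (auto simp: alien_def E_headed_def intro: normal_sign)
  then have "ac_eq E (sign K L) (sign K K)" by (cases rule: combinations.cases) auto
  then show "ac_eq E K L" by (auto dest: ac_eq_sign ac_eq_sym)
next
  assume "ac_eq E K L"
  then have "eq_E E (sign K K) (sign K L)" by (intro eq_E_ac ac_eq_signI)
  then show "elementary E {sign K K} (sign K L)" using elementary_member by blast
qed

end

subsection \<open>Fresh names\<close>

primrec names :: "msg \<Rightarrow> nat set" where
  "names (Name a) = {a}"
| "names (App g Ms) = \<Union> (set (map names Ms))"

primrec rename :: "(nat \<Rightarrow> msg) \<Rightarrow> msg \<Rightarrow> msg" where
  "rename \<rho> (Name a) = \<rho> a"
| "rename \<rho> (App g Ms) = App g (map (rename \<rho>) Ms)"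

lemma finite_names [simp]: "finite (names M)"
  by (induction M) auto

lemma rename_id: "(\<And>a. a \<in> names M \<Longrightarrow> \<rho> a = Name a) \<Longrightarrow> rename \<rho> M = M"
  by (induction M) (auto intro: map_idI)

lemma rename_plug: "rename \<rho> (plug \<sigma> q) = plug (rename \<rho> \<circ> \<sigma>) q"
  by (induction q) auto

lemma wf_msg_rename: "(\<And>a. wf_msg E (\<rho> a)) \<Longrightarrow> wf_msg E M \<Longrightarrow> wf_msg E (rename \<rho> M)"
  by (induction M) (auto simp: list_all_iff)

lemma in_context_rename:
  "in_context q s t \<Longrightarrow> (\<And>a b. q a b \<Longrightarrow> q (rename \<rho> a) (rename \<rho> b)) \<Longrightarrow>
    in_context q (rename \<rho> s) (rename \<rho> t)"
  by (induction rule: in_context.induct) (auto intro: in_context.intros)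

text \<open>Composing the substitution of a rule instance with \<open>\<rho>\<close> gives a rule
  instance again; \<open>\<rho>\<close> has to yield well-formed messages because rule instances
  admit only well-formed substitutions.\<close>

lemma eq_E_rename:
  assumes "\<And>a. wf_msg E (\<rho> a)" "eq_E E s t" shows "eq_E E (rename \<rho> s) (rename \<rho> t)"
proof -
  have ac: "ac_axiom E a b \<Longrightarrow> ac_axiom E (rename \<rho> a) (rename \<rho> b)" for a b
    by (auto elim!: ac_axiom.cases intro: ac_axiom.intros)
  have ru: "rule_instance E a b \<Longrightarrow> rule_instance E (rename \<rho> a) (rename \<rho> b)" for a b
    by (auto elim!: rule_instance.cases simp: rename_plug intro!: rule_instance.intros
        wf_msg_rename assms(1))
  from assms(2) show ?thesis
  proof (induction rule: eq_E_induct)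
    case (ac u v)
    have "ac_step E (rename \<rho> u) (rename \<rho> v)"
      using ac(2) unfolding ac_step_def
      by (rule in_context_rename) (use \<open>\<And>b a. ac_axiom E a b \<Longrightarrow> _\<close> in blast)
    then show ?case using ac by (meson ac_eq_step eq_E_ac eq_E_trans)
  next
    case (rule u v)
    have "eq_E E (rename \<rho> u) (rename \<rho> v)"
      by (rule eq_E_rule[OF in_context_rename[OF rule(2)]]) (rule ru)
    then show ?case using rule.IH eq_E_trans by blast
  next
    case (rule_sym u v)
    have "eq_E E (rename \<rho> v) (rename \<rho> u)"
      by (rule eq_E_rule[OF in_context_rename[OF rule_sym(2)]]) (rule ru)
    then show ?case using rule_sym.IH eq_E_trans eq_E_sym by blast
  qed simp
qed

lemma elementary_mono: "elementary E \<Gamma> M \<Longrightarrow> \<Gamma> \<subseteq> \<Delta> \<Longrightarrow> elementary E \<Delta> M"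
  unfolding elementary_def by blast

text \<open>A leaf of \<open>M\<close> would be AC-equal to a name in \<open>A\<close>, hence equal
  to it, which is excluded. So \<open>M\<close> has no leaves and can be deduced from
  nothing.\<close>

lemma elementary_closed_combination:
  assumes "M \<in> combinations E (Name ` A)" "names M \<inter> A = {}"
  shows "\<exists>C. wf_pat E C \<and> holes C = {} \<and> (\<forall>\<sigma>. plug \<sigma> C = M)"
  using assms
proof (induction rule: combinations.induct)
  case (base d a)
  then obtain x where x: "x \<in> A" "ac_eq E (Name x) a" by (auto intro: ac_eq_sym)
  then have "a = Name x" using ac_eq_Name by blast
  then show ?case using base x by auto
next
  case (fn f Ms)
  have "\<exists>C. wf_pat E C \<and> holes C = {} \<and> (\<forall>\<sigma>. plug \<sigma> C = M)" if "M \<in> set Ms" for M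
  proof (rule fn.IH[OF that])
    show "names M \<inter> A = {}" using fn.prems that by auto
  qed
  then obtain c where c: "\<And>M. M \<in> set Ms \<Longrightarrow> wf_pat E (c M) \<and> holes (c M) = {} \<and> (\<forall>\<sigma>. plug \<sigma> (c M) = M)"
    by metis
  show ?case
    by (rule exI[of _ "PFn f (map c Ms)"]) (use fn c in \<open>auto simp: list_all_iff intro: map_idI\<close>)
qed

lemma (in convergent) elementary_fresh_names:
  assumes "\<And>N. N \<in> \<Gamma> \<Longrightarrow> wf_msg E N \<and> names N \<inter> A = {}" "normal E M" "names M \<inter> A = {}"
  shows "elementary E (\<Gamma> \<union> Name ` A) M \<longleftrightarrow> elementary E \<Gamma> M"
proof
  assume *: "elementary E (\<Gamma> \<union> Name ` A) M"
  show "elementary E \<Gamma> M"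
  \<comment> \<open>Sending the fresh names to a member \<open>N\<close> of \<open>\<Gamma>\<close>
    fixes \<open>M\<close> and refills the holes from \<open>\<Gamma>\<close>. Without such an
    \<open>N\<close>, the shape of normal forms decides.\<close>
  proof (cases "\<Gamma> = {}")
    case True
    have "M \<in> combinations E (Name ` A)"
      using * True assms(2)
      by (intro elementary_alien_combinations) (auto simp: alien_def E_headed_def)
    then obtain C where "wf_pat E C" "holes C = {}" "\<forall>\<sigma>. plug \<sigma> C = M"
      using elementary_closed_combination assms(3) by blast
    then show ?thesis unfolding elementary_def by (metis empty_iff eq_E_refl)
  next
    case False
    then obtain N where N: "N \<in> \<Gamma>" by blast
    define \<rho> where "\<rho> a = (if a \<in> A then N else Name a)" for a
    have wf: "wf_msg E (\<rho> a)" for a using assms(1) N by (simp add: \<rho>_def)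
    have id: "rename \<rho> L = L" if "names L \<inter> A = {}" for L
      using that by (intro rename_id) (auto simp: \<rho>_def)
    obtain C \<sigma> where C: "wf_pat E C" "\<forall>i \<in> holes C. \<sigma> i \<in> \<Gamma> \<union> Name ` A" "eq_E E (plug \<sigma> C) M"
      using * by (auto simp: elementary_def)
    have "eq_E E (plug (rename \<rho> \<circ> \<sigma>) C) M"
      using eq_E_rename[of E \<rho>, OF wf C(3)] id[OF assms(3)] by (simp add: rename_plug)
    moreover have "(rename \<rho> \<circ> \<sigma>) i \<in> \<Gamma>" if "i \<in> holes C" for i
      using C(2) that id assms(1) N by (fastforce simp: \<rho>_def)
    ultimately show ?thesis using C(1) unfolding elementary_def by blast
  qed
qed (auto elim: elementary_mono)

section \<open>Saturation for the linear system\<close>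

lemma right_deriv_mono: "right_deriv E \<Gamma> M \<Longrightarrow> \<Gamma> \<subseteq> \<Delta> \<Longrightarrow> right_deriv E \<Delta> M"
  by (induction rule: right_deriv.induct) (auto intro: right_deriv.intros elementary_mono)

text \<open>The principal messages move from the shape of the left-hand side into membership
  premises, so that the rules apply to arbitrary sets.\<close>

lemma L_deriv_rules:
  shows L_deriv_pair: "pair M N \<in> \<Gamma> \<Longrightarrow> L_deriv E (\<Gamma> \<union> {M, N}) T \<Longrightarrow> L_deriv E \<Gamma> T"
    and L_deriv_enc: "enc M K \<in> \<Gamma> \<Longrightarrow> right_deriv E \<Gamma> K \<Longrightarrow> L_deriv E (\<Gamma> \<union> {M, K}) T \<Longrightarrow>
      L_deriv E \<Gamma> T"
    and L_deriv_sign: "sign M K \<in> \<Gamma> \<Longrightarrow> pub L \<in> \<Gamma> \<Longrightarrow> ac_eq E K L \<Longrightarrow> L_deriv E (\<Gamma> \<union> {M}) T \<Longrightarrow>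
      L_deriv E \<Gamma> T"
    and L_deriv_blind1: "blind M K \<in> \<Gamma> \<Longrightarrow> right_deriv E \<Gamma> K \<Longrightarrow> L_deriv E (\<Gamma> \<union> {M, K}) T \<Longrightarrow>
      L_deriv E \<Gamma> T"
    and L_deriv_blind2: "sign (blind M R) K \<in> \<Gamma> \<Longrightarrow> right_deriv E \<Gamma> R \<Longrightarrow>
      L_deriv E (\<Gamma> \<union> {sign M K, R}) T \<Longrightarrow> L_deriv E \<Gamma> T"
  using L_deriv.lp[of E \<Gamma> M N T] L_deriv.le[of E \<Gamma> M K T] L_deriv.sign[of E K L \<Gamma> M T]
    L_deriv.blind1[of E \<Gamma> M K T] L_deriv.blind2[of E \<Gamma> M R K T]
  by (simp_all add: insert_absorb insert_commute)

lemma L_deriv_mono: "L_deriv E \<Gamma> M \<Longrightarrow> \<Gamma> \<subseteq> \<Delta> \<Longrightarrow> L_deriv E \<Delta> M"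
proof (induction arbitrary: \<Delta> rule: L_deriv.induct)
  case (r \<Gamma> M)
  then show ?case by (blast intro: L_deriv.r right_deriv_mono)
next
  case (lp \<Gamma> M N T)
  have "L_deriv E (\<Delta> \<union> {M, N}) T" by (rule lp.IH) (use lp.prems in auto)
  then show ?case using L_deriv_pair[of M N \<Delta> E T] lp.prems by auto
next
  case (le \<Gamma> M K N)
  have "L_deriv E (\<Delta> \<union> {M, K}) N" by (rule le.IH) (use le.prems in auto)
  then show ?case using L_deriv_enc[of M K \<Delta> E N] le.prems right_deriv_mono[OF le.hyps(1) le.prems] by auto
next
  case (sign K L \<Gamma> M N)
  have "L_deriv E (\<Delta> \<union> {M}) N" by (rule sign.IH) (use sign.prems in auto)
  then show ?case using L_deriv_sign[of M K \<Delta> L E N] sign.prems sign.hyps by auto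
next
  case (blind1 \<Gamma> M K N)
  have "L_deriv E (\<Delta> \<union> {M, K}) N" by (rule blind1.IH) (use blind1.prems in auto)
  then show ?case using L_deriv_blind1[of M K \<Delta> E N] blind1.prems right_deriv_mono[OF blind1.hyps(1) blind1.prems] by auto
next
  case (blind2 \<Gamma> M R K N)
  have "L_deriv E (\<Delta> \<union> {sign M K, R}) N" by (rule blind2.IH) (use blind2.prems in auto)
  then show ?case using L_deriv_blind2[of M R K \<Delta> E N] blind2.prems right_deriv_mono[OF blind2.hyps(1) blind2.prems] by auto
next
  case (ls \<Gamma> M A)
  then have "\<exists>N \<in> \<Delta> \<union> {M}. factor E A N" "right_deriv E \<Delta> A" "L_deriv E (\<Delta> \<union> {A}) M"
    by (auto intro: right_deriv_mono)
  then show ?case by (rule L_deriv.ls)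
qed

text \<open>A rule that adds two messages is split into two single additions, which weakening makes
  harmless. The goal \<open>T\<close> is a parameter because its factors may be added too; no left
  rule changes it.\<close>

inductive left_step :: "eq_theory \<Rightarrow> msg \<Rightarrow> msg set \<Rightarrow> msg \<Rightarrow> bool" for E T \<Gamma> where
  pair: "pair M N \<in> \<Gamma> \<Longrightarrow> A \<in> {M, N} \<Longrightarrow> left_step E T \<Gamma> A"
| enc: "enc M K \<in> \<Gamma> \<Longrightarrow> right_deriv E \<Gamma> K \<Longrightarrow> A \<in> {M, K} \<Longrightarrow> left_step E T \<Gamma> A"
| sign: "sign A K \<in> \<Gamma> \<Longrightarrow> pub L \<in> \<Gamma> \<Longrightarrow> ac_eq E K L \<Longrightarrow> left_step E T \<Gamma> A"
| blind1: "blind M K \<in> \<Gamma> \<Longrightarrow> right_deriv E \<Gamma> K \<Longrightarrow> A \<in> {M, K} \<Longrightarrow> left_step E T \<Gamma> A"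
| blind2: "sign (blind M R) K \<in> \<Gamma> \<Longrightarrow> right_deriv E \<Gamma> R \<Longrightarrow> A \<in> {sign M K, R} \<Longrightarrow>
    left_step E T \<Gamma> A"
| factor: "N \<in> \<Gamma> \<union> {T} \<Longrightarrow> factor E A N \<Longrightarrow> right_deriv E \<Gamma> A \<Longrightarrow> left_step E T \<Gamma> A"

lemma left_step_mono: "left_step E T \<Gamma> A \<Longrightarrow> \<Gamma> \<subseteq> \<Delta> \<Longrightarrow> left_step E T \<Delta> A"
  by (induction rule: left_step.induct)
    (blast intro: left_step.intros right_deriv_mono)+

lemma left_step_sound:
  assumes "left_step E T \<Gamma> A" "L_deriv E (\<Gamma> \<union> {A}) T" shows "L_deriv E \<Gamma> T"
proof -
  have *: "L_deriv E (\<Gamma> \<union> S) T" if "A \<in> S" for S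
    using assms(2) by (rule L_deriv_mono) (use that in blast)
  from assms(1) show ?thesis
  proof cases
    case (pair M N)
    show ?thesis by (rule L_deriv_pair[OF pair(1) *]) (rule pair)
  next
    case (enc M K)
    show ?thesis by (rule L_deriv_enc[OF enc(1,2) *]) (rule enc)
  next
    case (sign K L)
    show ?thesis by (rule L_deriv_sign[OF sign *]) simp
  next
    case (blind1 M K)
    show ?thesis by (rule L_deriv_blind1[OF blind1(1,2) *]) (rule blind1)
  next
    case (blind2 M R K)
    show ?thesis by (rule L_deriv_blind2[OF blind2(1,2) *]) (rule blind2)
  next
    case (factor N)
    then show ?thesis using assms(2) by (blast intro: L_deriv.ls)
  qed
qed

text \<open>Steps stay possible when the left-hand side grows, so a whole round of additions can be
  undone one message at a time.\<close>

lemma left_steps_sound: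
  assumes "finite S" "\<And>A. A \<in> S \<Longrightarrow> left_step E T \<Gamma> A" "L_deriv E (\<Gamma> \<union> S) T"
  shows "L_deriv E \<Gamma> T"
  using assms
proof (induction S rule: finite_induct)
  case (insert A S)
  have "left_step E T (\<Gamma> \<union> S) A" using insert.prems by (auto intro: left_step_mono)
  moreover have "L_deriv E (\<Gamma> \<union> S \<union> {A}) T" using insert.prems by (simp add: Un_assoc)
  ultimately have "L_deriv E (\<Gamma> \<union> S) T" by (rule left_step_sound)
  then show ?case using insert by auto
qed simp

text \<open>Each left rule of the derivation adds only messages that \<open>\<Delta>\<close> already
  contains; at the leaf \<open>r\<close>, monotonicity of right derivability applies.\<close>

lemma L_deriv_closed:
  "L_deriv E \<Gamma> T \<Longrightarrow> \<Gamma> \<subseteq> \<Delta> \<Longrightarrow> (\<And>A. left_step E T \<Delta> A \<Longrightarrow> A \<in> \<Delta>) \<Longrightarrow> right_deriv E \<Delta> T"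
proof (induction rule: L_deriv.induct)
  case (r \<Gamma> M)
  then show ?case by (blast intro: right_deriv_mono)
next
  case (lp \<Gamma> M N T)
  have "left_step E T \<Delta> A" if "A \<in> {M, N}" for A using lp.prems that by (intro left_step.pair[of M N]) auto
  then show ?case using lp by auto
next
  case (le \<Gamma> M K N)
  then have "right_deriv E \<Delta> K" by (blast intro: right_deriv_mono)
  then have "left_step E N \<Delta> A" if "A \<in> {M, K}" for A
    using le.prems that by (intro left_step.enc[of M K]) auto
  then show ?case using le by auto
next
  case (sign K L \<Gamma> M N)
  then have "left_step E N \<Delta> M" by (intro left_step.sign[of M K _ L]) auto
  then show ?case using sign by auto
next
  case (blind1 \<Gamma> M K N)
  then have "right_deriv E \<Delta> K" by (blast intro: right_deriv_mono)
  then have "left_step E N \<Delta> A" if "A \<in> {M, K}" for A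
    using blind1.prems that by (intro left_step.blind1[of M K]) auto
  then show ?case using blind1 by auto
next
  case (blind2 \<Gamma> M R K N)
  then have "right_deriv E \<Delta> R" by (blast intro: right_deriv_mono)
  then have "left_step E N \<Delta> A" if "A \<in> {sign M K, R}" for A
    using blind2.prems that by (intro left_step.blind2[of M R K]) auto
  then show ?case using blind2 by auto
next
  case (ls \<Gamma> M A)
  then obtain N where "N \<in> \<Delta> \<union> {M}" "factor E A N" by blast
  moreover have "right_deriv E \<Delta> A" using ls by (blast intro: right_deriv_mono)
  ultimately have "left_step E M \<Delta> A" by (rule left_step.factor)
  then show ?case using ls by auto
qed

section \<open>Programs with time bounds\<close>

text \<open>Total correctness with a time bound. The existence of one run suffices, since that is
  what \<open>answers\<close> demands.\<close>

definition runs :: "com \<Rightarrow> nat \<Rightarrow> store \<Rightarrow> (store \<Rightarrow> bool) \<Rightarrow> bool" where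
  "runs c b s Q \<longleftrightarrow> (\<exists>t s'. exec c s t s' \<and> t \<le> b \<and> Q s')"

lemma runs_mono: "runs c b s P \<Longrightarrow> b \<le> b' \<Longrightarrow> (\<And>s'. P s' \<Longrightarrow> Q s') \<Longrightarrow> runs c b' s Q"
  unfolding runs_def by (meson le_trans)

lemma runs_Assign: "1 + cost e \<le> b \<Longrightarrow> Q (s(x := eval_expr s e)) \<Longrightarrow> runs (Assign x e) b s Q"
  unfolding runs_def using exec.Assign by blast

lemma runs_Seq:
  assumes "runs c a s P" "a \<le> b" "\<And>s'. P s' \<Longrightarrow> runs d (b - a) s' Q"
  shows "runs (Seq c d) b s Q"
proof -
  obtain t s' where 1: "exec c s t s'" "t \<le> a" "P s'" using assms(1) runs_def by auto
  obtain t' s'' where 2: "exec d s' t' s''" "t' \<le> b - a" "Q s''" using assms(3)[OF 1(3)] runs_def by auto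
  show ?thesis unfolding runs_def using exec.Seq[OF 1(1) 2(1)] 1 2 assms(2) by fastforce
qed

lemma runs_Assign_Seq:
  "1 + cost e \<le> b \<Longrightarrow> runs d (b - (1 + cost e)) (s(x := eval_expr s e)) Q \<Longrightarrow>
    runs (Seq (Assign x e) d) b s Q"
  by (rule runs_Seq[where P = "\<lambda>s'. s' = s(x := eval_expr s e)" and a = "1 + cost e"])
    (auto intro: runs_Assign)

lemma runs_Cond:
  assumes "1 + cost e \<le> b" "eval_expr s e \<noteq> Atom \<Longrightarrow> runs c (b - (1 + cost e)) s Q"
    "eval_expr s e = Atom \<Longrightarrow> runs d (b - (1 + cost e)) s Q"
  shows "runs (Cond e c d) b s Q"
proof (cases "eval_expr s e = Atom")
  case True
  then obtain t s' where "exec d s t s'" "t \<le> b - (1 + cost e)" "Q s'"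
    using assms(3) runs_def by auto
  then show ?thesis
    unfolding runs_def using exec.CondFalse[OF True] assms(1) by fastforce
next
  case False
  then obtain t s' where "exec c s t s'" "t \<le> b - (1 + cost e)" "Q s'"
    using assms(2) runs_def by auto
  then show ?thesis
    unfolding runs_def using exec.CondTrue[OF False] assms(1) by fastforce
qed

abbreviation Skip :: com where "Skip \<equiv> Assign 0 (Var 0)"

lemma runs_Skip: "2 \<le> b \<Longrightarrow> Q s \<Longrightarrow> runs Skip b s Q"
  by (rule runs_Assign) auto

text \<open>At the end this gives \<open>1 \<le> T n\<close> for every size that occurs, so that
  \<open>T n + 1\<close> is at most \<open>2 * T n\<close>.\<close>

lemma exec_pos: "exec c s t s' \<Longrightarrow> 0 < t"
  by (induction rule: exec.induct) auto

lemma runs_While_step: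
  assumes "eval_expr s e \<noteq> Atom" "runs c a s P" "\<And>s'. P s' \<Longrightarrow> runs (While e c) b' s' Q"
    "1 + cost e + a + b' \<le> b"
  shows "runs (While e c) b s Q"
proof -
  obtain t s' where 1: "exec c s t s'" "t \<le> a" "P s'" using assms(2) runs_def by auto
  obtain t' s'' where 2: "exec (While e c) s' t' s''" "t' \<le> b'" "Q s''"
    using assms(3)[OF 1(3)] runs_def by auto
  have "1 + cost e + t + t' \<le> b" using 1(2) 2(2) assms(4) by simp
  then show ?thesis
    unfolding runs_def using exec.WhileTrue[OF assms(1) 1(1) 2(1)] 2(3) by blast
qed

lemma runs_While_end: "eval_expr s e = Atom \<Longrightarrow> 1 + cost e \<le> b \<Longrightarrow> Q s \<Longrightarrow> runs (While e c) b s Q"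
  unfolding runs_def using exec.WhileFalse by blast

subsection \<open>Frames\<close>

primrec expr_vars :: "expr \<Rightarrow> nat set" where
  "expr_vars (Var x) = {x}"
| "expr_vars Nil_expr = {}"
| "expr_vars (Cons_expr e e') = expr_vars e \<union> expr_vars e'"
| "expr_vars (Hd e) = expr_vars e"
| "expr_vars (Tl e) = expr_vars e"

primrec com_vars :: "com \<Rightarrow> nat set" where
  "com_vars (Assign x e) = insert x (expr_vars e)"
| "com_vars (Seq c d) = com_vars c \<union> com_vars d"
| "com_vars (Cond e c d) = expr_vars e \<union> com_vars c \<union> com_vars d"
| "com_vars (While e c) = expr_vars e \<union> com_vars c"

lemma finite_expr_vars [simp]: "finite (expr_vars e)"
  by (induction e) auto

lemma finite_com_vars [simp]: "finite (com_vars c)"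
  by (induction c) auto

lemma eval_expr_cong: "(\<And>v. v \<in> expr_vars e \<Longrightarrow> s v = r v) \<Longrightarrow> eval_expr s e = eval_expr r e"
  by (induction e) auto

text \<open>It moves a run of the given procedure from the blank store, for which it is specified,
  into a store with data above its variables: same time, same answer, data intact.\<close>

lemma exec_frame:
  assumes "exec c s t s'" "com_vars c \<subseteq> A" "\<And>v. v \<in> A \<Longrightarrow> s v = r v"
  shows "\<exists>r'. exec c r t r' \<and> (\<forall>v \<in> A. s' v = r' v) \<and> (\<forall>v. v \<notin> A \<longrightarrow> r' v = r v)"
  using assms
proof (induction arbitrary: r rule: exec.induct)
  case (Assign x e s)
  have "eval_expr s e = eval_expr r e" by (rule eval_expr_cong) (use Assign in auto)
  moreover have "exec (Assign x e) r (1 + cost e) (r(x := eval_expr r e))" by (rule exec.Assign)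
  ultimately show ?case using Assign.prems by (smt (verit) com_vars.simps(1) fun_upd_apply insert_subset)
next
  case (Seq c s t s' d t' s'')
  obtain r' where 1: "exec c r t r'" "\<forall>v \<in> A. s' v = r' v" "\<forall>v. v \<notin> A \<longrightarrow> r' v = r v"
    using Seq.IH(1)[of r] Seq.prems by auto
  obtain r'' where 2: "exec d r' t' r''" "\<forall>v \<in> A. s'' v = r'' v" "\<forall>v. v \<notin> A \<longrightarrow> r'' v = r' v"
    using Seq.IH(2)[of r'] Seq.prems 1 by auto
  show ?case using exec.Seq[OF 1(1) 2(1)] 1 2 by (intro exI[of _ r'']) auto
next
  case (CondTrue s e c t s' d)
  have e: "eval_expr s e = eval_expr r e" by (rule eval_expr_cong) (use CondTrue in auto)
  obtain r' where 1: "exec c r t r'" "\<forall>v \<in> A. s' v = r' v" "\<forall>v. v \<notin> A \<longrightarrow> r' v = r v"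
    using CondTrue.IH[of r] CondTrue.prems by auto
  show ?case using exec.CondTrue[OF _ 1(1)] CondTrue.hyps e 1 by (intro exI[of _ r']) auto
next
  case (CondFalse s e d t s' c)
  have e: "eval_expr s e = eval_expr r e" by (rule eval_expr_cong) (use CondFalse in auto)
  obtain r' where 1: "exec d r t r'" "\<forall>v \<in> A. s' v = r' v" "\<forall>v. v \<notin> A \<longrightarrow> r' v = r v"
    using CondFalse.IH[of r] CondFalse.prems by auto
  show ?case using exec.CondFalse[OF _ 1(1)] CondFalse.hyps e 1 by (intro exI[of _ r']) auto
next
  case (WhileFalse s e c)
  have e: "eval_expr s e = eval_expr r e" by (rule eval_expr_cong) (use WhileFalse in auto)
  show ?case
    using exec.WhileFalse[of r e c] WhileFalse e by (intro exI[of _ r]) auto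
next
  case (WhileTrue s e c t s' t' s'')
  have e: "eval_expr s e = eval_expr r e" by (rule eval_expr_cong) (use WhileTrue in auto)
  obtain r' where 1: "exec c r t r'" "\<forall>v \<in> A. s' v = r' v" "\<forall>v. v \<notin> A \<longrightarrow> r' v = r v"
    using WhileTrue.IH(1)[of r] WhileTrue.prems by auto
  obtain r'' where 2: "exec (While e c) r' t' r''" "\<forall>v \<in> A. s'' v = r'' v"
    "\<forall>v. v \<notin> A \<longrightarrow> r'' v = r' v"
    using WhileTrue.IH(2)[of r'] WhileTrue.prems 1 by auto
  show ?case using exec.WhileTrue[OF _ 1(1) 2(1)] WhileTrue.hyps e 1 2 by (intro exI[of _ r'']) auto
qed

text \<open>Earlier calls of the procedure leave values in its variables, but its specification
  speaks only of runs from blank ones.\<close>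

primrec clear :: "nat \<Rightarrow> com" where
  "clear 0 = Skip"
| "clear (Suc n) = Seq (clear n) (Assign n Nil_expr)"

lemma runs_clear: "runs (clear n) (2 + 2 * n) s (\<lambda>s'. s' = (\<lambda>v. if v < n then Atom else s v))"
proof (induction n)
  case (Suc n)
  show ?case
    by (simp, rule runs_Seq[OF Suc]) (auto intro!: runs_Assign simp: fun_eq_iff less_Suc_eq)
qed (auto intro: runs_Skip)

subsection \<open>Encodings of lists and numbers\<close>

lemma tree_of_nat_simps [simp]:
  "tree_of_nat 0 = Atom" "tree_of_nat (Suc n) = Cell Atom (tree_of_nat n)"
  by (simp_all add: tree_of_nat_def)

lemma tree_of_nat_eq_Atom [simp]: "tree_of_nat n = Atom \<longleftrightarrow> n = 0"
  by (cases n) auto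

lemma tree_of_bool_eq_Atom [simp]: "tree_of_bool b = Atom \<longleftrightarrow> \<not> b" "Atom = tree_of_bool b \<longleftrightarrow> \<not> b"
  by (auto simp: tree_of_bool_def)

lemma tree_of_bool_True: "tree_of_bool True = Cell Atom Atom"
  and tree_of_bool_False [simp]: "tree_of_bool False = Atom"
  by (simp_all add: tree_of_bool_def)

lemma tl_tree_of_list: "tl_tree (tree_of_list xs) = tree_of_list (tl xs)"
  by (cases xs) auto

lemma tl_funpow_tree_of_list: "(tl_tree ^^ k) (tree_of_list xs) = tree_of_list (drop k xs)"
  by (induction k) (auto simp: tl_tree_of_list drop_Suc tl_drop)

lemma hd_tl_funpow_tree_of_list:
  "k < length xs \<Longrightarrow> hd_tree ((tl_tree ^^ k) (tree_of_list xs)) = xs ! k"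
  by (simp add: tl_funpow_tree_of_list Cons_nth_drop_Suc[symmetric])

lemma tl_funpow_tree_of_nat: "(tl_tree ^^ k) (tree_of_nat m) = tree_of_nat (m - k)"
  by (simp add: tree_of_nat_def tl_funpow_tree_of_list)

text \<open>The indices descend from \<open>k - 1\<close> to 0, so a loop over them that conses one
  entry per index produces a list in ascending order.\<close>

primrec idx_list :: "nat \<Rightarrow> tree" where
  "idx_list 0 = Atom"
| "idx_list (Suc k) = Cell (tree_of_nat k) (idx_list k)"

lemma idx_list_eq_Atom [simp]: "idx_list k = Atom \<longleftrightarrow> k = 0"
  by (cases k) auto

definition For :: "nat \<Rightarrow> nat \<Rightarrow> nat \<Rightarrow> com \<Rightarrow> com" where
  "For l x L c = Seq (Assign l (Var L))
     (While (Var l) (Seq (Assign x (Hd (Var l))) (Seq c (Assign l (Tl (Var l))))))"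

text \<open>\<open>I k\<close> describes the store when the indices from \<open>n - 1\<close> down
  to \<open>k\<close> have been treated. In each round, the 8 pays for the test (2) and for taking
  head and tail (3 each); the 4 pays for copying \<open>L\<close> and for the last test.\<close>

lemma runs_For:
  assumes L: "s L = idx_list n" and lx: "l \<noteq> x"
    and init: "I n (s(l := idx_list n))"
    and step: "\<And>k s'. k < n \<Longrightarrow> I (Suc k) s' \<Longrightarrow> s' l = idx_list (Suc k) \<Longrightarrow>
      runs c b (s'(x := tree_of_nat k)) (\<lambda>s''. s'' l = idx_list (Suc k) \<and> I k (s''(l := idx_list k)))"
    and fin: "\<And>s'. I 0 s' \<Longrightarrow> Q s'"
    and b': "4 + n * (b + 8) \<le> b'"
  shows "runs (For l x L c) b' s Q"
proof -
  let ?w = "While (Var l) (Seq (Assign x (Hd (Var l))) (Seq c (Assign l (Tl (Var l)))))"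
  have loop: "runs ?w (2 + k * (b + 8)) s' (I 0)" if "k \<le> n" "I k s'" "s' l = idx_list k" for k s'
    using that
  proof (induction k arbitrary: s')
    case 0
    then show ?case using exec.WhileFalse[of s' "Var l"] by (fastforce simp: runs_def)
  next
    case (Suc k)
    obtain t s2 where s2: "exec c (s'(x := tree_of_nat k)) t s2" "t \<le> b"
        "s2 l = idx_list (Suc k)" "I k (s2(l := idx_list k))"
      using step[of k s'] Suc.prems by (auto simp: runs_def)
    let ?s3 = "s2(l := idx_list k)"
    have a1: "exec (Assign x (Hd (Var l))) s' 3 (s'(x := tree_of_nat k))"
      using exec.Assign[of x "Hd (Var l)" s'] Suc.prems(3) by (simp add: numeral_3_eq_3)
    have a2: "exec (Assign l (Tl (Var l))) s2 3 ?s3"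
      using exec.Assign[of l "Tl (Var l)" s2] s2(3) by (simp add: numeral_3_eq_3)
    have body: "exec (Seq (Assign x (Hd (Var l))) (Seq c (Assign l (Tl (Var l))))) s' (3 + (t + 3)) ?s3"
      by (rule exec.Seq[OF a1 exec.Seq[OF s2(1) a2]])
    have "runs ?w (2 + k * (b + 8)) ?s3 (I 0)"
      by (rule Suc.IH[OF _ s2(4)]) (use Suc.prems(1) in simp_all)
    then obtain t' s4 where s4: "exec ?w ?s3 t' s4" "t' \<le> 2 + k * (b + 8)" "I 0 s4"
      unfolding runs_def by blast
    have "exec ?w s' (1 + cost (Var l) + (3 + (t + 3)) + t') s4"
      by (rule exec.WhileTrue[OF _ body s4(1)]) (simp add: Suc.prems(3))
    then show ?case using s4 s2(2) unfolding runs_def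
      by (intro exI[of _ "1 + cost (Var l) + (3 + (t + 3)) + t'"] exI[of _ s4]) auto
  qed
  show ?thesis
    unfolding For_def
  proof (rule runs_Assign_Seq)
    show "runs ?w (b' - (1 + cost (Var L))) (s(l := eval_expr s (Var L))) Q"
      by (rule runs_mono[OF loop[of n] _ fin]) (use b' init L in simp_all)
  qed (use b' in simp)
qed

subsection \<open>Polynomial bounds\<close>

text \<open>\<open>T\<close> enters linearly: such bounds are closed under addition and under
  multiplication by \<open>n\<close>, but not by each other, which keeps the final time in O(n^k
  f(n)). The summand 1 leaves room for constants where \<open>T n = 0\<close>.\<close>

definition poly_bound :: "(nat \<Rightarrow> nat) \<Rightarrow> (nat \<Rightarrow> nat) \<Rightarrow> bool" where
  "poly_bound T b \<longleftrightarrow> (\<exists>C k. \<forall>n. b n \<le> C * (n + 1) ^ k * (T n + 1))"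

lemma poly_bound_const: "poly_bound T (\<lambda>_. c)"
  unfolding poly_bound_def by (intro exI[of _ c] exI[of _ 0]) auto

lemma poly_bound_time: "poly_bound T T"
  unfolding poly_bound_def by (intro exI[of _ 1] exI[of _ 0]) auto

lemma poly_bound_add:
  assumes "poly_bound T a" "poly_bound T b" shows "poly_bound T (\<lambda>n. a n + b n)"
proof -
  obtain C k D l where 1: "\<And>n. a n \<le> C * (n + 1) ^ k * (T n + 1)"
    and 2: "\<And>n. b n \<le> D * (n + 1) ^ l * (T n + 1)"
    using assms poly_bound_def by metis
  have "a n + b n \<le> (C + D) * (n + 1) ^ (k + l) * (T n + 1)" for n
  proof -
    have "C * (n + 1) ^ k * (T n + 1) \<le> C * (n + 1) ^ (k + l) * (T n + 1)"
      by (intro mult_le_mono power_increasing order_refl) auto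
    moreover have "D * (n + 1) ^ l * (T n + 1) \<le> D * (n + 1) ^ (k + l) * (T n + 1)"
      by (intro mult_le_mono power_increasing order_refl) auto
    ultimately show ?thesis using 1[of n] 2[of n] by (simp add: algebra_simps)
  qed
  then show ?thesis unfolding poly_bound_def by blast
qed

lemma poly_bound_times:
  assumes "poly_bound T b" shows "poly_bound T (\<lambda>n. n * b n)"
proof -
  obtain C k where 1: "\<And>n. b n \<le> C * (n + 1) ^ k * (T n + 1)"
    using assms poly_bound_def by metis
  have "n * b n \<le> C * (n + 1) ^ Suc k * (T n + 1)" for n
    using mult_le_mono[of n "n + 1", OF _ 1[of n]] by (simp add: algebra_simps)
  then show ?thesis unfolding poly_bound_def by blast
qed

lemmas poly_bound_intros =
  poly_bound_const poly_bound_time poly_bound_add poly_bound_times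

section \<open>A fixpoint logic on DAGs\<close>

text \<open>First-order logic over the nodes of a DAG, with iterated definitions of node sets
  (\<open>Fix X y \<phi> \<psi>\<close> iterates \<open>X := {y. \<phi>}\<close> as often as there are nodes, and then evaluates \<open>\<psi>\<close>) and with
  queries to a decision procedure. In \<open>Query \<kappa> y X g\<close>, the formula \<open>\<kappa>\<close> describes the nodes \<open>y\<close> that are kept in the DAG
  handed to the procedure; it only affects how the answer is computed, not what it means.\<close>

datatype fm =
    In_left nat
  | Is_goal nat
  | Sym_gt nat nat
  | Child nat nat nat
  | Equal nat nat
  | Mem nat nat
  | Neg fm
  | And fm fm
  | Ex nat fm
  | Fix nat nat fm fm
  | Query fm nat nat nat

definition node_code :: "node \<Rightarrow> nat" where
  "node_code v = (case node_sym v of None \<Rightarrow> 0 | Some g \<Rightarrow> sym_code g)"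

primrec eval :: "dag \<Rightarrow> (nat set \<Rightarrow> nat \<Rightarrow> bool) \<Rightarrow> fm \<Rightarrow> (nat \<Rightarrow> nat) \<Rightarrow> (nat \<Rightarrow> nat set) \<Rightarrow> bool" where
  "eval G Q (In_left x) e S \<longleftrightarrow> in_left (G ! e x)"
| "eval G Q (Is_goal x) e S \<longleftrightarrow> is_goal (G ! e x)"
| "eval G Q (Sym_gt c x) e S \<longleftrightarrow> c < node_code (G ! e x)"
| "eval G Q (Child k x y) e S \<longleftrightarrow>
     k < length (children (G ! e x)) \<and> children (G ! e x) ! k = e y"
| "eval G Q (Equal x y) e S \<longleftrightarrow> e x = e y"
| "eval G Q (Mem X x) e S \<longleftrightarrow> e x \<in> S X"
| "eval G Q (Neg \<phi>) e S \<longleftrightarrow> \<not> eval G Q \<phi> e S"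
| "eval G Q (And \<phi> \<psi>) e S \<longleftrightarrow> eval G Q \<phi> e S \<and> eval G Q \<psi> e S"
| "eval G Q (Ex x \<phi>) e S \<longleftrightarrow> (\<exists>i < length G. eval G Q \<phi> (e(x := i)) S)"
| "eval G Q (Fix X y \<phi> \<psi>) e S \<longleftrightarrow> eval G Q \<psi> e (S(X :=
     ((\<lambda>Z. {i. i < length G \<and> eval G Q \<phi> (e(y := i)) (S(X := Z))}) ^^ length G) {}))"
| "eval G Q (Query \<kappa> y X g) e S \<longleftrightarrow> Q (S X) (e g)"

text \<open>Nodes outside of \<open>K\<close> become fresh names on the left-hand side: this keeps both the numbering
  and the size of the DAG.\<close>

definition query_dag :: "dag \<Rightarrow> nat set \<Rightarrow> nat set \<Rightarrow> nat \<Rightarrow> dag" where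
  "query_dag G K X g = map (\<lambda>i. if i \<in> K
     then Node (node_sym (G ! i)) (children (G ! i)) (i \<in> X) (i = g)
     else Node None [] True False) [0..<length G]"

definition valid_env :: "dag \<Rightarrow> (nat \<Rightarrow> nat) \<Rightarrow> (nat \<Rightarrow> nat set) \<Rightarrow> bool" where
  "valid_env G e S \<longleftrightarrow> (\<forall>x. e x < length G) \<and> (\<forall>X. S X \<subseteq> {..<length G})"

text \<open>\<open>keep X g\<close> is the set of nodes that \<open>\<kappa>\<close> has to describe in a query \<open>X \<turnstile> g\<close>.\<close>

primrec sound_queries ::
    "dag \<Rightarrow> (nat set \<Rightarrow> nat \<Rightarrow> bool) \<Rightarrow> (nat set \<Rightarrow> nat \<Rightarrow> nat set) \<Rightarrow> fm \<Rightarrow> bool" where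
  "sound_queries G Q keep (In_left x) \<longleftrightarrow> True"
| "sound_queries G Q keep (Is_goal x) \<longleftrightarrow> True"
| "sound_queries G Q keep (Sym_gt c x) \<longleftrightarrow> True"
| "sound_queries G Q keep (Child k x y) \<longleftrightarrow> True"
| "sound_queries G Q keep (Equal x y) \<longleftrightarrow> True"
| "sound_queries G Q keep (Mem X x) \<longleftrightarrow> True"
| "sound_queries G Q keep (Neg \<phi>) \<longleftrightarrow> sound_queries G Q keep \<phi>"
| "sound_queries G Q keep (And \<phi> \<psi>) \<longleftrightarrow> sound_queries G Q keep \<phi> \<and> sound_queries G Q keep \<psi>"
| "sound_queries G Q keep (Ex x \<phi>) \<longleftrightarrow> sound_queries G Q keep \<phi>"
| "sound_queries G Q keep (Fix X y \<phi> \<psi>) \<longleftrightarrow> sound_queries G Q keep \<phi> \<and> sound_queries G Q keep \<psi>"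
| "sound_queries G Q keep (Query \<kappa> y X g) \<longleftrightarrow> sound_queries G Q keep \<kappa> \<and> y \<noteq> g \<and>
     (\<forall>e S. valid_env G e S \<longrightarrow> (\<forall>i < length G.
        eval G Q \<kappa> (e(y := i)) S \<longleftrightarrow> i \<in> keep (S X) (e g)))"

locale query_machine =
  fixes p :: com and T :: "nat \<Rightarrow> nat" and B :: nat
  assumes vars_p: "com_vars p \<subseteq> {..<B}" and B: "2 \<le> B"
begin

text \<open>Above the variables of \<open>p\<close>, the store is divided into node variables, set variables, and a stack
  of temporaries, which starts with the list of all indices (in \<open>tp 0\<close>) and the input (in \<open>tp 1\<close>).\<close>

definition "iv x = B + 3 * x"
definition "sv x = B + 3 * x + 1"
definition "tp x = B + 3 * x + 2"

lemma locs [simp]: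
  "iv x = iv y \<longleftrightarrow> x = y" "sv x = sv y \<longleftrightarrow> x = y" "tp x = tp y \<longleftrightarrow> x = y"
  "iv x \<noteq> sv y" "sv y \<noteq> iv x" "iv x \<noteq> tp y" "tp y \<noteq> iv x" "sv x \<noteq> tp y" "tp y \<noteq> sv x"
  unfolding iv_def sv_def tp_def by presburger+

lemma locs_p [simp]:
  "\<not> iv x < B" "\<not> sv x < B" "\<not> tp x < B"
  "iv x \<noteq> 0" "sv x \<noteq> 0" "tp x \<noteq> 0" "iv x \<noteq> Suc 0" "sv x \<noteq> Suc 0" "tp x \<noteq> Suc 0"
  "0 \<noteq> iv x" "0 \<noteq> sv x" "0 \<noteq> tp x"
  using B unfolding iv_def sv_def tp_def by auto

text \<open>The contract of code at stack level \<open>d\<close>: it may overwrite the temporaries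
  from \<open>d\<close> on and the variables below \<open>B\<close>, where the procedure
  runs.\<close>

definition preserves :: "nat \<Rightarrow> store \<Rightarrow> store \<Rightarrow> bool" where
  "preserves d s s' \<longleftrightarrow> (\<forall>x. s' (iv x) = s (iv x)) \<and> (\<forall>x. s' (sv x) = s (sv x)) \<and>
     (\<forall>j < d. s' (tp j) = s (tp j))"

lemma preserves_trans: "preserves d s s' \<Longrightarrow> preserves d' s' s'' \<Longrightarrow> d \<le> d' \<Longrightarrow> preserves d s s''"
  unfolding preserves_def by auto

lemma preserves_refl [simp]: "preserves d s s"
  unfolding preserves_def by auto

lemma preserves_upd_tp [simp]: "d \<le> j \<Longrightarrow> preserves d s (s'(tp j := t)) \<longleftrightarrow> preserves d s s'"
  unfolding preserves_def by auto

text \<open>Any nonatomic entry counts as membership, and beyond the end of a list the atom is read;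
  so \<open>Atom\<close> represents the empty set.\<close>

definition set_rep :: "nat \<Rightarrow> tree \<Rightarrow> nat set \<Rightarrow> bool" where
  "set_rep n t A \<longleftrightarrow> (\<forall>i < n. hd_tree ((tl_tree ^^ i) t) \<noteq> Atom \<longleftrightarrow> i \<in> A)"

definition state :: "dag \<Rightarrow> (nat \<Rightarrow> nat) \<Rightarrow> (nat \<Rightarrow> nat set) \<Rightarrow> store \<Rightarrow> bool" where
  "state G e S s \<longleftrightarrow> valid_env G e S \<and> s (tp 0) = idx_list (length G) \<and> s (tp 1) = tree_of_dag G \<and>
     (\<forall>x. s (iv x) = tree_of_nat (e x)) \<and> (\<forall>X. set_rep (length G) (s (sv X)) (S X))"

lemma state_preserves: "state G e S s \<Longrightarrow> preserves d s s' \<Longrightarrow> 2 \<le> d \<Longrightarrow> state G e S s'"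
  unfolding state_def preserves_def by auto

subsection \<open>Basic programs\<close>

text \<open>The list of indices only serves as a clock here.\<close>

definition strip :: "nat \<Rightarrow> nat \<Rightarrow> nat \<Rightarrow> nat \<Rightarrow> com" where
  "strip a b l x = For l x (tp 0)
     (Cond (Var b) (Seq (Assign a (Tl (Var a))) (Assign b (Tl (Var b)))) Skip)"

lemma runs_strip:
  assumes "s (tp 0) = idx_list n" "s b = tree_of_nat k" "k \<le> n"
    "distinct [a, b, l, x, 0]" "4 + 16 * n \<le> c"
  shows "runs (strip a b l x) c s
    (\<lambda>s'. s' a = (tl_tree ^^ k) (s a) \<and> (\<forall>v. v \<notin> {a, b, l, x} \<longrightarrow> s' v = s v))"
  unfolding strip_def
proof (rule runs_For[where b = 8 and n = n and I = "\<lambda>j s'.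
      s' a = (tl_tree ^^ (min k (n - j))) (s a) \<and> s' b = tree_of_nat (k - (n - j)) \<and>
      (\<forall>v. v \<notin> {a, b, l, x} \<longrightarrow> s' v = s v)"])
  fix j s'
  assume j: "j < n" and s': "s' a = (tl_tree ^^ (min k (n - Suc j))) (s a) \<and>
      s' b = tree_of_nat (k - (n - Suc j)) \<and> (\<forall>v. v \<notin> {a, b, l, x} \<longrightarrow> s' v = s v)"
    "s' l = idx_list (Suc j)"
  show "runs (Cond (Var b) (Seq (Assign a (Tl (Var a))) (Assign b (Tl (Var b)))) Skip) 8
     (s'(x := tree_of_nat j))
     (\<lambda>s''. s'' l = idx_list (Suc j) \<and>
        (s''(l := idx_list j)) a = (tl_tree ^^ min k (n - j)) (s a) \<and>
        (s''(l := idx_list j)) b = tree_of_nat (k - (n - j)) \<and>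
        (\<forall>v. v \<notin> {a, b, l, x} \<longrightarrow> (s''(l := idx_list j)) v = s v))"
  proof (cases "k - (n - Suc j)")
    case 0
    then have "min k (n - j) = min k (n - Suc j)" "k - (n - j) = 0" by auto
    then show ?thesis using s' 0 assms(4) by (intro runs_Cond runs_Skip) auto
  next
    case (Suc m)
    then have "min k (n - j) = Suc (min k (n - Suc j))" "k - (n - j) = m" using j by auto
    then show ?thesis
      using s' Suc assms(4) by (intro runs_Cond runs_Assign_Seq runs_Assign) auto
  qed
qed (use assms in auto)

definition lookup :: "nat \<Rightarrow> expr \<Rightarrow> nat \<Rightarrow> com" where
  "lookup d e x = Seq (Assign (tp d) e) (Seq (Assign (tp (d + 1)) (Var (iv x)))
     (Seq (strip (tp d) (tp (d + 1)) (tp (d + 2)) (tp (d + 3))) (Assign (tp d) (Hd (Var (tp d))))))"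

lemma runs_lookup:
  assumes "state G e S s" "2 \<le> d" "14 + cost a + 16 * length G \<le> c"
  shows "runs (lookup d a x) c s (\<lambda>s'. preserves d s s' \<and>
    s' (tp d) = hd_tree ((tl_tree ^^ e x) (eval_expr s a)))"
proof -
  let ?s = "s(tp d := eval_expr s a, tp (d + 1) := tree_of_nat (e x))"
  have "e x \<le> length G" using assms(1) by (auto simp: state_def valid_env_def intro: less_imp_le)
  then have 1: "runs (strip (tp d) (tp (d + 1)) (tp (d + 2)) (tp (d + 3))) (4 + 16 * length G) ?s
    (\<lambda>s'. s' (tp d) = (tl_tree ^^ e x) (?s (tp d)) \<and>
      (\<forall>v. v \<notin> {tp d, tp (d + 1), tp (d + 2), tp (d + 3)} \<longrightarrow> s' v = ?s v))"
    by (intro runs_strip[where n = "length G"]) (use assms in \<open>auto simp: state_def\<close>)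
  show ?thesis
    unfolding lookup_def
  proof (intro runs_Assign_Seq)
    show "runs (Seq (strip (tp d) (tp (d + 1)) (tp (d + 2)) (tp (d + 3))) (Assign (tp d) (Hd (Var (tp d)))))
     (c - (1 + cost a) - (1 + cost (Var (iv x))))
     (s(tp d := eval_expr s a,
        tp (d + 1) := eval_expr (s(tp d := eval_expr s a)) (Var (iv x))))
     (\<lambda>s'. preserves d s s' \<and> s' (tp d) = hd_tree ((tl_tree ^^ e x) (eval_expr s a)))"
    proof -
      have eq: "s(tp d := eval_expr s a,
          tp (d + 1) := eval_expr (s(tp d := eval_expr s a)) (Var (iv x))) = ?s"
        using assms by (simp add: state_def)
      show ?thesis
        unfolding eq
        by (rule runs_Seq[OF 1]) (use assms in \<open>auto intro!: runs_Assign simp: preserves_def\<close>)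
    qed
  qed (use assms in auto)
qed

lemma state_node: "state G e S s \<Longrightarrow>
    hd_tree ((tl_tree ^^ e x) (eval_expr s (Var (tp 1)))) = tree_of_node (G ! e x)"
  by (simp add: state_def valid_env_def tree_of_dag_def hd_tl_funpow_tree_of_list)

text \<open>Trees cannot be compared directly, so equality of unary numbers is tested by computing
  both truncated differences, which are 0 exactly when the numbers agree. The copies are needed
  because \<open>strip\<close> consumes its counter.\<close>

definition compare :: "nat \<Rightarrow> com" where
  "compare d = Seq (Assign (tp (d + 2)) (Var (tp d))) (Seq (Assign (tp (d + 3)) (Var (tp (d + 1))))
     (Seq (strip (tp d) (tp (d + 3)) (tp (d + 4)) (tp (d + 5)))
     (Seq (strip (tp (d + 1)) (tp (d + 2)) (tp (d + 4)) (tp (d + 5)))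
     (Cond (Var (tp d)) (Assign (tp d) Nil_expr)
     (Cond (Var (tp (d + 1))) (Assign (tp d) Nil_expr)
       (Assign (tp d) (Cons_expr Nil_expr Nil_expr)))))))"

lemma runs_compare:
  assumes "s (tp 0) = idx_list n" "s (tp d) = tree_of_nat i" "s (tp (d + 1)) = tree_of_nat j"
    "i \<le> n" "j \<le> n" "2 \<le> d" "20 + 32 * n \<le> c"
  shows "runs (compare d) c s (\<lambda>s'. preserves d s s' \<and> s' (tp d) = tree_of_bool (i = j))"
proof -
  let ?s = "s(tp (d + 2) := tree_of_nat i, tp (d + 3) := tree_of_nat j)"
  have 1: "runs (strip (tp d) (tp (d + 3)) (tp (d + 4)) (tp (d + 5))) (4 + 16 * n) ?s
    (\<lambda>s'. s' (tp d) = (tl_tree ^^ j) (?s (tp d)) \<and>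
      (\<forall>v. v \<notin> {tp d, tp (d + 3), tp (d + 4), tp (d + 5)} \<longrightarrow> s' v = ?s v))"
    by (intro runs_strip[where n = n]) (use assms in auto)
  have 2: "runs (strip (tp (d + 1)) (tp (d + 2)) (tp (d + 4)) (tp (d + 5))) (4 + 16 * n) s'
    (\<lambda>s''. s'' (tp (d + 1)) = (tl_tree ^^ i) (s' (tp (d + 1))) \<and>
      (\<forall>v. v \<notin> {tp (d + 1), tp (d + 2), tp (d + 4), tp (d + 5)} \<longrightarrow> s'' v = s' v))"
    if "\<forall>v. v \<notin> {tp d, tp (d + 3), tp (d + 4), tp (d + 5)} \<longrightarrow> s' v = ?s v" for s'
    by (intro runs_strip[where n = n]) (use assms that in auto)
  show ?thesis
    unfolding compare_def
  proof (intro runs_Assign_Seq, goal_cases)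
    case 3
    have eq: "(s(tp (d + 2) := eval_expr s (Var (tp d)),
        tp (d + 3) := eval_expr (s(tp (d + 2) := eval_expr s (Var (tp d)))) (Var (tp (d + 1))))) = ?s"
      using assms by simp
    show ?case
      unfolding eq
    proof (rule runs_Seq[OF 1], goal_cases)
      case (2 s')
      then have s': "\<forall>v. v \<notin> {tp d, tp (d + 3), tp (d + 4), tp (d + 5)} \<longrightarrow> s' v = ?s v" by blast
      have d: "s' (tp d) = tree_of_nat (i - j)" using 2 assms by (simp add: tl_funpow_tree_of_nat)
      show ?case
      proof (rule runs_Seq[OF \<open>\<And>s'. _ \<Longrightarrow> runs (strip (tp (d + 1)) _ _ _) _ s' _\<close>[OF s']], goal_cases)
        case (2 s'')
        have d'': "s'' (tp d) = tree_of_nat (i - j)" using 2 d by auto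
        have e'': "s'' (tp (d + 1)) = tree_of_nat (j - i)"
          using 2 s' assms by (simp add: tl_funpow_tree_of_nat)
        have "preserves d s s''" using 2 s' assms by (auto simp: preserves_def)
        then show ?case
          using d'' e'' assms
          by (intro runs_Cond runs_Assign) (auto simp: tree_of_bool_True)
      qed (use assms in auto)
    qed (use assms in auto)
  qed (use assms in auto)
qed

definition run_query :: "nat \<Rightarrow> com" where
  "run_query j = Seq (clear B) (Seq (Assign 0 (Var (tp j))) p)"

lemma runs_query:
  assumes "answers p (s (tp j)) t b" "t \<le> T'" "4 + 2 * B + T' \<le> c"
  shows "runs (run_query j) c s (\<lambda>s'. (\<forall>v. \<not> v < B \<longrightarrow> s' v = s v) \<and> (s' 1 \<noteq> Atom \<longleftrightarrow> b))"
proof -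
  obtain s1 where s1: "exec p ((\<lambda>_. Atom)(0 := s (tp j))) t s1" "b \<longleftrightarrow> s1 1 \<noteq> Atom"
    using assms(1) by (auto simp: answers_def)
  let ?r = "(\<lambda>v. if v < B then Atom else s v)(0 := s (tp j))"
  obtain r where r: "exec p ?r t r" "\<forall>v \<in> {..<B}. s1 v = r v" "\<forall>v. v \<notin> {..<B} \<longrightarrow> r v = ?r v"
  proof -
    have "((\<lambda>_. Atom)(0 := s (tp j))) v = ?r v" if "v \<in> {..<B}" for v using that by simp
    from exec_frame[OF s1(1) vars_p this] that show thesis by blast
  qed
  have "r 1 = s1 1" "\<And>v. \<not> v < B \<Longrightarrow> r v = s v" using r B by auto
  with r(1) s1(2) assms(2) have p: "runs p T' ?r
      (\<lambda>s'. (\<forall>v. \<not> v < B \<longrightarrow> s' v = s v) \<and> (s' 1 \<noteq> Atom \<longleftrightarrow> b))"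
    unfolding runs_def by (intro exI[of _ t] exI[of _ r]) simp
  show ?thesis
    unfolding run_query_def
  proof (rule runs_Seq[OF runs_clear], goal_cases)
    case (2 s')
    then have eq: "s'(0 := eval_expr s' (Var (tp j))) = ?r" by simp
    show ?case
      by (rule runs_Assign_Seq, use assms in simp, unfold eq, rule runs_mono[OF p])
        (use assms in auto)
  qed (use assms in auto)
qed

definition True_expr :: expr where "True_expr = Cons_expr Nil_expr Nil_expr"

lemma True_expr [simp]: "eval_expr s True_expr = Cell Atom Atom" "cost True_expr = 3"
  by (simp_all add: True_expr_def)

lemma eval_expr_Tl_funpow [simp]: "eval_expr s ((Tl ^^ k) e) = (tl_tree ^^ k) (eval_expr s e)"
  by (induction k) auto

lemma cost_Tl_funpow [simp]: "cost ((Tl ^^ k) e) = k + cost e"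
  by (induction k) auto

text \<open>Symbol and children are shared with the input; only the tags are new. The membership bit
  is made canonical first, because a set variable may hold any nonatomic tree there, while the
  encoding of a DAG has to be exact.\<close>

definition keep_node :: "nat \<Rightarrow> nat \<Rightarrow> nat \<Rightarrow> nat \<Rightarrow> com" where
  "keep_node d y X g = Seq (lookup (d + 5) (Var (tp 1)) y)
     (Seq (lookup (d + 6) (Var (sv X)) y)
     (Seq (Cond (Var (tp (d + 6))) (Assign (tp (d + 6)) True_expr) (Assign (tp (d + 6)) Nil_expr))
     (Seq (Assign (tp (d + 7)) (Var (iv y)))
     (Seq (Assign (tp (d + 8)) (Var (iv g)))
     (Seq (compare (d + 7))
     (Assign (tp (d + 2)) (Cons_expr
        (Cons_expr (Hd (Var (tp (d + 5)))) (Cons_expr (Hd (Tl (Var (tp (d + 5)))))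
          (Cons_expr (Var (tp (d + 6))) (Cons_expr (Var (tp (d + 7))) Nil_expr))))
        (Var (tp (d + 2))))))))))"

definition drop_node :: "nat \<Rightarrow> com" where
  "drop_node d = Assign (tp (d + 2)) (Cons_expr
     (Cons_expr Nil_expr (Cons_expr Nil_expr (Cons_expr True_expr (Cons_expr Nil_expr Nil_expr))))
     (Var (tp (d + 2))))"

definition comprehension :: "nat \<Rightarrow> nat \<Rightarrow> com \<Rightarrow> com" where
  "comprehension d y c = Seq (Assign (tp d) Nil_expr) (For (tp (d + 1)) (iv y) (tp 0)
     (Seq c (Assign (tp d) (Cons_expr (Var (tp (d + 2))) (Var (tp d))))))"

text \<open>At level \<open>d\<close> the truth value ends up in \<open>tp d\<close>. Overwritten
  node and set variables are saved in temporaries and restored, so that formulas can be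
  nested.\<close>

primrec compile :: "nat \<Rightarrow> fm \<Rightarrow> com" where
  "compile d (In_left x) = Seq (lookup d (Var (tp 1)) x) (Assign (tp d) (Hd (Tl (Tl (Var (tp d))))))"
| "compile d (Is_goal x) = Seq (lookup d (Var (tp 1)) x) (Assign (tp d) (Hd (Tl (Tl (Tl (Var (tp d)))))))"
| "compile d (Sym_gt c x) = Seq (lookup d (Var (tp 1)) x) (Assign (tp d) ((Tl ^^ c) (Hd (Var (tp d)))))"
| "compile d (Child k x y) = Seq (lookup d (Var (tp 1)) x)
     (Seq (Assign (tp d) ((Tl ^^ k) (Hd (Tl (Var (tp d))))))
     (Cond (Var (tp d))
       (Seq (Assign (tp d) (Hd (Var (tp d)))) (Seq (Assign (tp (d + 1)) (Var (iv y))) (compare d)))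
       Skip))"
| "compile d (Equal x y) =
     Seq (Assign (tp d) (Var (iv x))) (Seq (Assign (tp (d + 1)) (Var (iv y))) (compare d))"
| "compile d (Mem X x) = lookup d (Var (sv X)) x"
| "compile d (Neg \<phi>) = Seq (compile d \<phi>)
     (Cond (Var (tp d)) (Assign (tp d) Nil_expr) (Assign (tp d) True_expr))"
| "compile d (And \<phi> \<psi>) = Seq (compile d \<phi>) (Cond (Var (tp d)) (compile d \<psi>) Skip)"
| "compile d (Ex x \<phi>) = Seq (Assign (tp d) Nil_expr) (Seq (Assign (tp (d + 1)) (Var (iv x)))
     (Seq (For (tp (d + 2)) (iv x) (tp 0)
       (Seq (compile (d + 3) \<phi>) (Cond (Var (tp (d + 3))) (Assign (tp d) True_expr) Skip)))
     (Assign (iv x) (Var (tp (d + 1))))))"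
| "compile d (Fix X y \<phi> \<psi>) =
     Seq (Assign (tp (d + 1)) (Var (sv X))) (Seq (Assign (tp (d + 2)) (Var (iv y)))
     (Seq (Assign (sv X) Nil_expr)
     (Seq (For (tp (d + 3)) (tp (d + 4)) (tp 0)
       (Seq (comprehension (d + 5) y (compile (d + 7) \<phi>)) (Assign (sv X) (Var (tp (d + 5))))))
     (Seq (Assign (iv y) (Var (tp (d + 2))))
     (Seq (compile (d + 3) \<psi>)
     (Seq (Assign (tp d) (Var (tp (d + 3)))) (Assign (sv X) (Var (tp (d + 1))))))))))"
| "compile d (Query \<kappa> y X g) =
     Seq (Assign (tp (d + 1)) (Var (iv y))) (Seq (Assign (tp (d + 2)) Nil_expr)
     (Seq (For (tp (d + 3)) (iv y) (tp 0)
       (Seq (compile (d + 4) \<kappa>) (Cond (Var (tp (d + 4))) (keep_node d y X g) (drop_node d))))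
     (Seq (Assign (iv y) (Var (tp (d + 1))))
     (Seq (run_query (d + 2)) (Assign (tp d) (Var 1))))))"

definition queries_ok ::
    "dag \<Rightarrow> (nat set \<Rightarrow> nat \<Rightarrow> bool) \<Rightarrow> (nat set \<Rightarrow> nat \<Rightarrow> nat set) \<Rightarrow> bool" where
  "queries_ok G Q keep \<longleftrightarrow> (\<forall>i < length G. set (children (G ! i)) \<subseteq> {..<length G}) \<and>
     (\<forall>X g. X \<subseteq> {..<length G} \<longrightarrow> g < length G \<longrightarrow>
       (\<exists>t \<le> T (length G). answers p (tree_of_dag (query_dag G (keep X g) X g)) t (Q X g)))"

definition computes :: "dag \<Rightarrow> (nat set \<Rightarrow> nat \<Rightarrow> bool) \<Rightarrow> nat \<Rightarrow> fm \<Rightarrow> nat \<Rightarrow> bool" where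
  "computes G Q d \<phi> b \<longleftrightarrow> (\<forall>e S s. state G e S s \<longrightarrow>
     runs (compile d \<phi>) b s (\<lambda>s'. preserves d s s' \<and> (s' (tp d) \<noteq> Atom \<longleftrightarrow> eval G Q \<phi> e S)))"

lemma computesD:
  "computes G Q d \<phi> b \<Longrightarrow> state G e S s \<Longrightarrow>
    runs (compile d \<phi>) b s (\<lambda>s'. preserves d s s' \<and> (s' (tp d) \<noteq> Atom \<longleftrightarrow> eval G Q \<phi> e S))"
  unfolding computes_def by blast

section \<open>Correctness and cost of each connective\<close>

lemma runs_node:
  assumes "state G e S s" "2 \<le> d" "15 + 16 * length G \<le> c"
  shows "runs (lookup d (Var (tp 1)) x) c s (\<lambda>s'. preserves d s s' \<and>
    s' (tp d) = tree_of_node (G ! e x))"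
  by (rule runs_mono[OF runs_lookup[OF assms(1,2) order_refl]])
    (use assms state_node[OF assms(1)] in auto)

lemma hd_tree_of_node:
  "hd_tree (tree_of_node v) = tree_of_nat (node_code v)"
  "hd_tree (tl_tree (tree_of_node v)) = tree_of_list (map tree_of_nat (children v))"
  "hd_tree (tl_tree (tl_tree (tree_of_node v))) = tree_of_bool (in_left v)"
  "hd_tree (tl_tree (tl_tree (tl_tree (tree_of_node v)))) = tree_of_bool (is_goal v)"
  by (simp_all add: tree_of_node_def node_code_def)

lemma computes_In_left:
  assumes "2 \<le> d" shows "computes G Q d (In_left x) (20 + length G * 16)"
  unfolding computes_def compile.simps
proof (intro allI impI)
  fix e S s assume s: "state G e S s"
  show "runs (Seq (lookup d (Var (tp 1)) x) (Assign (tp d) (Hd (Tl (Tl (Var (tp d)))))))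
      (20 + length G * 16) s
      (\<lambda>s'. preserves d s s' \<and> (s' (tp d) \<noteq> Atom \<longleftrightarrow> eval G Q (In_left x) e S))"
    by (rule runs_Seq[OF runs_node[OF s assms order_refl]])
      (auto intro!: runs_Assign simp: hd_tree_of_node)
qed

lemma computes_Is_goal:
  assumes "2 \<le> d" shows "computes G Q d (Is_goal x) (21 + length G * 16)"
  unfolding computes_def compile.simps
proof (intro allI impI)
  fix e S s assume s: "state G e S s"
  show "runs (Seq (lookup d (Var (tp 1)) x) (Assign (tp d) (Hd (Tl (Tl (Tl (Var (tp d))))))))
      (21 + length G * 16) s
      (\<lambda>s'. preserves d s s' \<and> (s' (tp d) \<noteq> Atom \<longleftrightarrow> eval G Q (Is_goal x) e S))"
    by (rule runs_Seq[OF runs_node[OF s assms order_refl]])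
      (auto intro!: runs_Assign simp: hd_tree_of_node)
qed

lemma computes_Sym_gt:
  assumes "2 \<le> d" shows "computes G Q d (Sym_gt c x) (18 + c + length G * 16)"
  unfolding computes_def compile.simps
proof (intro allI impI)
  fix e S s assume s: "state G e S s"
  show "runs (Seq (lookup d (Var (tp 1)) x) (Assign (tp d) ((Tl ^^ c) (Hd (Var (tp d))))))
      (18 + c + length G * 16) s
      (\<lambda>s'. preserves d s s' \<and> (s' (tp d) \<noteq> Atom \<longleftrightarrow> eval G Q (Sym_gt c x) e S))"
    by (rule runs_Seq[OF runs_node[OF s assms order_refl]])
      (auto intro!: runs_Assign simp: hd_tree_of_node tl_funpow_tree_of_nat)
qed

lemma tree_of_list_eq_Atom [simp]: "tree_of_list xs = Atom \<longleftrightarrow> xs = []"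
  by (cases xs) auto

lemma computes_Child:
  assumes "2 \<le> d" "\<And>i. i < length G \<Longrightarrow> set (children (G ! i)) \<subseteq> {..<length G}"
  shows "computes G Q d (Child k x y) (60 + k + length G * 48)"
  unfolding computes_def compile.simps
proof (intro allI impI)
  fix e S s assume s: "state G e S s"
  let ?n = "length G" and ?ch = "children (G ! e x)"
  have ch: "set ?ch \<subseteq> {..<?n}" and ey: "e y < ?n"
    using s assms(2) by (auto simp: state_def valid_env_def)
  show "runs (Seq (lookup d (Var (tp 1)) x)
     (Seq (Assign (tp d) ((Tl ^^ k) (Hd (Tl (Var (tp d))))))
     (Cond (Var (tp d))
       (Seq (Assign (tp d) (Hd (Var (tp d)))) (Seq (Assign (tp (d + 1)) (Var (iv y))) (compare d)))
       Skip)))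
      (60 + k + length G * 48) s
      (\<lambda>s'. preserves d s s' \<and> (s' (tp d) \<noteq> Atom \<longleftrightarrow> eval G Q (Child k x y) e S))"
  proof (rule runs_Seq[OF runs_node[OF s assms(1) order_refl]], goal_cases)
    case (2 s')
    let ?s = "s'(tp d := tree_of_list (drop k (map tree_of_nat ?ch)))"
    have s'': "s'(tp d := eval_expr s' ((Tl ^^ k) (Hd (Tl (Var (tp d)))))) = ?s"
      using 2 by (simp add: hd_tree_of_node tl_funpow_tree_of_list)
    have st: "state G e S ?s"
      by (rule state_preserves[OF s, of d]) (use 2 assms in auto)
    show ?case
    proof (rule runs_Assign_Seq, simp, unfold s'', rule runs_Cond, goal_cases)
      case 2
      then have k: "k < length ?ch" by auto
      then have hd: "eval_expr ?s (Hd (Var (tp d))) = tree_of_nat (?ch ! k)"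
        by (simp add: Cons_nth_drop_Suc[symmetric])
      let ?r = "?s(tp d := tree_of_nat (?ch ! k), tp (d + 1) := tree_of_nat (e y))"
      have r: "?s(tp d := tree_of_nat (?ch ! k),
          tp (d + 1) := eval_expr (?s(tp d := tree_of_nat (?ch ! k))) (Var (iv y))) = ?r"
        using st by (simp add: state_def)
      have "?ch ! k < ?n" using ch k nth_mem by blast
      have "runs (compare d) (20 + 32 * ?n) ?r
          (\<lambda>s'. preserves d ?r s' \<and> s' (tp d) = tree_of_bool (?ch ! k = e y))"
        by (rule runs_compare)
          (use st assms ey \<open>?ch ! k < ?n\<close> in \<open>auto simp: state_def intro: less_imp_le\<close>)
      moreover have "preserves d s s''" if "preserves d ?r s''" for s''
        by (rule preserves_trans[of d s s' d]) (use that \<open>preserves d s s' \<and> _\<close> in \<open>auto simp: preserves_def\<close>)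
      ultimately show ?case
        by (intro runs_Assign_Seq; (simp only: hd r)?) (auto elim!: runs_mono simp: k)
    next
      \<comment> \<open>There is no child at position \<open>k\<close>: \<open>tp d\<close> already
        holds the end of the list, the atom, which is the negative answer.\<close>
      case 3
      then show ?case using 2(1) by (intro runs_Skip) (auto simp: \<open>preserves d s s' \<and> _\<close>)
    qed simp
  qed simp
qed

lemma computes_Equal:
  assumes "2 \<le> d" shows "computes G Q d (Equal x y) (30 + length G * 32)"
  unfolding computes_def compile.simps
proof (intro allI impI)
  fix e S s assume s: "state G e S s"
  let ?r = "s(tp d := tree_of_nat (e x), tp (d + 1) := tree_of_nat (e y))"
  have r: "s(tp d := eval_expr s (Var (iv x)),
      tp (d + 1) := eval_expr (s(tp d := eval_expr s (Var (iv x)))) (Var (iv y))) = ?r"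
    using s by (simp add: state_def)
  have "runs (compare d) (20 + 32 * length G) ?r
      (\<lambda>s'. preserves d ?r s' \<and> s' (tp d) = tree_of_bool (e x = e y))"
    by (rule runs_compare) (use s assms in \<open>auto simp: state_def valid_env_def intro: less_imp_le\<close>)
  moreover have "preserves d s s''" if "preserves d ?r s''" for s''
    using that by (auto simp: preserves_def)
  ultimately show "runs (Seq (Assign (tp d) (Var (iv x))) (Seq (Assign (tp (d + 1)) (Var (iv y))) (compare d)))
     (30 + length G * 32) s
      (\<lambda>s'. preserves d s s' \<and> (s' (tp d) \<noteq> Atom \<longleftrightarrow> eval G Q (Equal x y) e S))"
    by (intro runs_Assign_Seq; (simp only: r)?) (auto elim!: runs_mono)
qed

lemma computes_Mem:
  assumes "2 \<le> d" shows "computes G Q d (Mem X x) (15 + length G * 16)"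
  unfolding computes_def compile.simps
proof (intro allI impI)
  fix e S s assume s: "state G e S s"
  show "runs (lookup d (Var (sv X)) x) (15 + length G * 16) s
      (\<lambda>s'. preserves d s s' \<and> (s' (tp d) \<noteq> Atom \<longleftrightarrow> eval G Q (Mem X x) e S))"
    by (rule runs_mono[OF runs_lookup[OF s assms order_refl]])
      (use s in \<open>auto simp: state_def valid_env_def set_rep_def\<close>)
qed

lemma computes_Neg:
  assumes "computes G Q d \<phi> b" shows "computes G Q d (Neg \<phi>) (b + 10)"
  unfolding computes_def compile.simps
proof (intro allI impI)
  fix e S s assume s: "state G e S s"
  show "runs (Seq (compile d \<phi>) (Cond (Var (tp d)) (Assign (tp d) Nil_expr) (Assign (tp d) True_expr)))
      (b + 10) s (\<lambda>s'. preserves d s s' \<and> (s' (tp d) \<noteq> Atom \<longleftrightarrow> eval G Q (Neg \<phi>) e S))"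
    by (rule runs_Seq[OF computesD[OF assms s]]) (auto intro!: runs_Cond runs_Assign)
qed

lemma computes_And:
  assumes "computes G Q d \<phi> a" "computes G Q d \<psi> b" "2 \<le> d"
  shows "computes G Q d (And \<phi> \<psi>) (a + b + 10)"
  unfolding computes_def compile.simps
proof (intro allI impI)
  fix e S s assume s: "state G e S s"
  show "runs (Seq (compile d \<phi>) (Cond (Var (tp d)) (compile d \<psi>) Skip))
      (a + b + 10) s (\<lambda>s'. preserves d s s' \<and> (s' (tp d) \<noteq> Atom \<longleftrightarrow> eval G Q (And \<phi> \<psi>) e S))"
  proof (rule runs_Seq[OF computesD[OF assms(1) s]], goal_cases)
    case (2 s')
    then have "state G e S s'" using state_preserves s assms(3) by blast
    from computesD[OF assms(2) this] show ?case
      by (intro runs_Cond runs_Skip) (use 2 in \<open>auto elim!: runs_mono intro: preserves_trans\<close>)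
  qed simp
qed

lemma state_upd_iv:
  assumes "state G e S s" "k < length G" "\<And>z. z \<noteq> x \<Longrightarrow> s' (iv z) = s (iv z)"
    "\<And>X. s' (sv X) = s (sv X)" "s' (tp 0) = s (tp 0)" "s' (tp 1) = s (tp 1)"
    "s' (iv x) = tree_of_nat k"
  shows "state G (e(x := k)) S s'"
  using assms by (auto simp: state_def valid_env_def)

lemma computes_Ex:
  assumes "computes G Q (d + 3) \<phi> b" "2 \<le> d"
  shows "computes G Q d (Ex x \<phi>) (20 + length G * (b + 20))"
  unfolding computes_def compile.simps
proof (intro allI impI)
  fix e S s assume s: "state G e S s"
  let ?n = "length G"
  let ?c = "Seq (compile (d + 3) \<phi>) (Cond (Var (tp (d + 3))) (Assign (tp d) True_expr) Skip)"
  let ?I = "\<lambda>k s'. (\<forall>z. z \<noteq> x \<longrightarrow> s' (iv z) = s (iv z)) \<and> (\<forall>X. s' (sv X) = s (sv X)) \<and>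
    (\<forall>j < d. s' (tp j) = s (tp j)) \<and> s' (tp (d + 1)) = s (iv x) \<and>
    (s' (tp d) \<noteq> Atom \<longleftrightarrow> (\<exists>i. k \<le> i \<and> i < ?n \<and> eval G Q \<phi> (e(x := i)) S))"
  have loop: "runs (For (tp (d + 2)) (iv x) (tp 0) ?c) (4 + ?n * (b + 18))
      (s(tp d := Atom, tp (d + 1) := s (iv x))) (?I 0)"
  proof (rule runs_For[where b = "b + 10" and n = ?n and I = ?I])
    fix k s'
    assume k: "k < ?n" and I: "?I (Suc k) s'" and l: "s' (tp (d + 2)) = idx_list (Suc k)"
    let ?s = "s'(iv x := tree_of_nat k)"
    have "state G (e(x := k)) S ?s"
      by (rule state_upd_iv[OF s k]) (use I assms in auto)
    note body = computesD[OF assms(1) this]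
    have "k \<le> i \<longleftrightarrow> i = k \<or> Suc k \<le> i" for i by auto
    then have ex: "(\<exists>i. k \<le> i \<and> i < ?n \<and> eval G Q \<phi> (e(x := i)) S) \<longleftrightarrow>
        eval G Q \<phi> (e(x := k)) S \<or> (\<exists>i. Suc k \<le> i \<and> i < ?n \<and> eval G Q \<phi> (e(x := i)) S)"
      using k by auto
    show "runs ?c (b + 10) ?s
        (\<lambda>s''. s'' (tp (d + 2)) = idx_list (Suc k) \<and> ?I k (s''(tp (d + 2) := idx_list k)))"
    proof (rule runs_Seq[OF body], goal_cases)
      case (2 s'')
      then have p: "s'' (iv z) = ?s (iv z)" "s'' (sv X) = ?s (sv X)" "j < d + 3 \<Longrightarrow> s'' (tp j) = ?s (tp j)"
        for z X j by (auto simp: preserves_def)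
      show ?case
        by (rule runs_Cond; (rule runs_Assign | rule runs_Skip)?)
          (use I l p 2 in \<open>auto simp: ex\<close>)
    qed simp
  qed (use s assms in \<open>auto simp: state_def\<close>)
  show "runs (Seq (Assign (tp d) Nil_expr) (Seq (Assign (tp (d + 1)) (Var (iv x)))
     (Seq (For (tp (d + 2)) (iv x) (tp 0) ?c) (Assign (iv x) (Var (tp (d + 1)))))))
     (20 + ?n * (b + 20)) s
      (\<lambda>s'. preserves d s s' \<and> (s' (tp d) \<noteq> Atom \<longleftrightarrow> eval G Q (Ex x \<phi>) e S))"
  proof (intro runs_Assign_Seq, goal_cases)
    case 3
    have eq: "s(tp d := eval_expr s Nil_expr,
        tp (d + 1) := eval_expr (s(tp d := eval_expr s Nil_expr)) (Var (iv x))) =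
        s(tp d := Atom, tp (d + 1) := s (iv x))" by simp
    show ?case
      unfolding eq
    proof (rule runs_Seq[OF loop], goal_cases)
      case (2 s')
      then show ?case by (intro runs_Assign) (auto simp: preserves_def algebra_simps)
    qed (simp add: algebra_simps)
  qed simp_all
qed

text \<open>\<open>state\<close> is not assumed at entry because, inside \<open>Fix\<close>, the
  previous round has left a stale index in \<open>iv y\<close>. The fourth assumption asks for a
  proper state only once \<open>y\<close> has been set.\<close>

lemma runs_comprehension:
  assumes "computes G Q (d + 2) \<phi> b" "2 \<le> d" "s (tp 0) = idx_list (length G)"
    "\<And>i s'. i < length G \<Longrightarrow> (\<And>z. z \<noteq> y \<Longrightarrow> s' (iv z) = s (iv z)) \<Longrightarrow>
      (\<And>X. s' (sv X) = s (sv X)) \<Longrightarrow> (\<And>j. j < d \<Longrightarrow> s' (tp j) = s (tp j)) \<Longrightarrow>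
      s' (iv y) = tree_of_nat i \<Longrightarrow> state G (e(y := i)) S s'"
    "10 + length G * (b + 20) \<le> c"
  shows "runs (comprehension d y (compile (d + 2) \<phi>)) c s (\<lambda>s'.
    (\<forall>z. z \<noteq> y \<longrightarrow> s' (iv z) = s (iv z)) \<and> (\<forall>X. s' (sv X) = s (sv X)) \<and>
    (\<forall>j < d. s' (tp j) = s (tp j)) \<and>
    set_rep (length G) (s' (tp d)) {i. i < length G \<and> eval G Q \<phi> (e(y := i)) S})"
proof -
  let ?n = "length G"
  let ?I = "\<lambda>k s'. (\<forall>z. z \<noteq> y \<longrightarrow> s' (iv z) = s (iv z)) \<and> (\<forall>X. s' (sv X) = s (sv X)) \<and>
    (\<forall>j < d. s' (tp j) = s (tp j)) \<and>
    (\<forall>i. k \<le> i \<longrightarrow> i < ?n \<longrightarrow>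
      (hd_tree ((tl_tree ^^ (i - k)) (s' (tp d))) \<noteq> Atom \<longleftrightarrow> eval G Q \<phi> (e(y := i)) S))"
  let ?c = "Seq (compile (d + 2) \<phi>) (Assign (tp d) (Cons_expr (Var (tp (d + 2))) (Var (tp d))))"
  show ?thesis
    unfolding comprehension_def
  proof (rule runs_Assign_Seq, goal_cases)
    case 2
    show ?case
    proof (rule runs_For[where b = "b + 5" and n = ?n and I = ?I])
      fix k s'
      assume k: "k < ?n" and I: "?I (Suc k) s'" and l: "s' (tp (d + 1)) = idx_list (Suc k)"
      let ?s = "s'(iv y := tree_of_nat k)"
      have "state G (e(y := k)) S ?s" by (rule assms(4)[OF k]) (use I in auto)
      note body = computesD[OF assms(1) this]
      show "runs ?c (b + 5) ?s
        (\<lambda>s''. s'' (tp (d + 1)) = idx_list (Suc k) \<and> ?I k (s''(tp (d + 1) := idx_list k)))"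
      proof (rule runs_Seq[OF body], goal_cases)
        case (2 s'')
        then have p: "s'' (iv z) = ?s (iv z)" "s'' (sv X) = ?s (sv X)"
          "j < d + 2 \<Longrightarrow> s'' (tp j) = ?s (tp j)" for z X j by (auto simp: preserves_def)
        have "hd_tree ((tl_tree ^^ (i - k)) (Cell (s'' (tp (d + 2))) (s'' (tp d)))) \<noteq> Atom \<longleftrightarrow>
            eval G Q \<phi> (e(y := i)) S" if "k \<le> i" "i < ?n" for i
        proof (cases "i = k")
          case False
          then have "i - k = Suc (i - Suc k)" "Suc k \<le> i" using that by auto
          then show ?thesis using I that p by (simp add: funpow_Suc_right del: funpow.simps)
        qed (use 2 in auto)
        then show ?case
          by (intro runs_Assign) (use I l p in auto)
      qed simp
    qed (use assms in \<open>auto simp: set_rep_def algebra_simps\<close>)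
  qed (use assms in simp)
qed

lemma computes_Fix:
  assumes "computes G Q (d + 7) \<phi> a" "computes G Q (d + 3) \<psi> b" "2 \<le> d"
  shows "computes G Q d (Fix X y \<phi> \<psi>) (40 + length G * (40 + length G * (a + 20)) + b)"
  unfolding computes_def compile.simps
proof (intro allI impI)
  fix e S s assume s: "state G e S s"
  let ?n = "length G"
  define F where "F = (\<lambda>Z. {i. i < ?n \<and> eval G Q \<phi> (e(y := i)) (S(X := Z))})"
  have F: "(F ^^ k) {} \<subseteq> {..<?n}" for k by (cases k) (auto simp: F_def)
  let ?c = "Seq (comprehension (d + 5) y (compile (d + 7) \<phi>)) (Assign (sv X) (Var (tp (d + 5))))"
  \<comment> \<open>After the rounds for the indices down to \<open>k\<close>, the operator has been
    applied \<open>?n - k\<close> times; the index itself only counts rounds.\<close>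
  let ?I = "\<lambda>k s'. (\<forall>z. z \<noteq> y \<longrightarrow> s' (iv z) = s (iv z)) \<and> (\<forall>Z. Z \<noteq> X \<longrightarrow> s' (sv Z) = s (sv Z)) \<and>
    (\<forall>j < d. s' (tp j) = s (tp j)) \<and> s' (tp (d + 1)) = s (sv X) \<and> s' (tp (d + 2)) = s (iv y) \<and>
    set_rep ?n (s' (sv X)) ((F ^^ (?n - k)) {})"
  let ?s0 = "s(tp (d + 1) := s (sv X), tp (d + 2) := s (iv y), sv X := Atom)"
  have tl_Atom: "(tl_tree ^^ i) Atom = Atom" for i by (induction i) auto
  have loop: "runs (For (tp (d + 3)) (tp (d + 4)) (tp 0) ?c) (4 + ?n * (23 + ?n * (a + 20))) ?s0 (?I 0)"
  proof (rule runs_For[where b = "15 + ?n * (a + 20)" and n = ?n and I = ?I])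
    fix k s'
    assume k: "k < ?n" and I: "?I (Suc k) s'" and l: "s' (tp (d + 3)) = idx_list (Suc k)"
    let ?s = "s'(tp (d + 4) := tree_of_nat k)" and ?Z = "(F ^^ (?n - Suc k)) {}"
    have nk: "?n - k = Suc (?n - Suc k)" using k by simp
    have seven: "d + 7 = d + 5 + 2" by simp
    have comp: "runs (comprehension (d + 5) y (compile (d + 7) \<phi>)) (10 + ?n * (a + 20)) ?s (\<lambda>s'.
        (\<forall>z. z \<noteq> y \<longrightarrow> s' (iv z) = ?s (iv z)) \<and> (\<forall>X. s' (sv X) = ?s (sv X)) \<and>
        (\<forall>j < d + 5. s' (tp j) = ?s (tp j)) \<and>
        set_rep ?n (s' (tp (d + 5))) {i. i < ?n \<and> eval G Q \<phi> (e(y := i)) (S(X := ?Z))})"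
      unfolding seven
    proof (rule runs_comprehension)
      show "computes G Q (d + 5 + 2) \<phi> a" using assms(1) unfolding seven .
      show "?s (tp 0) = idx_list ?n" using s I assms(3) by (auto simp: state_def)
      fix i s''
      assume i: "i < ?n" and s'': "\<And>z. z \<noteq> y \<Longrightarrow> s'' (iv z) = ?s (iv z)" "\<And>X. s'' (sv X) = ?s (sv X)"
        "\<And>j. j < d + 5 \<Longrightarrow> s'' (tp j) = ?s (tp j)" "s'' (iv y) = tree_of_nat i"
      show "state G (e(y := i)) (S(X := ?Z)) s''"
        using i s'' s I assms(3) F[of "?n - Suc k"] by (auto simp: state_def valid_env_def)
    qed (use assms in auto)
    show "runs ?c (15 + ?n * (a + 20)) ?s
      (\<lambda>s''. s'' (tp (d + 3)) = idx_list (Suc k) \<and> ?I k (s''(tp (d + 3) := idx_list k)))"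
    proof (rule runs_Seq[OF comp], goal_cases)
      case (2 s'')
      then have "set_rep ?n (s'' (tp (d + 5))) ((F ^^ (?n - k)) {})"
        by (simp add: nk F_def add.commute)
      then show ?case
        by (intro runs_Assign) (use 2 I l in auto)
    qed simp
  qed (use s assms in \<open>auto simp: state_def set_rep_def tl_Atom\<close>)
  show "runs (Seq (Assign (tp (d + 1)) (Var (sv X))) (Seq (Assign (tp (d + 2)) (Var (iv y)))
     (Seq (Assign (sv X) Nil_expr)
     (Seq (For (tp (d + 3)) (tp (d + 4)) (tp 0) ?c)
     (Seq (Assign (iv y) (Var (tp (d + 2))))
     (Seq (compile (d + 3) \<psi>)
     (Seq (Assign (tp d) (Var (tp (d + 3)))) (Assign (sv X) (Var (tp (d + 1)))))))))))
     (40 + ?n * (40 + ?n * (a + 20)) + b) s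
      (\<lambda>s'. preserves d s s' \<and> (s' (tp d) \<noteq> Atom \<longleftrightarrow> eval G Q (Fix X y \<phi> \<psi>) e S))"
  proof (intro runs_Assign_Seq, goal_cases)
    case 4
    have eq: "s(tp (d + 1) := eval_expr s (Var (sv X)),
        tp (d + 2) := eval_expr (s(tp (d + 1) := eval_expr s (Var (sv X)))) (Var (iv y)),
        sv X := eval_expr (s(tp (d + 1) := eval_expr s (Var (sv X)),
          tp (d + 2) := eval_expr (s(tp (d + 1) := eval_expr s (Var (sv X)))) (Var (iv y)))) Nil_expr) = ?s0"
      by simp
    show ?case
      unfolding eq
    proof (rule runs_Seq[OF loop], goal_cases)
      case (2 s')
      let ?s = "s'(iv y := s (iv y))"
      have eq: "s'(iv y := eval_expr s' (Var (tp (d + 2)))) = ?s" using 2 by simp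
      have st: "state G e (S(X := (F ^^ ?n) {})) ?s"
        using 2 s F[of ?n] assms(3) by (auto simp: state_def valid_env_def)
      show ?case
      proof (rule runs_Assign_Seq, goal_cases)
        case 2
        show ?case
          unfolding eq
        proof (rule runs_Seq[OF computesD[OF assms(2) st]], goal_cases)
          case (2 s'')
          then have "s'' (iv z) = s (iv z)" "Z \<noteq> X \<Longrightarrow> s'' (sv Z) = s (sv Z)"
            "j < d \<Longrightarrow> s'' (tp j) = s (tp j)" "s'' (tp (d + 1)) = s (sv X)" for z Z j
            using \<open>?I 0 s'\<close> by (auto simp: preserves_def)
          then show ?case
            using 2 by (intro runs_Assign_Seq runs_Assign)
              (auto simp: preserves_def F_def algebra_simps)
        qed (simp add: algebra_simps)
      qed (simp add: algebra_simps)
    qed (simp add: algebra_simps)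
  qed simp_all
qed

lemma runs_keep_node:
  assumes s: "state G e S s" and d: "2 \<le> d" and c: "100 + length G * 64 \<le> c"
  shows "runs (keep_node d y X g) c s (preserves (d + 5)
    (s(tp (d + 2) := Cell (tree_of_node
      (Node (node_sym (G ! e y)) (children (G ! e y)) (e y \<in> S X) (e y = e g))) (s (tp (d + 2))))))"
proof -
  let ?n = "length G" and ?v = "G ! e y"
  show ?thesis
    unfolding keep_node_def
  proof (rule runs_Seq[OF runs_node[OF s, of "d + 5", OF _ order_refl]], goal_cases)
    case (3 s1)
    have s1: "state G e S s1" by (rule state_preserves[OF s, of "d + 5"]) (use 3 in auto)
    show ?case
    proof (rule runs_Seq[OF runs_lookup[OF s1, of "d + 6", OF _ order_refl]], goal_cases)
      case (3 s2)
      have b: "s2 (tp (d + 6)) \<noteq> Atom \<longleftrightarrow> e y \<in> S X"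
        using 3 s1 by (auto simp: state_def valid_env_def set_rep_def)
      let ?s3 = "s2(tp (d + 6) := tree_of_bool (e y \<in> S X))"
      have p3: "preserves (d + 6) s1 ?s3" using 3 by simp
      have s3: "state G e S ?s3" by (rule state_preserves[OF s1 p3]) simp
      show ?case
      proof (rule runs_Seq[where a = 10 and P = "\<lambda>s'. s' = ?s3"], goal_cases)
        case 1
        show ?case using b by (intro runs_Cond runs_Assign) (auto simp: tree_of_bool_True)
      next
        case (3 s3')
        then have s3': "s3' = ?s3" .
        let ?r = "?s3(tp (d + 7) := tree_of_nat (e y), tp (d + 8) := tree_of_nat (e g))"
        have r: "?s3(tp (d + 7) := eval_expr ?s3 (Var (iv y)), tp (d + 8) :=
            eval_expr (?s3(tp (d + 7) := eval_expr ?s3 (Var (iv y)))) (Var (iv g))) = ?r"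
          using s3 by (simp add: state_def)
        have cmp: "runs (compare (d + 7)) (20 + 32 * ?n) ?r
            (\<lambda>s'. preserves (d + 7) ?r s' \<and> s' (tp (d + 7)) = tree_of_bool (e y = e g))"
          by (rule runs_compare)
            (use s3 in \<open>auto simp: state_def valid_env_def add.commute intro: less_imp_le\<close>)
        show ?case
          unfolding s3'
        proof (intro runs_Assign_Seq, goal_cases)
          case 3
          show ?case
            unfolding r
          proof (rule runs_Seq[OF cmp], goal_cases)
            case (2 s4)
            have "preserves (d + 7) ?s3 s4" using 2 by (auto simp: preserves_def)
            then have p4: "preserves (d + 6) s1 s4" using preserves_trans[OF p3] by simp
            have t6: "s4 (tp (d + 6)) = tree_of_bool (e y \<in> S X)" using 2 by (auto simp: preserves_def)
            have t5: "s4 (tp (d + 5)) = tree_of_node ?v"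
              using p4 \<open>preserves (d + 5) s s1 \<and> _\<close> by (auto simp: preserves_def)
            have t2: "s4 (tp (d + 2)) = s (tp (d + 2))"
              using p4 \<open>preserves (d + 5) s s1 \<and> _\<close> by (auto simp: preserves_def)
            have p: "preserves (d + 5) s s4"
              by (rule preserves_trans[OF _ p4]) (use \<open>preserves (d + 5) s s1 \<and> _\<close> in auto)
            show ?case
              by (rule runs_Assign)
                (use c 2 t6 t5 t2 p in \<open>auto simp: preserves_def tree_of_node_def\<close>)
          qed (use c in simp)
        qed (use c in simp_all)
      qed (use c in simp)
    qed (use c in simp_all)
  qed (use c in simp_all)
qed

text \<open>The loop over the nodes overwrites \<open>y\<close> while the goal is still read from
  \<open>g\<close>, hence \<open>y \<noteq> g\<close> in \<open>sound_queries\<close>. The single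
  call of \<open>p\<close> contributes the summand \<open>T (length G)\<close>.\<close>

lemma computes_Query:
  assumes k: "computes G Q (d + 4) \<kappa> b" and d: "2 \<le> d" and ok: "queries_ok G Q keep"
    and sq: "sound_queries G Q keep (Query \<kappa> y X g)"
  shows "computes G Q d (Query \<kappa> y X g)
    (40 + 2 * B + T (length G) + length G * (b + 140 + length G * 64))"
  unfolding computes_def compile.simps
proof (intro allI impI)
  fix e S s assume s: "state G e S s"
  let ?n = "length G"
  define K where "K = keep (S X) (e g)"
  define nd where "nd i = (if i \<in> K then Node (node_sym (G ! i)) (children (G ! i)) (i \<in> S X) (i = e g)
    else Node None [] True False)" for i
  have yg: "y \<noteq> g" using sq by simp
  have K: "eval G Q \<kappa> (e(y := i)) S \<longleftrightarrow> i \<in> K" if "i < ?n" for i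
    using sq s that by (simp add: K_def state_def)
  let ?c = "Seq (compile (d + 4) \<kappa>) (Cond (Var (tp (d + 4))) (keep_node d y X g) (drop_node d))"
  let ?I = "\<lambda>k s'. (\<forall>z. z \<noteq> y \<longrightarrow> s' (iv z) = s (iv z)) \<and> (\<forall>X. s' (sv X) = s (sv X)) \<and>
    (\<forall>j < d. s' (tp j) = s (tp j)) \<and> s' (tp (d + 1)) = s (iv y) \<and>
    s' (tp (d + 2)) = tree_of_list (map (tree_of_node \<circ> nd) [k..<?n])"
  let ?s0 = "s(tp (d + 1) := s (iv y), tp (d + 2) := Atom)"
  have loop: "runs (For (tp (d + 3)) (iv y) (tp 0) ?c) (4 + ?n * (b + 128 + ?n * 64)) ?s0 (?I 0)"
  proof (rule runs_For[where b = "b + 120 + ?n * 64" and n = ?n and I = ?I])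
    fix k s'
    assume k: "k < ?n" and I: "?I (Suc k) s'" and l: "s' (tp (d + 3)) = idx_list (Suc k)"
    let ?s = "s'(iv y := tree_of_nat k)"
    have st: "state G (e(y := k)) S ?s"
      by (rule state_upd_iv[OF s k]) (use I d in auto)
    have upt: "[k..<?n] = k # [Suc k..<?n]" using k by (simp add: upt_conv_Cons)
    let ?s' = "?s(tp (d + 2) := Cell (tree_of_node (nd k)) (s' (tp (d + 2))))"
    have fin: "s2 (tp (d + 3)) = idx_list (Suc k) \<and> ?I k (s2(tp (d + 3) := idx_list k))"
      if "preserves (d + 4) ?s' s2" for s2
    proof -
      from that have p: "s2 (iv z) = ?s' (iv z)" "s2 (sv Z) = ?s' (sv Z)"
          "j < d + 4 \<Longrightarrow> s2 (tp j) = ?s' (tp j)" for z Z j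
        by (auto simp: preserves_def)
      show ?thesis using I l p by (simp add: upt)
    qed
    show "runs ?c (b + 120 + ?n * 64) ?s
      (\<lambda>s''. s'' (tp (d + 3)) = idx_list (Suc k) \<and> ?I k (s''(tp (d + 3) := idx_list k)))"
    proof (rule runs_Seq[OF computesD[OF assms(1) st]], goal_cases)
      case (2 s1)
      have p1: "preserves (d + 4) ?s s1" using 2 by simp
      have s1: "state G (e(y := k)) S s1" by (rule state_preserves[OF st p1]) simp
      have t2: "s1 (tp (d + 2)) = s' (tp (d + 2))" using p1 by (auto simp: preserves_def)
      have kK: "s1 (tp (d + 4)) \<noteq> Atom \<longleftrightarrow> k \<in> K" using 2 K[OF k] by simp
      show ?case
      proof (rule runs_Cond, goal_cases)
        case 2
        then have nd: "Node (node_sym (G ! k)) (children (G ! k)) (k \<in> S X) (k = e g) = nd k"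
          using kK by (simp add: nd_def)
        show ?case
        proof (rule runs_mono[OF runs_keep_node[OF s1 d order_refl, of y X g]], goal_cases)
          case (2 s2)
          have "preserves (d + 4) ?s' s2"
            using 2 p1 yg t2 nd by (auto simp: preserves_def)
          then show ?case by (rule fin)
        qed simp
      next
        case 3
        then have nd: "Node None [] True False = nd k" using kK by (simp add: nd_def)
        show ?case
          unfolding drop_node_def
        proof (rule runs_Assign, goal_cases)
          case 2
          show ?case
            by (rule fin) (use p1 t2 in \<open>auto simp: preserves_def nd[symmetric] tree_of_node_def tree_of_bool_True\<close>)
        qed simp
      qed simp
    qed simp
  qed (use s d in \<open>auto simp: state_def\<close>)
  have X: "S X \<subseteq> {..<?n}" and g: "e g < ?n" using s by (auto simp: state_def valid_env_def)
  obtain t where t: "t \<le> T ?n" "answers p (tree_of_dag (query_dag G K (S X) (e g))) t (Q (S X) (e g))"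
    using ok X g unfolding queries_ok_def K_def by blast
  have dag: "tree_of_dag (query_dag G K (S X) (e g)) = tree_of_list (map (tree_of_node \<circ> nd) [0..<?n])"
    by (simp add: tree_of_dag_def query_dag_def nd_def comp_def)
  show "runs (Seq (Assign (tp (d + 1)) (Var (iv y))) (Seq (Assign (tp (d + 2)) Nil_expr)
     (Seq (For (tp (d + 3)) (iv y) (tp 0) ?c)
     (Seq (Assign (iv y) (Var (tp (d + 1))))
     (Seq (run_query (d + 2)) (Assign (tp d) (Var 1)))))))
     (40 + 2 * B + T ?n + ?n * (b + 140 + ?n * 64)) s
      (\<lambda>s'. preserves d s s' \<and> (s' (tp d) \<noteq> Atom \<longleftrightarrow> eval G Q (Query \<kappa> y X g) e S))"
  proof (intro runs_Assign_Seq, goal_cases)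
    case 3
    have eq: "s(tp (d + 1) := eval_expr s (Var (iv y)),
        tp (d + 2) := eval_expr (s(tp (d + 1) := eval_expr s (Var (iv y)))) Nil_expr) = ?s0" by simp
    show ?case
      unfolding eq
    proof (rule runs_Seq[OF loop], goal_cases)
      case (2 s')
      let ?s = "s'(iv y := s (iv y))"
      have eq: "s'(iv y := eval_expr s' (Var (tp (d + 1)))) = ?s" using 2 by simp
      have "answers p (?s (tp (d + 2))) t (Q (S X) (e g))" using t(2) 2 dag by simp
      note orc = runs_query[of ?s "d + 2", OF this t(1) order_refl]
      show ?case
      proof (rule runs_Assign_Seq, goal_cases)
        case 2
        show ?case
          unfolding eq
        proof (rule runs_Seq[OF orc], goal_cases)
          case (2 s'')
          then show ?case
            using \<open>?I 0 s'\<close> by (intro runs_Assign) (auto simp: preserves_def algebra_simps)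
        qed (simp add: algebra_simps)
      qed (simp add: algebra_simps)
    qed (simp add: algebra_simps)
  qed simp_all
qed

text \<open>The bound is chosen before the level, the DAG and the oracle; this uniformity makes the
  cost of one fixed formula polynomial in the size of the DAG, up to the factor from
  \<open>T\<close>.\<close>

theorem compile_correct:
  "\<exists>b. poly_bound T b \<and> (\<forall>d G Q keep. 2 \<le> d \<longrightarrow> queries_ok G Q keep \<longrightarrow> sound_queries G Q keep \<phi> \<longrightarrow>
     computes G Q d \<phi> (b (length G)))"
proof (induction \<phi>)
  case (In_left x)
  show ?case
    by (rule exI[of _ "\<lambda>n. 20 + n * 16"], intro conjI poly_bound_intros) (auto intro: computes_In_left)
next
  case (Is_goal x)
  show ?case
    by (rule exI[of _ "\<lambda>n. 21 + n * 16"], intro conjI poly_bound_intros) (auto intro: computes_Is_goal)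
next
  case (Sym_gt c x)
  show ?case
    by (rule exI[of _ "\<lambda>n. 18 + c + n * 16"], intro conjI poly_bound_intros)
      (auto intro: computes_Sym_gt)
next
  case (Child k x y)
  show ?case
    by (rule exI[of _ "\<lambda>n. 60 + k + n * 48"], intro conjI poly_bound_intros)
      (auto intro!: computes_Child simp: queries_ok_def)
next
  case (Equal x y)
  show ?case
    by (rule exI[of _ "\<lambda>n. 30 + n * 32"], intro conjI poly_bound_intros) (auto intro: computes_Equal)
next
  case (Mem X x)
  show ?case
    by (rule exI[of _ "\<lambda>n. 15 + n * 16"], intro conjI poly_bound_intros) (auto intro: computes_Mem)
next
  case (Neg \<phi>)
  then obtain b where "poly_bound T b" "\<And>d G Q keep. 2 \<le> d \<Longrightarrow> queries_ok G Q keep \<Longrightarrow>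
      sound_queries G Q keep \<phi> \<Longrightarrow> computes G Q d \<phi> (b (length G))" by blast
  then show ?case
    by (intro exI[of _ "\<lambda>n. b n + 10"] conjI poly_bound_intros) (auto intro: computes_Neg)
next
  case (And \<phi> \<psi>)
  then obtain a b where "poly_bound T a" "poly_bound T b"
    "\<And>d G Q keep. 2 \<le> d \<Longrightarrow> queries_ok G Q keep \<Longrightarrow>
      sound_queries G Q keep \<phi> \<Longrightarrow> computes G Q d \<phi> (a (length G))"
    "\<And>d G Q keep. 2 \<le> d \<Longrightarrow> queries_ok G Q keep \<Longrightarrow>
      sound_queries G Q keep \<psi> \<Longrightarrow> computes G Q d \<psi> (b (length G))" by blast
  then show ?case
    by (intro exI[of _ "\<lambda>n. a n + b n + 10"] conjI poly_bound_intros) (auto intro: computes_And)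
next
  case (Ex x \<phi>)
  then obtain b where "poly_bound T b" "\<And>d G Q keep. 2 \<le> d \<Longrightarrow> queries_ok G Q keep \<Longrightarrow>
      sound_queries G Q keep \<phi> \<Longrightarrow> computes G Q d \<phi> (b (length G))" by blast
  then show ?case
    by (intro exI[of _ "\<lambda>n. 20 + n * (b n + 20)"] conjI poly_bound_intros)
      (auto intro!: computes_Ex)
next
  case (Fix X y \<phi> \<psi>)
  then obtain a b where "poly_bound T a" "poly_bound T b"
    "\<And>d G Q keep. 2 \<le> d \<Longrightarrow> queries_ok G Q keep \<Longrightarrow>
      sound_queries G Q keep \<phi> \<Longrightarrow> computes G Q d \<phi> (a (length G))"
    "\<And>d G Q keep. 2 \<le> d \<Longrightarrow> queries_ok G Q keep \<Longrightarrow>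
      sound_queries G Q keep \<psi> \<Longrightarrow> computes G Q d \<psi> (b (length G))" by blast
  then show ?case
    by (intro exI[of _ "\<lambda>n. 40 + n * (40 + n * (a n + 20)) + b n"] conjI poly_bound_intros)
      (auto intro!: computes_Fix)
next
  case (Query \<kappa> y X g)
  then obtain b where b: "poly_bound T b" "\<And>d G Q keep. 2 \<le> d \<Longrightarrow> queries_ok G Q keep \<Longrightarrow>
      sound_queries G Q keep \<kappa> \<Longrightarrow> computes G Q d \<kappa> (b (length G))" by blast
  show ?case
  proof (intro exI[of _ "\<lambda>n. 40 + 2 * B + T n + n * (b n + 140 + n * 64)"] conjI poly_bound_intros b(1)
      allI impI)
    fix d :: nat and G Q keep
    assume *: "2 \<le> d" "queries_ok G Q keep" "sound_queries G Q keep (Query \<kappa> y X g)"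
    have "computes G Q (d + 4) \<kappa> (b (length G))" using * by (intro b(2)) auto
    then show "computes G Q d (Query \<kappa> y X g)
        (40 + 2 * B + T (length G) + length G * (b (length G) + 140 + length G * 64))"
      using * by (intro computes_Query)
  qed
qed

end

section \<open>The saturated set\<close>

lemma size_arguments: "B \<in> set (arguments N) \<Longrightarrow> size B < size N"
  by (cases N) (auto simp: less_Suc_eq_le intro: size_list_estimation')

lemma size_subterms: "A \<in> subterms M \<Longrightarrow> size A \<le> size M"
proof (induction M)
  case (App g Ms)
  then show ?case
  proof (cases "A = App g Ms")
    case False
    then obtain N where "N \<in> set Ms" "size A \<le> size N" using App by auto
    then show ?thesis using size_arguments[of N "App g Ms"] by simp
  qed simp
qed simp

text \<open>By size, a message is no subterm of its own arguments; so removing it from its subterms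
  leaves exactly those of its arguments.\<close>

lemma pst_iff: "A \<in> pst \<Gamma> \<longleftrightarrow> (\<exists>N \<in> \<Gamma>. \<exists>B \<in> set (arguments N). A \<in> subterms B)"
proof -
  have "A \<in> subterms N \<and> A \<noteq> N \<longleftrightarrow> (\<exists>B \<in> set (arguments N). A \<in> subterms B)" for N
  proof (cases N)
    case (App g Ms)
    have "App g Ms \<notin> subterms B" if "B \<in> set Ms" for B
      using size_subterms[of "App g Ms" B] size_arguments[of B "App g Ms"] that by auto
    then show ?thesis using App by auto
  qed simp
  then show ?thesis unfolding pst_def by auto
qed

lemma arguments_pst: "A \<in> \<Gamma> \<Longrightarrow> B \<in> set (arguments A) \<Longrightarrow> B \<in> pst \<Gamma>"
  unfolding pst_iff by force

lemma arguments_subterms: "B \<in> set (arguments A) \<Longrightarrow> B \<in> subterms A"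
  by (cases A) force+

lemma pst_subterms: "A \<in> pst \<Gamma> \<Longrightarrow> B \<in> subterms A \<Longrightarrow> B \<in> pst \<Gamma>"
  unfolding pst_iff by (meson subterms_trans)

text \<open>Even the added signatures have proper subterms as arguments, so saturation creates no
  new proper subterm.\<close>

lemma St_arguments: "A \<in> St \<Gamma> \<Longrightarrow> B \<in> set (arguments A) \<Longrightarrow> B \<in> pst \<Gamma>"
  unfolding St_def by (auto intro: arguments_pst pst_subterms arguments_subterms)

lemma pst_St: "\<Delta> \<subseteq> St \<Gamma> \<Longrightarrow> pst \<Delta> \<subseteq> pst \<Gamma>"
proof
  fix A assume \<Delta>: "\<Delta> \<subseteq> St \<Gamma>" and "A \<in> pst \<Delta>"
  then obtain N B where "N \<in> St \<Gamma>" "B \<in> set (arguments N)" "A \<in> subterms B"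
    by (auto simp: pst_iff[of A \<Delta>])
  then show "A \<in> pst \<Gamma>" using St_arguments pst_subterms by blast
qed

text \<open>Consequently a query about members of the saturated set fits into the input DAG.\<close>

lemma St_least: "\<Delta> \<subseteq> St \<Gamma> \<Longrightarrow> St \<Delta> \<subseteq> St \<Gamma>"
  using pst_St[of \<Delta> \<Gamma>] unfolding St_def by auto

lemma subterms_St: "A \<in> St \<Gamma> \<Longrightarrow> B \<in> subterms A \<Longrightarrow> B = A \<or> B \<in> pst \<Gamma>"
  using pst_St[of "{A}" \<Gamma>] by (auto simp: pst_def)

lemma St_pst: "A \<in> pst \<Gamma> \<Longrightarrow> A \<in> St \<Gamma>"
  and St_base: "A \<in> \<Gamma> \<Longrightarrow> A \<in> St \<Gamma>"
  and St_sign: "A \<in> pst \<Gamma> \<Longrightarrow> B \<in> pst \<Gamma> \<Longrightarrow> sign A B \<in> St \<Gamma>"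
  unfolding St_def by auto

section \<open>Formulas for derivability\<close>

text \<open>Monotonicity is replaced by counting: after \<open>k\<close> rounds the chain has either
  stopped or collected at least \<open>k\<close> elements, and with \<open>n\<close> elements it has
  exhausted the range.\<close>

lemma inflationary_fixpoint:
  assumes "\<And>Z. Z \<subseteq> {..<n} \<Longrightarrow> Z \<subseteq> F Z \<and> F Z \<subseteq> {..<n :: nat}"
  shows "F ((F ^^ n) {}) = (F ^^ n) {}"
proof -
  have sub: "(F ^^ k) {} \<subseteq> {..<n}" for k by (induction k) (use assms in auto)
  have "F ((F ^^ k) {}) = (F ^^ k) {} \<or> k \<le> card ((F ^^ k) {})" for k
  proof (induction k)
    case (Suc k)
    show ?case
    proof (cases "F ((F ^^ k) {}) = (F ^^ k) {}")
      case False
      then have "(F ^^ k) {} \<subset> (F ^^ Suc k) {}" using assms[OF sub[of k]] by auto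
      moreover have "finite ((F ^^ Suc k) {})" using sub[of "Suc k"] finite_subset by blast
      ultimately have "card ((F ^^ k) {}) < card ((F ^^ Suc k) {})" by (rule psubset_card_mono[rotated])
      then show ?thesis using Suc False by simp
    qed simp
  qed simp
  from this[of n] show ?thesis
  proof
    assume "n \<le> card ((F ^^ n) {})"
    then have "(F ^^ n) {} = {..<n}" using sub[of n] by (intro card_subset_eq) (auto intro: antisym dest: card_mono[rotated])
    then show ?thesis using assms[of "{..<n}"] by auto
  qed
qed

definition Or :: "fm \<Rightarrow> fm \<Rightarrow> fm" where "Or \<phi> \<psi> = Neg (And (Neg \<phi>) (Neg \<psi>))"

text \<open>The disjunct \<open>Mem X y\<close> makes the operator inflationary, so the iteration
  reaches a fixpoint for every \<open>\<phi>\<close>.\<close>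

definition Lfix :: "nat \<Rightarrow> nat \<Rightarrow> fm \<Rightarrow> fm \<Rightarrow> fm" where
  "Lfix X y \<phi> \<psi> = Fix X y (Or (Mem X y) \<phi>) \<psi>"

text \<open>Only thresholds can be tested, so a code is enclosed between two of them. For
  \<open>c = 0\<close> truncated subtraction makes the formula false, whence \<open>0 < c\<close> in
  \<open>eval_Sym\<close>.\<close>

definition Sym :: "nat \<Rightarrow> nat \<Rightarrow> fm" where "Sym c x = And (Sym_gt (c - 1) x) (Neg (Sym_gt c x))"

definition Unary :: "sym \<Rightarrow> nat \<Rightarrow> nat \<Rightarrow> fm" where
  "Unary g x a = And (Sym (sym_code g) x) (Child 0 x a)"

definition Binary :: "sym \<Rightarrow> nat \<Rightarrow> nat \<Rightarrow> nat \<Rightarrow> fm" where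
  "Binary g x a b = And (Sym (sym_code g) x) (And (Child 0 x a) (Child 1 x b))"

text \<open>Arities are bounded by a constant of the theory, so being some argument is a finite
  disjunction, starting from the false formula \<open>Neg (Equal x x)\<close>.\<close>

primrec Argument :: "nat \<Rightarrow> nat \<Rightarrow> nat \<Rightarrow> fm" where
  "Argument 0 x a = Neg (Equal x x)"
| "Argument (Suc k) x a = Or (Child k x a) (Argument k x a)"

lemma eval_Or [simp]: "eval G Q (Or \<phi> \<psi>) e S \<longleftrightarrow> eval G Q \<phi> e S \<or> eval G Q \<psi> e S"
  by (simp add: Or_def)

lemma eval_Sym: "0 < c \<Longrightarrow> eval G Q (Sym c x) e S \<longleftrightarrow> node_code (G ! e x) = c"
  by (auto simp: Sym_def)

lemma eval_Argument: "eval G Q (Argument K x a) e S \<longleftrightarrow>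
    (\<exists>k < K. k < length (children (G ! e x)) \<and> children (G ! e x) ! k = e a)"
  by (induction K) (auto simp: less_Suc_eq)

lemma sound_queries_derived [simp]:
  "sound_queries G Q keep (Or \<phi> \<psi>) \<longleftrightarrow> sound_queries G Q keep \<phi> \<and> sound_queries G Q keep \<psi>"
  "sound_queries G Q keep (Lfix X y \<phi> \<psi>) \<longleftrightarrow> sound_queries G Q keep \<phi> \<and> sound_queries G Q keep \<psi>"
  "sound_queries G Q keep (Sym c x)"
  "sound_queries G Q keep (Unary g x a)"
  "sound_queries G Q keep (Binary g x a b)"
  "sound_queries G Q keep (Argument K x a)"
  by (simp_all add: Or_def Lfix_def Sym_def Unary_def Binary_def) (induction K; simp add: Or_def)

lemma valid_env_upd [simp]:
  "valid_env G e S \<Longrightarrow> i < length G \<Longrightarrow> valid_env G (e(x := i)) S"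
  "valid_env G e S \<Longrightarrow> Z \<subseteq> {..<length G} \<Longrightarrow> valid_env G e (S(X := Z))"
  by (auto simp: valid_env_def)

lemma valid_env_less [simp]: "valid_env G e S \<Longrightarrow> e x < length G"
  by (simp add: valid_env_def)

text \<open>Completeness proofs use that \<open>Z\<close> is closed under \<open>\<phi>\<close>;
  soundness proofs use that a property of the empty set that survives each round holds of
  \<open>Z\<close>.\<close>

lemma Lfix_cases:
  obtains Z where "Z \<subseteq> {..<length G}"
    "eval G Q (Lfix X y \<phi> \<psi>) e S \<longleftrightarrow> eval G Q \<psi> e (S(X := Z))"
    "\<And>i. i < length G \<Longrightarrow> eval G Q \<phi> (e(y := i)) (S(X := Z)) \<Longrightarrow> i \<in> Z"
    "\<And>P. P {} \<Longrightarrow> (\<And>Y. Y \<subseteq> {..<length G} \<Longrightarrow> P Y \<Longrightarrow>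
        P (Y \<union> {i. i < length G \<and> eval G Q \<phi> (e(y := i)) (S(X := Y))})) \<Longrightarrow> P Z"
proof -
  define F where "F Y = {i. i < length G \<and> (i \<in> Y \<or> eval G Q \<phi> (e(y := i)) (S(X := Y)))}" for Y
  let ?Z = "(F ^^ length G) {}"
  have sub: "(F ^^ k) {} \<subseteq> {..<length G}" for k by (cases k) (auto simp: F_def)
  have F: "F Y = Y \<union> {i. i < length G \<and> eval G Q \<phi> (e(y := i)) (S(X := Y))}"
    if "Y \<subseteq> {..<length G}" for Y
    using that by (auto simp: F_def)
  have fp: "F ?Z = ?Z" by (rule inflationary_fixpoint) (auto simp: F)
  show thesis
  proof (rule that[of ?Z])
    show "eval G Q (Lfix X y \<phi> \<psi>) e S \<longleftrightarrow> eval G Q \<psi> e (S(X := ?Z))"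
      by (simp add: Lfix_def F_def[abs_def])
    show "i \<in> ?Z" if "i < length G" "eval G Q \<phi> (e(y := i)) (S(X := ?Z))" for i
    proof -
      have "i \<in> F ?Z" using that by (simp add: F_def)
      then show ?thesis by (simp only: fp)
    qed
    show "P ?Z" if "P {}" "\<And>Y. Y \<subseteq> {..<length G} \<Longrightarrow> P Y \<Longrightarrow>
        P (Y \<union> {i. i < length G \<and> eval G Q \<phi> (e(y := i)) (S(X := Y))})" for P
    proof -
      have "P ((F ^^ k) {})" for k
        by (induction k) (use that sub in \<open>auto simp: F\<close>)
      then show ?thesis .
    qed
  qed (rule sub)
qed

text \<open>Each of the following formulas binds node and set variables from a range of its own, so that
  nesting them captures nothing. The parameter \<open>K\<close> bounds the arities of all symbols.\<close>

definition Keep :: "nat \<Rightarrow> nat \<Rightarrow> nat \<Rightarrow> nat \<Rightarrow> fm" where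
  "Keep K X g y = Lfix 2 21
     (Ex 22 (And (Argument K 22 21) (Or (Mem X 22) (Or (Equal 22 g) (Mem 2 22)))))
     (Or (Mem X y) (Or (Equal y g) (Or (Mem 2 y)
       (Ex 23 (Ex 24 (And (Binary Sign y 23 24) (And (Mem 2 23) (Mem 2 24))))))))"

definition Elem :: "nat \<Rightarrow> nat \<Rightarrow> nat \<Rightarrow> fm" where
  "Elem K X g = Query (Keep K X g 20) 20 X g"

definition Right :: "nat \<Rightarrow> nat \<Rightarrow> nat \<Rightarrow> fm" where
  "Right K X x = Lfix 1 10 (Or (Elem K X 10) (Ex 11 (Ex 12 (And
     (Or (Binary Tup 10 11 12) (Or (Binary Enc 10 11 12) (Or (Binary Sign 10 11 12) (Binary Blind 10 11 12))))
     (And (Mem 1 11) (Mem 1 12)))))) (Mem 1 x)"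

text \<open>Iterating a constant operator is a way to bind the set variable 3 to the singleton of
  node 30. The nodes 30 and 31 exist whenever \<open>k\<close> and \<open>l\<close> denote proper
  subterms of the sequent.\<close>

definition Ac_eq :: "nat \<Rightarrow> nat \<Rightarrow> nat \<Rightarrow> fm" where
  "Ac_eq K k l = Ex 30 (Ex 31 (And (Binary Sign 30 k k) (And (Binary Sign 31 k l)
     (Fix 3 32 (Equal 32 30) (Elem K 3 31)))))"

text \<open>\<open>In_left\<close> starts the closure from the empty set; the other disjuncts are
  the left rules in their order. In the last one, codes above 5 belong to function symbols, and a
  factor is recognised by one edge from an \<open>E\<close>-headed node.\<close>

definition Step :: "nat \<Rightarrow> fm" where
  "Step K = Or (In_left 1) (Or
     (Ex 2 (Ex 3 (And (Mem 0 2) (Or (Binary Tup 2 1 3) (Binary Tup 2 3 1))))) (Or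
     (Ex 2 (Ex 3 (Ex 4 (And (Mem 0 2) (And (Binary Enc 2 3 4) (And (Right K 0 4)
       (Or (Equal 1 3) (Equal 1 4)))))))) (Or
     (Ex 2 (Ex 3 (Ex 4 (Ex 5 (And (Mem 0 2) (And (Binary Sign 2 1 3) (And (Mem 0 4)
       (And (Unary Pub 4 5) (Ac_eq K 3 5))))))))) (Or
     (Ex 2 (Ex 3 (Ex 4 (And (Mem 0 2) (And (Binary Blind 2 3 4) (And (Right K 0 4)
       (Or (Equal 1 3) (Equal 1 4)))))))) (Or
     (Ex 2 (Ex 3 (Ex 4 (Ex 5 (Ex 6 (And (Mem 0 2) (And (Binary Sign 2 3 4) (And (Binary Blind 3 5 6)
       (And (Right K 0 6) (Or (Equal 1 6) (Binary Sign 1 5 4)))))))))))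
     (And (Neg (Sym_gt 5 1)) (And (Right K 0 1) (Ex 2 (And (Sym_gt 5 2) (Argument K 2 1))))))))))"

definition Derivable :: "nat \<Rightarrow> fm" where
  "Derivable K = Ex 7 (And (Is_goal 7) (Lfix 0 1 (Step K) (Right K 0 7)))"

section \<open>Formulas read on the represented messages\<close>

locale sequent_dag = convergent +
  fixes \<Gamma> :: "msg set" and M :: msg and G :: dag and tm :: "nat \<Rightarrow> msg" and K :: nat
  assumes normal_sequent: "normal_sequent E \<Gamma> M"
    and bij: "bij_betw tm {..<length G} (St (\<Gamma> \<union> {M}))"
    and node: "\<And>i. i < length G \<Longrightarrow>
      root_sym (tm i) = node_sym (G ! i) \<and>
      set (children (G ! i)) \<subseteq> {..<length G} \<and>
      arguments (tm i) = map tm (children (G ! i)) \<and>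
      (in_left (G ! i) \<longleftrightarrow> tm i \<in> \<Gamma>) \<and>
      (is_goal (G ! i) \<longleftrightarrow> tm i = M)"
    and K: "2 \<le> K" "\<And>f. f \<in> sig E \<Longrightarrow> arity E f \<le> K"
begin

abbreviation "n \<equiv> length G"

definition "elem X g = elementary E (tm ` X) (tm g)"
definition "keep X g = {i. i < n \<and> tm i \<in> St (tm ` X \<union> {tm g})}"

lemma tm_St: "i < n \<Longrightarrow> tm i \<in> St (\<Gamma> \<union> {M})"
  using bij by (auto simp: bij_betw_def)

lemma St_tm: "A \<in> St (\<Gamma> \<union> {M}) \<Longrightarrow> \<exists>i < n. tm i = A"
  using bij unfolding bij_betw_def by (metis imageE lessThan_iff)

lemma tm_inj: "i < n \<Longrightarrow> j < n \<Longrightarrow> tm i = tm j \<longleftrightarrow> i = j"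
  using bij by (auto simp: bij_betw_def inj_on_def)

lemma wf_normal_St: "A \<in> St (\<Gamma> \<union> {M}) \<Longrightarrow> wf_msg E A \<and> normal E A"
proof -
  have base: "wf_msg E A \<and> normal E A" if "A \<in> \<Gamma> \<union> {M}" for A
    using normal_sequent that by (auto simp: normal_sequent_def)
  have pst: "wf_msg E A \<and> normal E A" if "A \<in> pst (\<Gamma> \<union> {M})" for A
    using that base by (auto simp: pst_def intro: wf_msg_subterm normal_subterm)
  show "A \<in> St (\<Gamma> \<union> {M}) \<Longrightarrow> wf_msg E A \<and> normal E A"
    unfolding St_def using base pst by (auto intro!: normal_sign)
qed

lemma tm_wf: "i < n \<Longrightarrow> wf_msg E (tm i)" and tm_normal: "i < n \<Longrightarrow> normal E (tm i)"
  using wf_normal_St tm_St by auto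

lemma tm_arguments: "i < n \<Longrightarrow> B \<in> set (arguments (tm i)) \<Longrightarrow> \<exists>j < n. tm j = B"
  using node by fastforce

lemma node_code_tm:
  "i < n \<Longrightarrow> node_code (G ! i) = (case root_sym (tm i) of None \<Rightarrow> 0 | Some g \<Rightarrow> sym_code g)"
  using node by (simp add: node_code_def)

lemma sym_code_inj: "sym_code g = sym_code h \<longleftrightarrow> g = h"
  by (cases g; cases h) auto

lemma sym_code_pos: "0 < sym_code g"
  by (cases g) auto

lemma root_sym_App: "root_sym A = Some g \<longleftrightarrow> A = App g (arguments A)"
  by (cases A) auto

text \<open>The formula inspects two positions only; that there are no further children follows from
  well-formedness, and the identity of nodes from maximal sharing.\<close>

lemma eval_Binary:
  assumes "valid_env G e S" "sym_arity E g = 2"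
  shows "eval G Q (Binary g x a b) e S \<longleftrightarrow> tm (e x) = App g [tm (e a), tm (e b)]"
proof -
  let ?ch = "children (G ! e x)"
  have x: "e x < n" "e a < n" "e b < n" using assms by auto
  have args: "arguments (tm (e x)) = map tm ?ch" "set ?ch \<subseteq> {..<n}" using node x by auto
  have code: "node_code (G ! e x) = sym_code g \<longleftrightarrow> root_sym (tm (e x)) = Some g"
    using node_code_tm[OF x(1)] sym_code_pos[of g] by (auto split: option.splits simp: sym_code_inj)
  show ?thesis
  proof
    assume "eval G Q (Binary g x a b) e S"
    then have r: "root_sym (tm (e x)) = Some g" and c: "?ch ! 0 = e a" "?ch ! 1 = e b"
      by (auto simp: Binary_def eval_Sym sym_code_pos code)
    have app: "tm (e x) = App g (map tm ?ch)" using r args by (simp add: root_sym_App)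
    then have "length ?ch = 2" using tm_wf[OF x(1)] assms(2) by simp
    then obtain u v where "?ch = [u, v]" by (auto simp: numeral_2_eq_2 length_Suc_conv)
    then show "tm (e x) = App g [tm (e a), tm (e b)]" using app c by simp
  next
    assume *: "tm (e x) = App g [tm (e a), tm (e b)]"
    then have "map tm ?ch = [tm (e a), tm (e b)]" using args by simp
    then obtain u v where "?ch = [u, v]" "tm u = tm (e a)" "tm v = tm (e b)" by auto
    moreover from this have "u = e a" "v = e b" using args(2) x tm_inj by auto
    ultimately show "eval G Q (Binary g x a b) e S"
      using code * by (simp add: Binary_def eval_Sym sym_code_pos)
  qed
qed

lemma eval_Unary:
  assumes "valid_env G e S" "sym_arity E g = 1"
  shows "eval G Q (Unary g x a) e S \<longleftrightarrow> tm (e x) = App g [tm (e a)]"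
proof -
  let ?ch = "children (G ! e x)"
  have x: "e x < n" "e a < n" using assms by auto
  have args: "arguments (tm (e x)) = map tm ?ch" "set ?ch \<subseteq> {..<n}" using node x by auto
  have code: "node_code (G ! e x) = sym_code g \<longleftrightarrow> root_sym (tm (e x)) = Some g"
    using node_code_tm[OF x(1)] sym_code_pos[of g] by (auto split: option.splits simp: sym_code_inj)
  show ?thesis
  proof
    assume "eval G Q (Unary g x a) e S"
    then have r: "root_sym (tm (e x)) = Some g" and c: "?ch ! 0 = e a"
      by (auto simp: Unary_def eval_Sym sym_code_pos code)
    have app: "tm (e x) = App g (map tm ?ch)" using r args by (simp add: root_sym_App)
    then have "length ?ch = 1" using tm_wf[OF x(1)] assms(2) by simp
    then obtain u where "?ch = [u]" by (auto simp: length_Suc_conv)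
    then show "tm (e x) = App g [tm (e a)]" using app c by simp
  next
    assume *: "tm (e x) = App g [tm (e a)]"
    then have "map tm ?ch = [tm (e a)]" using args by simp
    then obtain u where "?ch = [u]" "tm u = tm (e a)" by auto
    moreover from this have "u = e a" using args(2) x tm_inj by auto
    ultimately show "eval G Q (Unary g x a) e S"
      using code * by (simp add: Unary_def eval_Sym sym_code_pos)
  qed
qed

lemma arity_le_K: "wf_msg E A \<Longrightarrow> length (arguments A) \<le> K"
proof (cases A)
  case (App g Ms)
  assume "wf_msg E A"
  then show ?thesis using App K by (cases g) auto
qed simp

lemma eval_Argument_tm:
  assumes "valid_env G e S"
  shows "eval G Q (Argument K x a) e S \<longleftrightarrow> tm (e a) \<in> set (arguments (tm (e x)))"
proof -
  let ?ch = "children (G ! e x)"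
  have x: "e x < n" "e a < n" using assms by auto
  have args: "arguments (tm (e x)) = map tm ?ch" "set ?ch \<subseteq> {..<n}" using node x by auto
  have "length ?ch \<le> K" using arity_le_K[OF tm_wf[OF x(1)]] args by simp
  then have "eval G Q (Argument K x a) e S \<longleftrightarrow> e a \<in> set ?ch"
    unfolding eval_Argument in_set_conv_nth by (meson less_le_trans)
  also have "\<dots> \<longleftrightarrow> tm (e a) \<in> set (arguments (tm (e x)))"
    using args x tm_inj by (auto simp: image_iff)
  finally show ?thesis .
qed

lemma eval_E_headed:
  assumes "valid_env G e S"
  shows "eval G Q (Sym_gt 5 x) e S \<longleftrightarrow> E_headed E (tm (e x))"
proof -
  have x: "e x < n" using assms by auto
  have "5 < sym_code g \<longleftrightarrow> (\<exists>f. g = Fn f)" for g by (cases g) auto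
  moreover have "f \<in> sig E" if "root_sym (tm (e x)) = Some (Fn f)" for f
    using tm_wf[OF x] that by (cases "tm (e x)") auto
  ultimately show ?thesis
    using node_code_tm[OF x] by (auto simp: E_headed_root_sym split: option.splits)
qed

lemma eval_In_left: "valid_env G e S \<Longrightarrow> eval G Q (In_left x) e S \<longleftrightarrow> tm (e x) \<in> \<Gamma>"
  and eval_Is_goal: "valid_env G e S \<Longrightarrow> eval G Q (Is_goal x) e S \<longleftrightarrow> tm (e x) = M"
  using node by auto

lemma image_tm_St: "X \<subseteq> {..<n} \<Longrightarrow> g < n \<Longrightarrow> tm ` X \<union> {tm g} \<subseteq> St (\<Gamma> \<union> {M})"
  using tm_St by auto

lemma pst_image_tm: "X \<subseteq> {..<n} \<Longrightarrow> g < n \<Longrightarrow> pst (tm ` X \<union> {tm g}) \<subseteq> pst (\<Gamma> \<union> {M})"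
  by (rule pst_St[OF image_tm_St])

lemma pst_tm: "A \<in> pst (\<Gamma> \<union> {M}) \<Longrightarrow> \<exists>i < n. tm i = A"
  by (rule St_tm[OF St_pst])

lemma tm_arg_pst: "i < n \<Longrightarrow> A \<in> set (arguments (tm i)) \<Longrightarrow> A \<in> pst (\<Gamma> \<union> {M})"
  by (rule St_arguments[OF tm_St])

lemma tm_binary:
  assumes "i < n" "tm i = App h [A, B]"
  obtains a b where "a < n" "tm a = A" "b < n" "tm b = B"
  using tm_arguments[OF assms(1), of A] tm_arguments[OF assms(1), of B] assms(2) by auto

lemma tm_unary:
  assumes "i < n" "tm i = App h [A]"
  obtains a where "a < n" "tm a = A"
  using tm_arguments[OF assms(1), of A] assms(2) by auto

text \<open>Set 2 becomes the set of proper subterms of the query, collected downwards from its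
  messages; the disjuncts then follow the three parts of \<open>St\<close>. The inequalities between
  variables exclude capture.\<close>

lemma eval_Keep:
  assumes v: "valid_env G e S" and names: "X \<noteq> 2" "g \<notin> {20, 21, 22, 23, 24}" "y \<notin> {21, 22, 23, 24}"
  shows "eval G Q (Keep K X g y) e S \<longleftrightarrow> e y \<in> keep (S X) (e g)"
proof -
  let ?\<Delta> = "tm ` S X \<union> {tm (e g)}"
  let ?\<phi> = "Ex 22 (And (Argument K 22 21) (Or (Mem X 22) (Or (Equal 22 g) (Mem 2 22))))"
  have X: "S X \<subseteq> {..<n}" and g: "e g < n" and y: "e y < n" using v by (auto simp: valid_env_def)
  have step: "eval G Q ?\<phi> (e(21 := i)) (S(2 := Z)) \<longleftrightarrow>
      (\<exists>j < n. tm i \<in> set (arguments (tm j)) \<and> (j \<in> S X \<or> j = e g \<or> j \<in> Z))"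
    if "i < n" "Z \<subseteq> {..<n}" for i Z
  proof -
    have "valid_env G (e(21 := i, 22 := j)) (S(2 := Z))" if "j < n" for j
      using v that \<open>i < n\<close> \<open>Z \<subseteq> _\<close> by simp
    then show ?thesis using names by (auto simp: eval_Argument_tm cong: conj_cong)
  qed
  obtain Z where Z: "Z \<subseteq> {..<n}"
    "eval G Q (Keep K X g y) e S \<longleftrightarrow> eval G Q (Or (Mem X y) (Or (Equal y g) (Or (Mem 2 y)
       (Ex 23 (Ex 24 (And (Binary Sign y 23 24) (And (Mem 2 23) (Mem 2 24)))))))) e (S(2 := Z))"
    "\<And>i. i < n \<Longrightarrow> eval G Q ?\<phi> (e(21 := i)) (S(2 := Z)) \<Longrightarrow> i \<in> Z"
    "\<And>P. P {} \<Longrightarrow> (\<And>Y. Y \<subseteq> {..<n} \<Longrightarrow> P Y \<Longrightarrow>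
        P (Y \<union> {i. i < n \<and> eval G Q ?\<phi> (e(21 := i)) (S(2 := Y))})) \<Longrightarrow> P Z"
    unfolding Keep_def by (rule Lfix_cases) blast
  have sound: "\<forall>i \<in> Z. tm i \<in> pst ?\<Delta>"
  proof (rule Z(4))
    fix Y assume Y: "Y \<subseteq> {..<n}" "\<forall>i \<in> Y. tm i \<in> pst ?\<Delta>"
    show "\<forall>i \<in> Y \<union> {i. i < n \<and> eval G Q ?\<phi> (e(21 := i)) (S(2 := Y))}. tm i \<in> pst ?\<Delta>"
    proof
      fix i assume i: "i \<in> Y \<union> {i. i < n \<and> eval G Q ?\<phi> (e(21 := i)) (S(2 := Y))}"
      show "tm i \<in> pst ?\<Delta>"
      proof (cases "i \<in> Y")
        case False
        with i have i': "i < n" and ev: "eval G Q ?\<phi> (e(21 := i)) (S(2 := Y))" by blast+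
        from iffD1[OF step[OF i' Y(1)] ev] obtain j where
          j: "j < n" "tm i \<in> set (arguments (tm j))" "j \<in> S X \<or> j = e g \<or> j \<in> Y"
          by blast
        show ?thesis
        proof (cases "j \<in> Y")
          case True
          show ?thesis by (rule pst_subterms[OF bspec[OF Y(2) True] arguments_subterms[OF j(2)]])
        next
          case False
          then have "tm j \<in> ?\<Delta>" using j(3) by auto
          then show ?thesis using j(2) by (rule arguments_pst)
        qed
      qed (use Y in auto)
    qed
  qed simp
  have args_Z: "j \<in> Z" if "i < n" "j < n" "tm j \<in> set (arguments (tm i))" "i \<in> S X \<or> i = e g \<or> i \<in> Z" for i j
    by (rule Z(3)[OF that(2) iffD2[OF step[OF that(2) Z(1)]]]) (use that in blast)
  have sub_Z: "j < n \<Longrightarrow> i \<in> Z \<Longrightarrow> tm j \<in> subterms A \<Longrightarrow> tm i = A \<Longrightarrow> j \<in> Z" for i j A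
  proof (induction A arbitrary: i)
    case (App h Ms)
    have i: "i < n" using App.prems(2) Z(1) by auto
    show ?case
    proof (cases "tm j = tm i")
      case True
      then show ?thesis using tm_inj[OF App.prems(1) i] App.prems(2) by blast
    next
      case False
      then obtain B where B: "B \<in> set Ms" "tm j \<in> subterms B" using App.prems by auto
      then have "B \<in> set (arguments (tm i))" using App.prems by simp
      then obtain k where k: "k < n" "tm k = B" using tm_arguments[OF i] by blast
      then have "k \<in> Z" using args_Z[of i k] i App.prems(2) B(1) App.prems(4) by auto
      from App.IH[OF B(1) App.prems(1) this B(2) k(2)] show ?thesis .
    qed
  next
    case (Name a)
    then have "tm j = tm i" "i < n" using Z(1) by auto
    then show ?case using tm_inj[OF Name(1)] Name(2) by blast
  qed
  have Z_iff: "i \<in> Z \<longleftrightarrow> tm i \<in> pst ?\<Delta>" if "i < n" for i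
  proof
    assume "tm i \<in> pst ?\<Delta>"
    then obtain N B where N: "N \<in> ?\<Delta>" "B \<in> set (arguments N)" "tm i \<in> subterms B"
      unfolding pst_iff by blast
    then obtain j where j: "j < n" "N = tm j" "j \<in> S X \<or> j = e g" using X g by auto
    obtain k where k: "k < n" "tm k = B" using tm_arguments[OF j(1)] N(2) j(2) by blast
    have "k \<in> Z" using args_Z[of j k] j k N(2) by auto
    from sub_Z[OF \<open>i < n\<close> this N(3) k(2)] show "i \<in> Z" .
  qed (use sound in simp)
  have "(\<exists>a < n. \<exists>b < n. eval G Q (Binary Sign y 23 24) (e(23 := a, 24 := b)) (S(2 := Z)) \<and> a \<in> Z \<and> b \<in> Z)
      \<longleftrightarrow> (\<exists>A B. tm (e y) = sign A B \<and> A \<in> pst ?\<Delta> \<and> B \<in> pst ?\<Delta>)" (is "?L \<longleftrightarrow> ?R")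
  proof -
    have "eval G Q (Binary Sign y 23 24) (e(23 := a, 24 := b)) (S(2 := Z)) \<longleftrightarrow> tm (e y) = sign (tm a) (tm b)"
      if "a < n" "b < n" for a b
      using eval_Binary[of "e(23 := a, 24 := b)" "S(2 := Z)" Sign] v Z(1) that names by simp
    then have "?L \<longleftrightarrow> (\<exists>a < n. \<exists>b < n. tm (e y) = sign (tm a) (tm b) \<and> tm a \<in> pst ?\<Delta> \<and> tm b \<in> pst ?\<Delta>)"
      using Z_iff by (simp cong: conj_cong)
    also have "\<dots> \<longleftrightarrow> ?R"
    proof
      assume ?R
      then obtain A C where AC: "tm (e y) = sign A C" "A \<in> pst ?\<Delta>" "C \<in> pst ?\<Delta>" by blast
      then obtain a c where "a < n" "tm a = A" "c < n" "tm c = C"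
        using pst_tm pst_image_tm[OF X g] by (metis subsetD)
      with AC show "\<exists>a < n. \<exists>b < n. tm (e y) = sign (tm a) (tm b) \<and> tm a \<in> pst ?\<Delta> \<and> tm b \<in> pst ?\<Delta>"
        by metis
    qed blast
    finally show ?thesis .
  qed
  then have "eval G Q (Keep K X g y) e S \<longleftrightarrow> e y \<in> S X \<or> e y = e g \<or> tm (e y) \<in> pst ?\<Delta> \<or> ?R"
    unfolding Z(2) using names Z_iff[OF y] by simp
  also have "\<dots> \<longleftrightarrow> tm (e y) \<in> St ?\<Delta>"
  proof -
    have "tm (e y) \<in> tm ` S X \<longleftrightarrow> e y \<in> S X" "tm (e y) = tm (e g) \<longleftrightarrow> e y = e g"
      using X y g tm_inj by (auto simp: image_iff)
    then show ?thesis unfolding St_def by auto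
  qed
  also have "\<dots> \<longleftrightarrow> e y \<in> keep (S X) (e g)" using y by (simp add: keep_def)
  finally show ?thesis .
qed

lemma sound_Keep: "sound_queries G Q keep' (Keep K X g y)"
  by (simp add: Keep_def)

lemma sound_Elem: "X \<noteq> 2 \<Longrightarrow> g \<notin> {20, 21, 22, 23, 24} \<Longrightarrow> sound_queries G elem keep (Elem K X g)"
  unfolding Elem_def sound_queries.simps
  using sound_Keep eval_Keep[of "e(20 := i)" S X g 20 for e i S] by simp

lemma eval_Elem [simp]: "eval G elem (Elem K X g) e S \<longleftrightarrow> elementary E (tm ` S X) (tm (e g))"
  by (simp add: Elem_def elem_def)

lemma sound_Right: "X \<notin> {1, 2} \<Longrightarrow> sound_queries G elem keep (Right K X x)"
  by (simp add: Right_def sound_Elem)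

lemma sound_Ac_eq: "sound_queries G elem keep (Ac_eq K k l)"
  by (simp add: Ac_eq_def sound_Elem)

lemma sound_Derivable: "sound_queries G elem keep (Derivable K)"
  by (simp add: Derivable_def Step_def sound_Right sound_Ac_eq)

text \<open>Right rules build a message from its arguments, and the arguments of a node are nodes;
  so a right derivation of a node never leaves the DAG.\<close>

lemma eval_Right:
  assumes v: "valid_env G e S" and names: "X \<noteq> 1"
  shows "eval G elem (Right K X x) e S \<longleftrightarrow> right_deriv E (tm ` S X) (tm (e x))"
proof -
  let ?D = "tm ` S X"
  let ?\<phi> = "Or (Elem K X 10) (Ex 11 (Ex 12 (And
     (Or (Binary Tup 10 11 12) (Or (Binary Enc 10 11 12) (Or (Binary Sign 10 11 12) (Binary Blind 10 11 12))))
     (And (Mem 1 11) (Mem 1 12)))))"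
  have step: "eval G elem ?\<phi> (e(10 := i)) (S(1 := Z)) \<longleftrightarrow> elementary E ?D (tm i) \<or>
      (\<exists>a < n. \<exists>b < n. (\<exists>g \<in> {Tup, Enc, Sign, Blind}. tm i = App g [tm a, tm b]) \<and> a \<in> Z \<and> b \<in> Z)"
    if "i < n" "Z \<subseteq> {..<n}" for i Z
  proof -
    have "valid_env G (e(10 := i, 11 := a, 12 := b)) (S(1 := Z))" if "a < n" "b < n" for a b
      using v that \<open>i < n\<close> \<open>Z \<subseteq> _\<close> by simp
    then show ?thesis using names by (simp add: eval_Binary cong: conj_cong)
  qed
  obtain Z where Z: "Z \<subseteq> {..<n}"
    "eval G elem (Right K X x) e S \<longleftrightarrow> eval G elem (Mem 1 x) e (S(1 := Z))"
    "\<And>i. i < n \<Longrightarrow> eval G elem ?\<phi> (e(10 := i)) (S(1 := Z)) \<Longrightarrow> i \<in> Z"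
    "\<And>P. P {} \<Longrightarrow> (\<And>Y. Y \<subseteq> {..<n} \<Longrightarrow> P Y \<Longrightarrow>
        P (Y \<union> {i. i < n \<and> eval G elem ?\<phi> (e(10 := i)) (S(1 := Y))})) \<Longrightarrow> P Z"
    unfolding Right_def by (rule Lfix_cases) blast
  have sound: "\<forall>i \<in> Z. right_deriv E ?D (tm i)"
  proof (rule Z(4))
    fix Y assume Y: "Y \<subseteq> {..<n}" "\<forall>i \<in> Y. right_deriv E ?D (tm i)"
    show "\<forall>i \<in> Y \<union> {i. i < n \<and> eval G elem ?\<phi> (e(10 := i)) (S(1 := Y))}. right_deriv E ?D (tm i)"
    proof
      fix i assume i: "i \<in> Y \<union> {i. i < n \<and> eval G elem ?\<phi> (e(10 := i)) (S(1 := Y))}"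
      show "right_deriv E ?D (tm i)"
      proof (cases "i \<in> Y")
        case False
        with i have i': "i < n" and ev: "eval G elem ?\<phi> (e(10 := i)) (S(1 := Y))" by blast+
        from iffD1[OF step[OF i' Y(1)] ev] show ?thesis
        proof (elim disjE exE conjE bexE)
          fix a b h
          assume "a \<in> Y" "b \<in> Y" "h \<in> {Tup, Enc, Sign, Blind}" "tm i = App h [tm a, tm b]"
          moreover from this have "right_deriv E ?D (tm a)" "right_deriv E ?D (tm b)" using Y(2) by auto
          ultimately show ?thesis by (auto intro: right_deriv.pR right_deriv.eR right_deriv.signR right_deriv.blindR)
        qed (rule right_deriv.id)
      qed (use Y in auto)
    qed
  qed simp
  have Zi: "i \<in> Z" if "i < n" "elementary E ?D (tm i) \<or>
      (\<exists>a < n. \<exists>b < n. (\<exists>g \<in> {Tup, Enc, Sign, Blind}. tm i = App g [tm a, tm b]) \<and> a \<in> Z \<and> b \<in> Z)" for i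
    by (rule Z(3)[OF that(1) iffD2[OF step[OF that(1) Z(1)] that(2)]])
  have complete: "right_deriv E ?D A \<Longrightarrow> i < n \<Longrightarrow> tm i = A \<Longrightarrow> i \<in> Z" for A i
  proof (induction arbitrary: i rule: right_deriv.induct)
    case (id A)
    then show ?case using Zi by blast
  next
    case (pR A B)
    then obtain a b where ab: "a < n" "tm a = A" "b < n" "tm b = B" using tm_binary[OF pR.prems] by blast
    then have "a \<in> Z" "b \<in> Z" using pR.IH by auto
    then show ?case using Zi[of i] pR.prems ab by auto
  next
    case (eR A B)
    then obtain a b where ab: "a < n" "tm a = A" "b < n" "tm b = B" using tm_binary[OF eR.prems] by blast
    then have "a \<in> Z" "b \<in> Z" using eR.IH by auto
    then show ?case using Zi[of i] eR.prems ab by auto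
  next
    case (signR A B)
    then obtain a b where ab: "a < n" "tm a = A" "b < n" "tm b = B" using tm_binary[OF signR.prems] by blast
    then have "a \<in> Z" "b \<in> Z" using signR.IH by auto
    then show ?case using Zi[of i] signR.prems ab by auto
  next
    case (blindR A B)
    then obtain a b where ab: "a < n" "tm a = A" "b < n" "tm b = B" using tm_binary[OF blindR.prems] by blast
    then have "a \<in> Z" "b \<in> Z" using blindR.IH by auto
    then show ?case using Zi[of i] blindR.prems ab by auto
  qed
  show ?thesis unfolding Z(2) using sound complete v by auto
qed

lemma eval_Ac_eq:
  assumes v: "valid_env G e S" and names: "k \<notin> {30, 31}" "l \<notin> {30, 31}"
    and pst: "tm (e k) \<in> pst (\<Gamma> \<union> {M})" "tm (e l) \<in> pst (\<Gamma> \<union> {M})"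
  shows "eval G elem (Ac_eq K k l) e S \<longleftrightarrow> ac_eq E (tm (e k)) (tm (e l))"
proof -
  have kl: "e k < n" "e l < n" using v by auto
  \<comment> \<open>At least one round takes place, because the DAG has the node
    \<open>a\<close>.\<close>
  have const: "((\<lambda>_ :: nat set. {a}) ^^ n) {} = {a}" if "a < n" for a :: nat
    using that by (cases n) auto
  have "eval G elem (Ac_eq K k l) e S \<longleftrightarrow>
      (\<exists>a < n. \<exists>b < n. tm a = sign (tm (e k)) (tm (e k)) \<and> tm b = sign (tm (e k)) (tm (e l)) \<and>
        elementary E {tm a} (tm b))"
  proof -
    have "valid_env G (e(30 := a, 31 := b)) S" if "a < n" "b < n" for a b using v that by simp
    moreover have "{i. i < n \<and> i = a} = {a}" if "a < n" for a using that by auto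
    ultimately show ?thesis
      using names by (simp add: Ac_eq_def eval_Binary const cong: conj_cong)
  qed
  also have "\<dots> \<longleftrightarrow> elementary E {sign (tm (e k)) (tm (e k))} (sign (tm (e k)) (tm (e l)))"
    using St_tm[OF St_sign[OF pst(1) pst(1)]] St_tm[OF St_sign[OF pst(1) pst(2)]] by metis
  also have "\<dots> \<longleftrightarrow> ac_eq E (tm (e k)) (tm (e l))"
    using kl tm_wf tm_normal by (intro elementary_sign_iff) auto
  finally show ?thesis .
qed

text \<open>The saturated set exceeds the subterms of the sequent only by signatures, which are
  alien. So alien arguments of \<open>E\<close>-headed nodes are factors of the sequent
  itself.\<close>

lemma E_headed_St:
  assumes "F \<in> St (\<Gamma> \<union> {M})" "E_headed E F" shows "\<exists>N \<in> \<Gamma> \<union> {M}. F \<in> subterms N"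
proof -
  from assms(1) consider "F \<in> \<Gamma> \<union> {M}" | "F \<in> pst (\<Gamma> \<union> {M})" | A B where "F = sign A B"
    unfolding St_def by blast
  then show ?thesis
  proof cases
    case 1
    then show ?thesis using subterms_refl[of F] by blast
  next
    case 2
    then show ?thesis unfolding pst_def by blast
  next
    case 3
    then show ?thesis using assms(2) by (simp add: E_headed_def)
  qed
qed

definition index_step :: "nat set \<Rightarrow> nat \<Rightarrow> bool" where
  "index_step Z i \<longleftrightarrow> tm i \<in> \<Gamma> \<or>
    (\<exists>u < n. \<exists>a < n. u \<in> Z \<and> (tm u = pair (tm i) (tm a) \<or> tm u = pair (tm a) (tm i))) \<or>
    (\<exists>u < n. \<exists>a < n. \<exists>b < n. u \<in> Z \<and> tm u = enc (tm a) (tm b) \<and> right_deriv E (tm ` Z) (tm b) \<and>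
      (i = a \<or> i = b)) \<or>
    (\<exists>u < n. \<exists>a < n. \<exists>w < n. \<exists>b < n. u \<in> Z \<and> tm u = sign (tm i) (tm a) \<and> w \<in> Z \<and>
      tm w = pub (tm b) \<and> ac_eq E (tm a) (tm b)) \<or>
    (\<exists>u < n. \<exists>a < n. \<exists>b < n. u \<in> Z \<and> tm u = blind (tm a) (tm b) \<and> right_deriv E (tm ` Z) (tm b) \<and>
      (i = a \<or> i = b)) \<or>
    (\<exists>u < n. \<exists>a < n. \<exists>k < n. \<exists>b < n. \<exists>r < n. u \<in> Z \<and> tm u = sign (tm a) (tm k) \<and>
      tm a = blind (tm b) (tm r) \<and> right_deriv E (tm ` Z) (tm r) \<and> (i = r \<or> tm i = sign (tm b) (tm k))) \<or>
    (alien E (tm i) \<and> right_deriv E (tm ` Z) (tm i) \<and>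
      (\<exists>u < n. E_headed E (tm u) \<and> tm i \<in> set (arguments (tm u))))"

lemma eval_Step:
  assumes v: "valid_env G e S" and i: "i < n" and Z: "Z \<subseteq> {..<n}"
  shows "eval G elem (Step K) (e(1 := i)) (S(0 := Z)) \<longleftrightarrow> index_step Z i"
proof -
  \<comment> \<open>\<open>eval_Ac_eq\<close> needs proper subterms; \<open>a\<close> and
    \<open>b\<close> denote such because they are arguments of the nodes \<open>u\<close> and
    \<open>w\<close>.\<close>
  have ac: "eval G elem (Ac_eq K 3 5) (e(1 := i, 2 := u, 3 := a, 4 := w, 5 := b)) (S(0 := Z)) \<longleftrightarrow>
      ac_eq E (tm a) (tm b)"
    if "u < n" "a < n" "w < n" "b < n" "tm u = sign (tm i) (tm a)" "tm w = pub (tm b)" for u a w b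
    using v i Z that tm_arg_pst[of u "tm a"] tm_arg_pst[of w "tm b"]
    by (subst eval_Ac_eq) simp_all
  show ?thesis
    unfolding Step_def index_step_def
    using v i Z
    by (simp add: eval_Binary eval_Unary eval_Right eval_Argument_tm eval_E_headed eval_In_left
        alien_def ac[unfolded One_nat_def] del: eval.simps(1,3) cong: conj_cong)
qed

lemma index_step_intros:
  "tm i \<in> \<Gamma> \<Longrightarrow> index_step Z i"
  "u < n \<Longrightarrow> u \<in> Z \<Longrightarrow> a < n \<Longrightarrow> tm u = pair (tm i) (tm a) \<or> tm u = pair (tm a) (tm i) \<Longrightarrow>
    index_step Z i"
  "u < n \<Longrightarrow> u \<in> Z \<Longrightarrow> a < n \<Longrightarrow> b < n \<Longrightarrow> tm u = enc (tm a) (tm b) \<Longrightarrow>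
    right_deriv E (tm ` Z) (tm b) \<Longrightarrow> i = a \<or> i = b \<Longrightarrow> index_step Z i"
  "u < n \<Longrightarrow> u \<in> Z \<Longrightarrow> a < n \<Longrightarrow> tm u = sign (tm i) (tm a) \<Longrightarrow> w < n \<Longrightarrow> w \<in> Z \<Longrightarrow> b < n \<Longrightarrow>
    tm w = pub (tm b) \<Longrightarrow> ac_eq E (tm a) (tm b) \<Longrightarrow> index_step Z i"
  "u < n \<Longrightarrow> u \<in> Z \<Longrightarrow> a < n \<Longrightarrow> b < n \<Longrightarrow> tm u = blind (tm a) (tm b) \<Longrightarrow>
    right_deriv E (tm ` Z) (tm b) \<Longrightarrow> i = a \<or> i = b \<Longrightarrow> index_step Z i"
  "u < n \<Longrightarrow> u \<in> Z \<Longrightarrow> a < n \<Longrightarrow> k < n \<Longrightarrow> b < n \<Longrightarrow> r < n \<Longrightarrow> tm u = sign (tm a) (tm k) \<Longrightarrow>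
    tm a = blind (tm b) (tm r) \<Longrightarrow> right_deriv E (tm ` Z) (tm r) \<Longrightarrow>
    i = r \<or> tm i = sign (tm b) (tm k) \<Longrightarrow> index_step Z i"
  "alien E (tm i) \<Longrightarrow> right_deriv E (tm ` Z) (tm i) \<Longrightarrow> u < n \<Longrightarrow> E_headed E (tm u) \<Longrightarrow>
    tm i \<in> set (arguments (tm u)) \<Longrightarrow> index_step Z i"
  unfolding index_step_def by metis+

lemma left_step_index_step:
  assumes Z: "Z \<subseteq> {..<n}" and "left_step E M (tm ` Z) A"
  shows "\<exists>i < n. tm i = A \<and> index_step Z i"
proof -
  have Zn: "\<exists>u < n. u \<in> Z \<and> tm u = N" if "N \<in> tm ` Z" for N using that Z by auto
  from assms(2) show ?thesis
  proof cases
    case (pair B C)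
    then obtain u where u: "u < n" "u \<in> Z" "tm u = pair B C" using Zn by blast
    from tm_binary[OF u(1,3)] obtain a b where ab: "a < n" "tm a = B" "b < n" "tm b = C" .
    then have "index_step Z a" "index_step Z b"
      using u index_step_intros(2)[of u Z b a] index_step_intros(2)[of u Z a b] by auto
    with pair(2) ab show ?thesis by auto
  next
    case (enc B C)
    then obtain u where u: "u < n" "u \<in> Z" "tm u = enc B C" using Zn by blast
    from tm_binary[OF u(1,3)] obtain a b where ab: "a < n" "tm a = B" "b < n" "tm b = C" .
    then have "index_step Z a" "index_step Z b"
      using u enc(2) index_step_intros(3)[of u Z a b] by auto
    with enc(3) ab show ?thesis by auto
  next
    case (sign C L)
    then obtain u w where u: "u < n" "u \<in> Z" "tm u = sign A C" "w < n" "w \<in> Z" "tm w = pub L"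
      using Zn by meson
    from tm_binary[OF u(1,3)] obtain a b where ab: "a < n" "tm a = A" "b < n" "tm b = C" .
    from tm_unary[OF u(4,6)] obtain l where l: "l < n" "tm l = L" .
    have "index_step Z a"
      using u ab l sign(3) index_step_intros(4)[of u Z b a w l] by auto
    with ab show ?thesis by auto
  next
    case (blind1 B C)
    then obtain u where u: "u < n" "u \<in> Z" "tm u = blind B C" using Zn by blast
    from tm_binary[OF u(1,3)] obtain a b where ab: "a < n" "tm a = B" "b < n" "tm b = C" .
    then have "index_step Z a" "index_step Z b"
      using u blind1(2) index_step_intros(5)[of u Z a b] by auto
    with blind1(3) ab show ?thesis by auto
  next
    case (blind2 B R C)
    then obtain u where u: "u < n" "u \<in> Z" "tm u = sign (blind B R) C" using Zn by blast
    from tm_binary[OF u(1,3)] obtain a c where ac: "a < n" "tm a = blind B R" "c < n" "tm c = C" .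
    from tm_binary[OF ac(1,2)] obtain b r where br: "b < n" "tm b = B" "r < n" "tm r = R" .
    \<comment> \<open>\<open>sign B C\<close> need not be a subterm of the sequent, but its
      arguments are proper subterms, so the signature part of \<open>St\<close> provides a node for
      it.\<close>
    have "tm b \<in> pst (\<Gamma> \<union> {M})" by (rule pst_subterms[OF tm_arg_pst[OF u(1)]]) (use u br in auto)
    moreover have "tm c \<in> pst (\<Gamma> \<union> {M})" by (rule tm_arg_pst[OF u(1)]) (use u ac in simp)
    ultimately obtain q where q: "q < n" "tm q = sign B C" using St_tm[OF St_sign] br ac by metis
    have "index_step Z q" "index_step Z r"
      using u ac br q blind2(2) index_step_intros(6)[of u Z a c b r] by auto
    with blind2(3) q br show ?thesis by auto
  next
    case (factor N)
    then obtain F where F: "F \<in> subterms N" "E_headed E F" "A \<in> set (arguments F)" "alien E A"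
      by (auto simp: factor_def immediate_subterm_def)
    have "N \<in> St (\<Gamma> \<union> {M})" using factor(1) Z tm_St by (auto intro: St_base)
    then have "F \<in> St (\<Gamma> \<union> {M})" using subterms_St[OF _ F(1)] St_pst by blast
    then obtain u where u: "u < n" "tm u = F" using St_tm by blast
    then obtain i where i: "i < n" "tm i = A" using tm_arguments F(3) by blast
    have "index_step Z i" using u F i factor(3) index_step_intros(7)[of i Z u] by auto
    with i show ?thesis by auto
  qed
qed

text \<open>\<open>\<Gamma>\<close> is added on the left because the factor disjunct sees all nodes,
  including subterms of members of \<open>\<Gamma>\<close> that \<open>Z\<close> does not
  contain.\<close>

lemma index_step_left_step:
  assumes Z: "Z \<subseteq> {..<n}" and i: "i < n" and st: "index_step Z i"
  shows "tm i \<in> \<Gamma> \<or> left_step E M (\<Gamma> \<union> tm ` Z) (tm i)"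
proof -
  have Zm: "u \<in> Z \<Longrightarrow> tm u = N \<Longrightarrow> N \<in> \<Gamma> \<union> tm ` Z" for u N by auto
  have rd: "right_deriv E (tm ` Z) A \<Longrightarrow> right_deriv E (\<Gamma> \<union> tm ` Z) A" for A
    by (erule right_deriv_mono) auto
  from st[unfolded index_step_def] show ?thesis
  proof (elim disjE exE conjE)
    fix u assume u: "alien E (tm i)" "right_deriv E (tm ` Z) (tm i)" "u < n" "E_headed E (tm u)"
      "tm i \<in> set (arguments (tm u))"
    then obtain N where "N \<in> \<Gamma> \<union> {M}" "tm u \<in> subterms N" using E_headed_St tm_St by blast
    moreover from this have "factor E (tm i) N"
      unfolding factor_def using u
      by (auto simp: immediate_subterm_def E_headed_def intro!: bexI[of _ "tm u"]
          intro: subterms_trans[OF arguments_subterms])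
    ultimately show ?thesis using rd[OF u(2)] by (auto intro: left_step.factor)
  next
    fix u a assume "u \<in> Z" "tm u = pair (tm i) (tm a)"
    from left_step.pair[OF Zm[OF this], of "tm i"] show ?thesis by simp
  next
    fix u a assume "u \<in> Z" "tm u = pair (tm a) (tm i)"
    from left_step.pair[OF Zm[OF this], of "tm i"] show ?thesis by simp
  next
    fix u a b assume u: "u \<in> Z" "tm u = enc (tm a) (tm b)" "right_deriv E (tm ` Z) (tm b)" "i = a"
    from left_step.enc[OF Zm[OF u(1,2)] rd[OF u(3)], of "tm i"] u(4) show ?thesis by simp
  next
    fix u a b assume u: "u \<in> Z" "tm u = enc (tm a) (tm b)" "right_deriv E (tm ` Z) (tm b)" "i = b"
    from left_step.enc[OF Zm[OF u(1,2)] rd[OF u(3)], of "tm i"] u(4) show ?thesis by simp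
  next
    fix u a w b assume u: "u \<in> Z" "tm u = sign (tm i) (tm a)" "w \<in> Z" "tm w = pub (tm b)"
      "ac_eq E (tm a) (tm b)"
    from left_step.sign[OF Zm[OF u(1,2)] Zm[OF u(3,4)] u(5)] show ?thesis by simp
  next
    fix u a b assume u: "u \<in> Z" "tm u = blind (tm a) (tm b)" "right_deriv E (tm ` Z) (tm b)" "i = a"
    from left_step.blind1[OF Zm[OF u(1,2)] rd[OF u(3)], of "tm i"] u(4) show ?thesis by simp
  next
    fix u a b assume u: "u \<in> Z" "tm u = blind (tm a) (tm b)" "right_deriv E (tm ` Z) (tm b)" "i = b"
    from left_step.blind1[OF Zm[OF u(1,2)] rd[OF u(3)], of "tm i"] u(4) show ?thesis by simp
  next
    fix u a k b r assume u: "u \<in> Z" "tm u = sign (tm a) (tm k)" "tm a = blind (tm b) (tm r)"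
      "right_deriv E (tm ` Z) (tm r)" "i = r"
    from left_step.blind2[OF Zm[OF u(1,2)[unfolded u(3)]] rd[OF u(4)], of "tm i"] u(5)
    show ?thesis by simp
  next
    fix u a k b r assume u: "u \<in> Z" "tm u = sign (tm a) (tm k)" "tm a = blind (tm b) (tm r)"
      "right_deriv E (tm ` Z) (tm r)" "tm i = sign (tm b) (tm k)"
    from left_step.blind2[OF Zm[OF u(1,2)[unfolded u(3)]] rd[OF u(4)], of "tm i"] u(5)
    show ?thesis by simp
  qed simp
qed

theorem eval_Derivable:
  assumes v: "valid_env G e S"
  shows "eval G elem (Derivable K) e S \<longleftrightarrow> L_deriv E \<Gamma> M"
proof -
  obtain m where m: "m < n" "tm m = M" using St_tm[OF St_base, of M] by auto
  have v': "valid_env G (e(7 := m)) S" using v m by simp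
  have goal: "i = m" if "i < n" "tm i = M" for i using that m tm_inj by auto
  obtain Z where Z: "Z \<subseteq> {..<n}"
    "eval G elem (Lfix 0 1 (Step K) (Right K 0 7)) (e(7 := m)) S \<longleftrightarrow>
      eval G elem (Right K 0 7) (e(7 := m)) (S(0 := Z))"
    "\<And>i. i < n \<Longrightarrow> eval G elem (Step K) (e(7 := m, 1 := i)) (S(0 := Z)) \<Longrightarrow> i \<in> Z"
    "\<And>P. P {} \<Longrightarrow> (\<And>Y. Y \<subseteq> {..<n} \<Longrightarrow> P Y \<Longrightarrow>
        P (Y \<union> {i. i < n \<and> eval G elem (Step K) (e(7 := m, 1 := i)) (S(0 := Y))})) \<Longrightarrow> P Z"
    by (rule Lfix_cases) blast
  have "eval G elem (Is_goal 7) (e(7 := i)) S \<longleftrightarrow> i = m" if "i < n" for i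
  proof -
    have "valid_env G (e(7 := i)) S" using v that by simp
    then have "eval G elem (Is_goal 7) (e(7 := i)) S \<longleftrightarrow> tm i = M"
      by (simp only: eval_Is_goal fun_upd_same)
    then show ?thesis using goal[OF that] m(2) by blast
  qed
  then have "eval G elem (Derivable K) e S \<longleftrightarrow>
      (\<exists>i < n. i = m \<and> eval G elem (Lfix 0 1 (Step K) (Right K 0 7)) (e(7 := i)) S)"
    unfolding Derivable_def eval.simps(8,9) by (simp del: eval.simps cong: conj_cong)
  also have "\<dots> \<longleftrightarrow> eval G elem (Lfix 0 1 (Step K) (Right K 0 7)) (e(7 := m)) S"
    using m(1) by blast
  also note Z(2)
  also have "eval G elem (Right K 0 7) (e(7 := m)) (S(0 := Z)) \<longleftrightarrow> right_deriv E (tm ` Z) M"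
    using v m Z(1) by (simp add: eval_Right)
  also have "\<dots> \<longleftrightarrow> L_deriv E \<Gamma> M"
  proof
    assume "right_deriv E (tm ` Z) M"
    then have "L_deriv E (\<Gamma> \<union> tm ` Z) M" by (intro L_deriv.r) (auto elim: right_deriv_mono)
    \<comment> \<open>Induction over the stages: what is derivable after some rounds was derivable
      from \<open>\<Gamma>\<close> alone, since each round consists of left steps and members of
      \<open>\<Gamma>\<close>.\<close>
    moreover have "L_deriv E (\<Gamma> \<union> tm ` Z) M \<longrightarrow> L_deriv E \<Gamma> M"
    proof (rule Z(4))
      fix Y assume Y: "Y \<subseteq> {..<n}" "L_deriv E (\<Gamma> \<union> tm ` Y) M \<longrightarrow> L_deriv E \<Gamma> M"
      let ?W = "{i. i < n \<and> eval G elem (Step K) (e(7 := m, 1 := i)) (S(0 := Y))}"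
      show "L_deriv E (\<Gamma> \<union> tm ` (Y \<union> ?W)) M \<longrightarrow> L_deriv E \<Gamma> M"
      proof
        assume *: "L_deriv E (\<Gamma> \<union> tm ` (Y \<union> ?W)) M"
        have "L_deriv E (\<Gamma> \<union> tm ` Y) M"
        proof (rule left_steps_sound[of "tm ` ?W - \<Gamma>"])
          show "left_step E M (\<Gamma> \<union> tm ` Y) A" if "A \<in> tm ` ?W - \<Gamma>" for A
            using that index_step_left_step[OF Y(1)] eval_Step[OF v' _ Y(1)] by auto
          have "\<Gamma> \<union> tm ` (Y \<union> ?W) = \<Gamma> \<union> tm ` Y \<union> (tm ` ?W - \<Gamma>)" by auto
          with * show "L_deriv E (\<Gamma> \<union> tm ` Y \<union> (tm ` ?W - \<Gamma>)) M" by simp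
        qed simp
        then show "L_deriv E \<Gamma> M" using Y(2) by blast
      qed
    qed simp
    ultimately show "L_deriv E \<Gamma> M" by blast
  next
    assume L: "L_deriv E \<Gamma> M"
    show "right_deriv E (tm ` Z) M"
    proof (rule L_deriv_closed[OF L])
      show "\<Gamma> \<subseteq> tm ` Z"
      proof
        fix A assume "A \<in> \<Gamma>"
        moreover from this obtain i where "i < n" "tm i = A" using St_tm[OF St_base, of A] by auto
        ultimately show "A \<in> tm ` Z" using Z(3)[of i] eval_Step[OF v' _ Z(1)]
          by (auto simp: index_step_def)
      qed
      show "A \<in> tm ` Z" if "left_step E M (tm ` Z) A" for A
        using left_step_index_step[OF Z(1) that] Z(3) eval_Step[OF v' _ Z(1)] by blast
    qed
  qed
  finally show ?thesis .
qed

end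

section \<open>Queries\<close>

context sequent_dag
begin

text \<open>Names have no proper subterms, so the fresh ones enlarge the saturated set of the query
  exactly by themselves, one for each discarded node. Kept nodes have kept children because
  \<open>St\<close> contains the arguments of its members.\<close>

lemma query_represents:
  assumes X: "X \<subseteq> {..<n}" and g: "g < n"
  obtains A where "finite A" "\<And>i. i < n \<Longrightarrow> names (tm i) \<inter> A = {}"
    "represents (query_dag G (keep X g) X g) (tm ` X \<union> Name ` A) (tm g)"
proof -
  let ?S = "St (tm ` X \<union> {tm g})" and ?K = "keep X g"
  have "finite (\<Union>i < n. names (tm i))" by simp
  then obtain m where m: "\<forall>a \<in> (\<Union>i < n. names (tm i)). a < m"
    unfolding finite_nat_set_iff_bounded by blast
  \<comment> \<open>All names in the DAG are below \<open>m\<close>, so the offset gives each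
    discarded node a fresh name of its own.\<close>
  define A where "A = (\<lambda>i. m + i) ` ({..<n} - ?K)"
  have fresh: "names (tm i) \<inter> A = {}" if "i < n" for i
    using m that by (fastforce simp: A_def)
  then have fresh': "Name a \<noteq> tm i" if "i < n" "a \<in> A" for i a
    using that by (metis disjoint_iff names.simps(1) singletonI)
  define tm' where "tm' i = (if i \<in> ?K then tm i else Name (m + i))" for i
  have A: "m + i \<in> A" if "i < n" "i \<notin> ?K" for i using that by (simp add: A_def)
  have S: "?S \<subseteq> St (\<Gamma> \<union> {M})" by (rule St_least[OF image_tm_St[OF X g]])
  have XK: "X \<subseteq> ?K" and gK: "g \<in> ?K" using X g St_base by (auto simp: keep_def)
  have pst: "pst (tm ` X \<union> Name ` A \<union> {tm g}) = pst (tm ` X \<union> {tm g})"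
    by (auto simp: pst_def)
  have St: "St (tm ` X \<union> Name ` A \<union> {tm g}) = ?S \<union> Name ` A"
    unfolding St_def pst by auto
  have inj: "inj_on tm' {..<n}"
  proof (rule inj_onI)
    fix i j assume "i \<in> {..<n}" "j \<in> {..<n}" "tm' i = tm' j"
    then show "i = j"
      using tm_inj[of i j] fresh'[of i "m + j"] fresh'[of j "m + i"] A[of i] A[of j]
      by (cases "i \<in> ?K"; cases "j \<in> ?K") (auto simp: tm'_def)
  qed
  have img: "tm' ` {..<n} = ?S \<union> Name ` A"
  proof
    show "tm' ` {..<n} \<subseteq> ?S \<union> Name ` A"
      using A by (auto simp: tm'_def keep_def)
    show "?S \<union> Name ` A \<subseteq> tm' ` {..<n}"
    proof
      fix N assume "N \<in> ?S \<union> Name ` A"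
      then consider "N \<in> ?S" | "N \<in> Name ` A" by blast
      then show "N \<in> tm' ` {..<n}"
      proof cases
        case 1
        then obtain i where i: "i < n" "tm i = N" using S St_tm by blast
        then have "tm' i = N" using 1 by (simp add: tm'_def keep_def)
        then show ?thesis using i by auto
      next
        case 2
        then obtain i where "i < n" "i \<notin> ?K" "N = Name (m + i)" by (auto simp: A_def)
        then show ?thesis by (auto simp: tm'_def)
      qed
    qed
  qed
  have "represents (query_dag G ?K X g) (tm ` X \<union> Name ` A) (tm g)"
    unfolding represents_def
  proof (intro exI[of _ tm'] conjI allI impI)
    show "bij_betw tm' {..<length (query_dag G ?K X g)} (St (tm ` X \<union> Name ` A \<union> {tm g}))"
      unfolding bij_betw_def St using inj img by (simp add: query_dag_def)
    fix i assume "i < length (query_dag G ?K X g)"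
    then have i: "i < n" by (simp add: query_dag_def)
    let ?v = "query_dag G ?K X g ! i"
    show "root_sym (tm' i) = node_sym ?v"
      using i node[OF i] by (simp add: query_dag_def tm'_def)
    show "set (children ?v) \<subseteq> {..<length (query_dag G ?K X g)}"
      using i node[OF i] by (simp add: query_dag_def)
    show "arguments (tm' i) = map tm' (children ?v)"
    proof (cases "i \<in> ?K")
      case True
      have args: "arguments (tm i) = map tm (children (G ! i))" "set (children (G ! i)) \<subseteq> {..<n}"
        using node[OF i] by auto
      have "c \<in> ?K" if "c \<in> set (children (G ! i))" for c
      proof -
        have "tm c \<in> set (arguments (tm i))" "c < n" using args that by auto
        moreover have "tm i \<in> ?S" using True by (simp add: keep_def)
        ultimately show ?thesis using St_arguments[of "tm i"] St_pst by (simp add: keep_def)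
      qed
      then show ?thesis using True i args by (simp add: query_dag_def tm'_def)
    qed (use i in \<open>simp add: query_dag_def tm'_def\<close>)
    show "in_left ?v \<longleftrightarrow> tm' i \<in> tm ` X \<union> Name ` A"
    proof (cases "i \<in> ?K")
      case True
      have "tm i \<in> tm ` X \<longleftrightarrow> i \<in> X" using tm_inj i X by (auto simp: image_iff)
      moreover have "tm i \<notin> Name ` A" using fresh'[OF i] by (metis imageE)
      ultimately show ?thesis using True i by (simp add: query_dag_def tm'_def)
    qed (use i A in \<open>simp add: query_dag_def tm'_def\<close>)
    show "is_goal ?v \<longleftrightarrow> tm' i = tm g"
      using i g tm_inj[OF i g] fresh'[OF g A[OF i]] by (simp add: query_dag_def tm'_def)
  qed
  moreover have "finite A" by (simp add: A_def)
  ultimately show thesis using fresh that by blast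
qed

text \<open>The padded query has exactly \<open>n\<close> nodes, so the bound \<open>T n\<close>
  applies as it stands, and the answer is that of the unpadded problem.\<close>

lemma query_answers:
  assumes p: "\<And>\<Gamma> M G. normal_sequent E \<Gamma> M \<Longrightarrow> represents G \<Gamma> M \<Longrightarrow>
      \<exists>t \<le> T (card (St (\<Gamma> \<union> {M}))). answers p (tree_of_dag G) t (elementary E \<Gamma> M)"
    and X: "X \<subseteq> {..<n}" and g: "g < n"
  shows "\<exists>t \<le> T n. answers p (tree_of_dag (query_dag G (keep X g) X g)) t (elem X g)"
proof -
  obtain A where A: "finite A" "\<And>i. i < n \<Longrightarrow> names (tm i) \<inter> A = {}"
    "represents (query_dag G (keep X g) X g) (tm ` X \<union> Name ` A) (tm g)"
    using query_represents[OF X g] by blast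
  have "finite X" using X finite_subset by blast
  then have "normal_sequent E (tm ` X \<union> Name ` A) (tm g)"
    using A(1) X g tm_wf tm_normal by (auto simp: normal_sequent_def)
  then obtain t where t: "t \<le> T (card (St (tm ` X \<union> Name ` A \<union> {tm g})))"
    "answers p (tree_of_dag (query_dag G (keep X g) X g)) t (elementary E (tm ` X \<union> Name ` A) (tm g))"
    using p A(3) by blast
  have "card (St (tm ` X \<union> Name ` A \<union> {tm g})) = n"
    using A(3) bij_betw_same_card by (fastforce simp: represents_def query_dag_def)
  moreover have "elementary E (tm ` X \<union> Name ` A) (tm g) = elem X g"
    unfolding elem_def
    by (rule elementary_fresh_names) (use A(2) X g tm_wf tm_normal in auto)
  ultimately show ?thesis using t by auto
qed

end

section \<open>The decision procedure\<close>

context query_machine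
begin

definition count_body :: com where
  "count_body = Seq (Assign (tp 0) (Cons_expr (Var (tp 3)) (Var (tp 0))))
     (Seq (Assign (tp 3) (Cons_expr Nil_expr (Var (tp 3)))) (Assign (tp 2) (Tl (Var (tp 2)))))"

definition init :: com where
  "init = Seq (Assign (tp 1) (Var 0)) (Seq (Assign (tp 2) (Var 0)) (While (Var (tp 2)) count_body))"

lemma runs_count:
  assumes "s (tp 2) = tree_of_list xs" "s (tp 0) = idx_list k" "s (tp 3) = tree_of_nat k"
    "2 + length xs * 20 \<le> b"
  shows "runs (While (Var (tp 2)) count_body) b s
    (\<lambda>s'. s' (tp 0) = idx_list (k + length xs) \<and> (\<forall>v. v \<notin> {tp 0, tp 2, tp 3} \<longrightarrow> s' v = s v))"
  using assms
proof (induction xs arbitrary: s k b)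
  case Nil
  then show ?case by (intro runs_While_end) auto
next
  case (Cons x xs)
  let ?s = "s(tp 0 := idx_list (Suc k), tp 3 := tree_of_nat (Suc k), tp 2 := tree_of_list xs)"
  show ?case
  proof (rule runs_While_step[where a = 12 and b' = "2 + length xs * 20" and P = "\<lambda>s'. s' = ?s"], goal_cases)
    case 2
    show ?case
      unfolding count_body_def
      by (intro runs_Assign_Seq runs_Assign) (use Cons.prems in auto)
  next
    case (3 s')
    have "runs (While (Var (tp 2)) count_body) (2 + length xs * 20) ?s
      (\<lambda>s'. s' (tp 0) = idx_list (Suc k + length xs) \<and> (\<forall>v. v \<notin> {tp 0, tp 2, tp 3} \<longrightarrow> s' v = ?s v))"
      by (rule Cons.IH) auto
    then show ?case unfolding 3 by (rule runs_mono) auto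
  qed (use Cons.prems in auto)
qed

text \<open>A blank variable reads as node 0 or as the empty set, so the blank store already
  represents an environment; node 0 exists because the DAG is nonempty.\<close>

lemma runs_init:
  assumes "0 < length G" "10 + length G * 20 \<le> b"
  shows "runs init b ((\<lambda>_. Atom)(0 := tree_of_dag G)) (state G (\<lambda>_. 0) (\<lambda>_. {}))"
proof -
  let ?s = "((\<lambda>_. Atom)(0 := tree_of_dag G))(tp 1 := tree_of_dag G, tp 2 := tree_of_dag G)"
  have tl: "(tl_tree ^^ i) Atom = Atom" for i by (induction i) auto
  show ?thesis
    unfolding init_def
  proof (intro runs_Assign_Seq, goal_cases)
    case 3
    have "runs (While (Var (tp 2)) count_body) (2 + length G * 20) ?s
      (\<lambda>s'. s' (tp 0) = idx_list (0 + length (map tree_of_node G)) \<and>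
        (\<forall>v. v \<notin> {tp 0, tp 2, tp 3} \<longrightarrow> s' v = ?s v))"
      by (rule runs_count) (auto simp: tree_of_dag_def)
    then have "runs (While (Var (tp 2)) count_body) (b - Suc (Suc (Suc (Suc 0)))) ?s (state G (\<lambda>_. 0) (\<lambda>_. {}))"
      by (rule runs_mono) (use assms tl in \<open>auto simp: state_def valid_env_def set_rep_def\<close>)
    then show ?case by simp
  qed (use assms in auto)
qed

end

theorem theorem4p10:
  fixes E :: eq_theory and f :: "nat \<Rightarrow> real"
  assumes "convergent_theory E"
    and "decidable_in_time E (elementary E) f"
  shows "\<exists>k :: nat. decidable_in_time E (L_deriv E) (\<lambda>n. real n ^ k * f n)"
proof -
  interpret convergent E by standard (rule assms(1))
  obtain p T where T: "(\<lambda>n. real (T n)) \<in> O(f)" and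
    p: "\<And>\<Gamma> M G. normal_sequent E \<Gamma> M \<Longrightarrow> represents G \<Gamma> M \<Longrightarrow>
      \<exists>t \<le> T (card (St (\<Gamma> \<union> {M}))). answers p (tree_of_dag G) t (elementary E \<Gamma> M)"
    using assms(2) unfolding decidable_in_time_def by blast
  \<comment> \<open>Inserting 1 makes \<open>B\<close> exceed the input and output variables 0 and 1
    as well.\<close>
  define B where "B = Suc (Max (insert 1 (com_vars p)))"
  interpret query_machine p T B
  proof
    show "com_vars p \<subseteq> {..<B}" "2 \<le> B" by (auto simp: B_def less_Suc_eq_le Max_ge_iff)
  qed
  \<comment> \<open>The 2 covers the constructors, also when \<open>sig E\<close> is empty.\<close>
  define K where "K = Max (insert 2 (arity E ` sig E))"
  have K: "2 \<le> K" "\<And>f. f \<in> sig E \<Longrightarrow> arity E f \<le> K"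
    using finite_sig by (auto simp: K_def)
  obtain b where b: "poly_bound T b" and
    comp: "\<And>d G Q keep. 2 \<le> d \<Longrightarrow> queries_ok G Q keep \<Longrightarrow> sound_queries G Q keep (Derivable K) \<Longrightarrow>
      computes G Q d (Derivable K) (b (length G))"
    using compile_correct[of "Derivable K"] by blast
  \<comment> \<open>\<open>10 + n * 20\<close> pays for \<open>init\<close>, the last 2 for copying
    the answer to variable 1.\<close>
  define time where "time n = 10 + n * 20 + b n + 2" for n
  have "poly_bound T time"
    unfolding time_def by (intro poly_bound_intros b)
  then obtain C k where C: "\<And>n. time n \<le> C * (n + 1) ^ k * (T n + 1)"
    unfolding poly_bound_def by blast
  define q where "q = Seq init (Seq (compile 2 (Derivable K)) (Assign 1 (Var (tp 2))))"
  define occurs where "occurs n \<longleftrightarrow> (\<exists>\<Gamma> M G. normal_sequent E \<Gamma> M \<and> represents G \<Gamma> M \<and>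
    card (St (\<Gamma> \<union> {M})) = n)" for n
  \<comment> \<open>At sizes that no sequent has, \<open>f n\<close> may vanish, and then no
    positive time would be bounded by a multiple of it.\<close>
  define T' where "T' n = (if occurs n then time n else 0)" for n
  have T_pos: "1 \<le> T n" if occ: "occurs n" for n
  proof -
    obtain \<Gamma> M G where "normal_sequent E \<Gamma> M" "represents G \<Gamma> M" "card (St (\<Gamma> \<union> {M})) = n"
      using occ unfolding occurs_def by blast
    then obtain t where t: "t \<le> T n" "answers p (tree_of_dag G) t (elementary E \<Gamma> M)"
      using p by blast
    then have "0 < t" using exec_pos unfolding answers_def by blast
    then show ?thesis using t(1) by simp
  qed
  have "decidable_in_time E (L_deriv E) (\<lambda>n. real n ^ k * f n)"
    unfolding decidable_in_time_def
  proof (intro exI[of _ q] exI[of _ T'] conjI allI impI)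
    obtain c where c: "0 < c" "eventually (\<lambda>n. norm (real (T n)) \<le> c * norm (f n)) sequentially"
      using T by (elim landau_o.bigE) blast
    show "(\<lambda>n. real (T' n)) \<in> O(\<lambda>n. real n ^ k * f n)"
    proof (rule bigoI)
      show "eventually (\<lambda>n. norm (real (T' n)) \<le> (C * 2 ^ k * 2 * c) * norm (real n ^ k * f n)) sequentially"
        using c(2) eventually_gt_at_top[of 0]
      proof eventually_elim
        case (elim n)
        show ?case
        proof (cases "occurs n")
          case True
          \<comment> \<open>Here \<open>n + 1 \<le> 2 * n\<close> because \<open>n\<close> is
            positive, and \<open>T n + 1 \<le> 2 * T n\<close> by \<open>T_pos\<close>.\<close>
          have "time n \<le> C * (2 * n) ^ k * (2 * T n)"
            by (rule order_trans[OF C]) (use T_pos[OF True] elim in \<open>intro mult_le_mono power_mono; simp\<close>)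
          then have "real (time n) \<le> real (C * (2 * n) ^ k * (2 * T n))"
            using of_nat_mono by blast
          also have "\<dots> = C * 2 ^ k * 2 * real n ^ k * real (T n)"
            by (simp add: power_mult_distrib)
          also have "\<dots> \<le> C * 2 ^ k * 2 * real n ^ k * (c * \<bar>f n\<bar>)"
            using elim by (intro mult_left_mono) auto
          finally show ?thesis using True by (simp add: T'_def abs_mult mult_ac)
        qed (use c in \<open>simp add: T'_def\<close>)
      qed
    qed
    fix \<Gamma> M G assume ns: "normal_sequent E \<Gamma> M" and rep: "represents G \<Gamma> M"
    obtain tm where tm: "bij_betw tm {..<length G} (St (\<Gamma> \<union> {M}))"
      "\<And>i. i < length G \<Longrightarrow>
        root_sym (tm i) = node_sym (G ! i) \<and> set (children (G ! i)) \<subseteq> {..<length G} \<and>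
        arguments (tm i) = map tm (children (G ! i)) \<and> (in_left (G ! i) \<longleftrightarrow> tm i \<in> \<Gamma>) \<and>
        (is_goal (G ! i) \<longleftrightarrow> tm i = M)"
      using rep unfolding represents_def by blast
    interpret sequent_dag E \<Gamma> M G tm K
      by standard (use ns tm K in auto)
    have card: "card (St (\<Gamma> \<union> {M})) = n" using bij_betw_same_card[OF tm(1)] by simp
    have "occurs n" unfolding occurs_def using ns rep card by blast
    then have T'n: "T' n = time n" by (simp add: T'_def)
    have n: "0 < n" using St_tm[OF St_base, of M] by auto
    have ok: "queries_ok G elem keep"
      unfolding queries_ok_def using query_answers[of T p, OF p] tm(2) by blast
    let ?s = "(\<lambda>_. Atom)(0 := tree_of_dag G)"
    have "runs q (time n) ?s (\<lambda>s'. s' 1 \<noteq> Atom \<longleftrightarrow> L_deriv E \<Gamma> M)"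
      unfolding q_def
    proof (rule runs_Seq[OF runs_init[OF n order_refl]])
      fix s assume s: "state G (\<lambda>_. 0) (\<lambda>_. {}) s"
      have "valid_env G (\<lambda>_. 0) (\<lambda>_. {})" using s by (simp add: state_def)
      note eval = eval_Derivable[OF this]
      show "runs (Seq (compile 2 (Derivable K)) (Assign 1 (Var (tp 2)))) (time n - (10 + n * 20)) s
          (\<lambda>s'. s' 1 \<noteq> Atom \<longleftrightarrow> L_deriv E \<Gamma> M)"
      proof (rule runs_Seq[OF computesD[OF comp[OF order_refl ok sound_Derivable] s]], goal_cases)
        case (2 s')
        then show ?case by (intro runs_Assign) (auto simp: eval time_def)
      qed (simp add: time_def)
    qed (simp add: time_def)
    then show "\<exists>t \<le> T' (card (St (\<Gamma> \<union> {M}))). answers q (tree_of_dag G) t (L_deriv E \<Gamma> M)"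
      unfolding card T'n runs_def answers_def by blast
  qed
  then show ?thesis by blast
qed

end
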